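(* Let $\phi\colon\mathbb{R}\to\mathbb{R}$ be an increasing homeomorphism with $\phi(0)=0$, $f,q\colon\mathbb{R}\to\mathbb{R}$ continuous, $a\in L^\infty(0,T)$ with $a(t)\ge0$ a.e. and $\bar a:=\frac1T\int_0^Ta>0$, and $e\in L^1(0,T)$ with $\frac1T\int_0^Te=0$. Assume the limits $\omega_\pm:=\lim_{u\to\pm\infty}q(u)\in[-\infty,+\infty]$ exist. Consider $$(\phi(u'))'+f(u)u'+a(t)q(u)=s+e(t).\qquad(\mathscr{W\!E}_s)$$ Assume there exists $u_0\in\mathbb{R}$ with $0\ge q(u_0)>\max\{\omega_+,\omega_-\}$ and $$\bar a\max\{\omega_-,\omega_+\}<\|a\|_\infty q(u_0)-\|e^+\|_\infty.$$ Then there exists $s_0\in\,]\bar a\omega_-,+\infty[$ such that: for $s>s_0$, $(\mathscr{W\!E}_s)$ has no $T$-periodic solutions; for $s=s_0$, at least one; for $\bar a\omega_-<s<s_0$, at least one; for $\bar a\max\{\omega_-,\omega_+\}<s<s_0$, at least two $T$-periodic solutions.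
   Context: $e^+$ is the positive part of $e$. A $T$-periodic solution is $u\in\mathcal{C}^1([0,T])$ with $u(0)=u(T)$, $u'(0)=u'(T)$, $\phi(u')$ absolutely continuous, satisfying the equation a.e. Products such as $\bar a\cdot(-\infty)$ are $-\infty$. *)

theory Defs
  imports "HOL-Analysis.Analysis" "HOL-Probability.Essential_Supremum"
begin

definition abs_cont_on :: "real \<Rightarrow> real \<Rightarrow> (real \<Rightarrow> real) \<Rightarrow> bool" where
  "abs_cont_on a b g \<longleftrightarrow>
     (\<forall>\<epsilon>>0. \<exists>\<delta>>0. \<forall>(n::nat) (x::nat \<Rightarrow> real) (y::nat \<Rightarrow> real).
        (\<forall>i<n. a \<le> x i \<and> x i \<le> y i \<and> y i \<le> b) \<and>
        (\<forall>i<n. \<forall>j<n. i \<noteq> j \<longrightarrow> y i \<le> x j \<or> y j \<le> x i) \<and>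
        (\<Sum>i<n. y i - x i) < \<delta>
        \<longrightarrow> (\<Sum>i<n. \<bar>g (y i) - g (x i)\<bar>) < \<epsilon>)"

definition Linf_norm :: "real \<Rightarrow> (real \<Rightarrow> real) \<Rightarrow> ereal" where
  "Linf_norm T g = esssup (restrict_space lebesgue {0..T}) (\<lambda>t. ereal \<bar>g t\<bar>)"

definition periodic_solution ::
  "real \<Rightarrow> (real \<Rightarrow> real) \<Rightarrow> (real \<Rightarrow> real) \<Rightarrow> (real \<Rightarrow> real) \<Rightarrow> (real \<Rightarrow> real)
    \<Rightarrow> (real \<Rightarrow> real) \<Rightarrow> real \<Rightarrow> (real \<Rightarrow> real) \<Rightarrow> bool" where
  "periodic_solution T phi f a q e s u \<longleftrightarrow>
     (\<exists>u'. (\<forall>t\<in>{0..T}. (u has_real_derivative u' t) (at t within {0..T})) \<and>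
           continuous_on {0..T} u' \<and>
           u 0 = u T \<and> u' 0 = u' T \<and>
           abs_cont_on 0 T (\<lambda>t. phi (u' t)) \<and>
           (AE t in lebesgue. t \<in> {0..T} \<longrightarrow>
              ((\<lambda>r. phi (u' r)) has_real_derivative
                 (s + e t - f (u t) * u' t - a t * q (u t))) (at t within {0..T})))"

end

theory Submission
  imports Defs "HOL-Complex_Analysis.Great_Picard"
begin

text \<open>
  With a primitive \<open>F\<close> of \<open>f\<close>, a solution is a \<open>C\<^sup>1\<close> periodic function for which
  \<open>\<phi> (u') + F u\<close> is a primitive of \<open>s + e - a q(u)\<close>. For a periodic \<open>C\<^sup>1\<close> function \<open>u\<^sub>*\<close> that is a
  lower solution at some level \<open>s\<^sub>* > s\<close>, regard the level as an unknown and prescribe instead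
  \<open>c = min (u - u\<^sub>*)\<close>. At \<open>c = 0\<close> the function \<open>u\<close> touches \<open>u\<^sub>*\<close> from above, which forces the
  level to be at least \<open>s\<^sub>*\<close>; for \<open>c\<close> far away in the direction of \<open>\<omega>\<^sub>\<plusminus>\<close> the mean value of
  \<open>a q(u)\<close>, hence the level, is below \<open>s\<close>, because the oscillation of solutions is bounded a priori. A
  Schauder argument in \<open>(c, u)\<close> therefore produces a solution at level \<open>s\<close> with \<open>c < 0\<close> if
  \<open>s\<close> exceeds the mean of \<open>a\<close> times \<open>\<omega>\<^sub>-\<close>, and another one with \<open>c > 0\<close> if it also exceeds that of
  \<open>\<omega>\<^sub>+\<close>. The constant \<open>u\<^sub>0\<close> is a lower solution that starts the argument, the solvable
  levels are bounded above because \<open>q\<close> is, and a solution at their supremum \<open>s\<^sub>0\<close> exists by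
  compactness.
\<close>

section \<open>Fixed points of equi-Lipschitz maps\<close>

text \<open>The usual source of a second solution is a topological degree computed on either side of
  a lower solution. Here one scalar unknown replaces the degree: \<gamma> measures how far the
  minimum of \<open>u - us\<close> is moved up (\<open>\<eta> = 1\<close>) or down
  (\<open>\<eta> = - 1\<close>), and the relation
  \<open>\<gamma> = max 0 (min \<Gamma> (\<gamma> + s' - s))\<close> is added to the periodic
  problem. It says \<open>s' = s\<close> when \<gamma> is strictly between the ends,
  \<open>s' \<le> s\<close> at \<open>0\<close> and \<open>s' \<ge> s\<close> at \<Gamma>. Both ends
  contradict the sign known there. The obstacle is that the Schauder argument needs bounded data,
  whereas \<open>q\<close> is bounded only from above and \<open>F\<close> may be unbounded. Both
  are clipped at a height \<open>M\<close>. This can be undone because the oscillation bound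
  involves neither \<open>F\<close> nor a lower bound of \<open>q\<close>, so that it can be fixed
  before \<open>M\<close>. The condition on \<open>u0\<close> comes from the crude estimate of a
  constant lower solution: as \<open>q u0 \<le> 0\<close>, the number \<open>A * q u0 - E\<close>,
  with \<open>A\<close> the norm of \<open>a\<close> and \<open>E\<close> that of the positive part
  of \<open>e\<close>, is a level at which \<open>u0\<close> is one. Lying above the critical mean,
  it makes the set of solvable levels nonempty.\<close>

text \<open>
  Brouwer's theorem in arbitrary finite dimension \<open>n\<close>, up to \<open>\<epsilon>\<close> and for uniformly continuous maps;
  the version of the library needs the dimension to be a type.
\<close>

lemma approximate_fixed_point_cube:
  fixes f :: "(nat \<Rightarrow> real) \<Rightarrow> nat \<Rightarrow> real" and n :: nat
  defines "cube \<equiv> {x. \<forall>i<n. 0 \<le> x i \<and> x i \<le> 1}"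
  assumes maps: "\<And>x. x \<in> cube \<Longrightarrow> f x \<in> cube"
    and uc: "\<And>\<epsilon>. \<epsilon> > 0 \<Longrightarrow> \<exists>\<delta>>0. \<forall>x\<in>cube. \<forall>y\<in>cube.
               (\<forall>i<n. \<bar>x i - y i\<bar> \<le> \<delta>) \<longrightarrow> (\<forall>i<n. \<bar>f x i - f y i\<bar> \<le> \<epsilon>)"
    and "\<epsilon> > 0"
  shows "\<exists>x\<in>cube. \<forall>i<n. \<bar>f x i - x i\<bar> \<le> \<epsilon>"
proof -
  obtain \<delta> where "\<delta> > 0" and \<delta>: "\<And>x y i. x \<in> cube \<Longrightarrow> y \<in> cube \<Longrightarrow>
      (\<And>i. i < n \<Longrightarrow> \<bar>x i - y i\<bar> \<le> \<delta>) \<Longrightarrow> i < n \<Longrightarrow> \<bar>f x i - f y i\<bar> \<le> \<epsilon>/2"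
    using uc[of "\<epsilon>/2"] \<open>\<epsilon> > 0\<close> by (metis half_gt_zero)
  obtain p :: nat where p: "0 < p" "1 / p < min \<delta> (\<epsilon>/2)"
    using \<open>\<delta> > 0\<close> \<open>\<epsilon> > 0\<close> real_arch_inverse[of "min \<delta> (\<epsilon>/2)"]
    by (auto simp: inverse_eq_divide)
  define z where "z = (\<lambda>(x::nat \<Rightarrow> nat) i. real (x i) / p)"
  have z_cube: "z x \<in> cube" if "\<forall>i<n. x i \<le> p" for x
    using that p by (auto simp: z_def cube_def)
  \<comment> \<open>Label 0 records that \<open>f\<close> does not decrease the coordinate, label 1
    that it does not increase it. The values on the faces are those required by Kuhn's lemma; they
    keep this meaning because \<open>f\<close> maps the cube into itself.\<close>
  define label where "label = (\<lambda>x i. if x i = p then 1 else if x i = 0 then 0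
      else if z x i \<le> f (z x) i then 0 else (1::nat))"
  have label0: "z x i \<le> f (z x) i" if "\<forall>i<n. x i \<le> p" "i < n" "label x i = 0" for x i
    using that maps[OF z_cube[of x]] by (auto simp: label_def z_def cube_def split: if_splits)
  have label1: "f (z x) i \<le> z x i" if "\<forall>i<n. x i \<le> p" "i < n" "label x i = 1" for x i
    using that maps[OF z_cube[of x]] p by (auto simp: label_def z_def cube_def split: if_splits)
  obtain q where q: "\<forall>i<n. q i < p" and qrs: "\<forall>i<n. \<exists>r s. (\<forall>j<n. q j \<le> r j \<and> r j \<le> q j + 1) \<and>
        (\<forall>j<n. q j \<le> s j \<and> s j \<le> q j + 1) \<and> label r i \<noteq> label s i"
    by (rule kuhn_lemma[of p n label]) (use p in \<open>auto simp: label_def\<close>)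
  have qp: "\<forall>i<n. q i \<le> p" using q by (simp add: less_imp_le)
  have near: "\<bar>f (z r) i - f (z q) i\<bar> \<le> \<epsilon>/2 \<and> z q i \<le> z r i \<and> z r i \<le> z q i + \<epsilon>/2 \<and> (\<forall>i<n. r i \<le> p)"
    if r: "\<forall>j<n. q j \<le> r j \<and> r j \<le> q j + 1" and "i < n" for r i
  proof -
    have rp: "\<forall>i<n. r i \<le> p" using q r by fastforce
    have d: "z q j \<le> z r j" "z r j \<le> z q j + 1 / p" if "j < n" for j
    proof -
      show "z q j \<le> z r j" using r that by (auto simp: z_def divide_right_mono)
      have "real (r j) \<le> real (q j) + 1" using r that by fastforce
      then show "z r j \<le> z q j + 1 / p" using p by (auto simp: z_def field_simps)
    qed
    have "\<bar>f (z r) i - f (z q) i\<bar> \<le> \<epsilon>/2"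
    proof (rule \<delta>)
      show "\<bar>z r j - z q j\<bar> \<le> \<delta>" if "j < n" for j
        using d[OF that] p by linarith
    qed (use z_cube rp qp \<open>i < n\<close> in auto)
    then show ?thesis using d[OF \<open>i < n\<close>] p rp by auto
  qed
  \<comment> \<open>Two corners of the Kuhn cell carry different labels, so
    \<open>f x i - x i\<close> changes sign within the cell. Both terms vary there by at most
    \<open>\<epsilon>/2\<close>.\<close>
  have "\<bar>f (z q) i - z q i\<bar> \<le> \<epsilon>" if i: "i < n" for i
  proof -
    obtain r s where r: "\<forall>j<n. q j \<le> r j \<and> r j \<le> q j + 1" and s: "\<forall>j<n. q j \<le> s j \<and> s j \<le> q j + 1"
      and rs: "label r i \<noteq> label s i"
      using qrs i by blast
    note nr = near[OF r that] and ns = near[OF s that]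
    have "label r i = 0 \<and> label s i = 1 \<or> label r i = 1 \<and> label s i = 0"
      using rs by (auto simp: label_def split: if_splits)
    then show ?thesis
    proof
      assume "label r i = 0 \<and> label s i = 1"
      then have "z r i \<le> f (z r) i" "f (z s) i \<le> z s i"
        using label0 label1 nr ns that by auto
      then show ?thesis using nr ns by linarith
    next
      assume "label r i = 1 \<and> label s i = 0"
      then have "z s i \<le> f (z s) i" "f (z r) i \<le> z r i"
        using label0 label1 nr ns that by auto
      then show ?thesis using nr ns by linarith
    qed
  qed
  then show ?thesis using z_cube[OF qp] by blast
qed

text \<open>The common Lipschitz constant provides the compactness. Brouwer's theorem on step
  functions gives approximate fixed points \<open>u n\<close>; the functions \<open>G (u n)\<close>
  have a uniformly convergent subsequence, and since \<open>G (u n) - u n\<close> tends to zero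
  uniformly, the \<open>u n\<close> converge to the same limit along it.\<close>

lemma schauder_Lipschitz_maps:
  fixes G :: "(real \<Rightarrow> real) \<Rightarrow> real \<Rightarrow> real" and T B L :: real
  defines "meas \<equiv> borel_measurable (lebesgue_on {0..T})"
  assumes "T > 0" "B > 0"
    and bound: "\<And>u t. u \<in> meas \<Longrightarrow> t \<in> {0..T} \<Longrightarrow> \<bar>G u t\<bar> \<le> B"
    and lip: "\<And>u t t'. u \<in> meas \<Longrightarrow> t \<in> {0..T} \<Longrightarrow> t' \<in> {0..T} \<Longrightarrow> \<bar>G u t - G u t'\<bar> \<le> L * \<bar>t - t'\<bar>"
    and uc: "\<And>\<epsilon>. \<epsilon> > 0 \<Longrightarrow> \<exists>\<delta>>0. \<forall>u\<in>meas. \<forall>w\<in>meas. (\<forall>t\<in>{0..T}. \<bar>u t - w t\<bar> \<le> \<delta>) \<longrightarrow>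
               (\<forall>t\<in>{0..T}. \<bar>G u t - G w t\<bar> \<le> \<epsilon>)"
  obtains v where "continuous_on {0..T} v" "\<And>t. t \<in> {0..T} \<Longrightarrow> G v t = v t"
proof -
  have L0: "L \<ge> 0"
    using order_trans[OF abs_ge_zero lip[of "\<lambda>_. 0" 0 T]] \<open>T > 0\<close>
    by (simp add: meas_def zero_le_mult_iff)
  have approx: "\<exists>u\<in>meas. \<forall>t\<in>{0..T}. \<bar>G u t - u t\<bar> \<le> \<epsilon>" if eps: "\<epsilon> > 0" for \<epsilon>
  proof -
    obtain m0 :: nat where "2 * L * T / \<epsilon> < m0" using reals_Archimedean2 by blast
    then have "L * T / Suc m0 \<le> \<epsilon>/2"
      using eps by (simp add: field_simps add_pos_nonneg)
    then obtain m :: nat where m: "0 < m" "L * T / m \<le> \<epsilon>/2"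
      using zero_less_Suc by blast
    \<comment> \<open>Step functions on the grid discretise \<open>G\<close>; this is why \<open>G\<close> has to act on measurable functions.\<close>
    define step where "step = (\<lambda>(x::nat \<Rightarrow> real) (t::real). 2 * B * x (nat \<lfloor>t * m / T\<rfloor>) - B)"
    have step_meas: "step x \<in> meas" for x
    proof -
      have "step x \<in> borel_measurable borel"
        unfolding step_def by measurable
      then show ?thesis unfolding meas_def
        by (intro measurable_restrict_space1 measurable_completion) simp
    qed
    \<comment> \<open>The node values of \<open>G (step x)\<close>, rescaled from
      \<open>{- B..B}\<close> to the unit interval. Index \<open>m\<close> is attained only at
      \<open>t = T\<close>, hence the \<open>Suc m\<close> coordinates.\<close>
    define f where "f = (\<lambda>x (i::nat). (G (step x) (i * T / m) + B) / (2 * B))"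
    have node: "real i * T / m \<in> {0..T}" if "i < Suc m" for i :: nat
      using that \<open>T > 0\<close> m by (auto simp: field_simps)
    have cell: "nat \<lfloor>t * m / T\<rfloor> < Suc m" "\<bar>t - real (nat \<lfloor>t * m / T\<rfloor>) * T / m\<bar> \<le> T / m"
      if "t \<in> {0..T}" for t
    proof -
      have 0: "0 \<le> t * m / T" "t * m / T \<le> m" using that \<open>T > 0\<close> m by (auto simp: field_simps)
      then have "\<lfloor>t * m / T\<rfloor> \<le> int m" by linarith
      then show "nat \<lfloor>t * m / T\<rfloor> < Suc m" by linarith
      have "\<bar>t * m / T - real (nat \<lfloor>t * m / T\<rfloor>)\<bar> \<le> 1" using 0 by linarith
      then have "\<bar>t * m / T - real (nat \<lfloor>t * m / T\<rfloor>)\<bar> * (T / m) \<le> T / m"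
        using \<open>T > 0\<close> m by (simp add: field_simps)
      also have "\<bar>t * m / T - real (nat \<lfloor>t * m / T\<rfloor>)\<bar> * (T / m) = \<bar>(t * m / T - real (nat \<lfloor>t * m / T\<rfloor>)) * (T / m)\<bar>"
        using \<open>T > 0\<close> m by (simp add: abs_mult)
      also have "(t * m / T - real (nat \<lfloor>t * m / T\<rfloor>)) * (T / m) = t - real (nat \<lfloor>t * m / T\<rfloor>) * T / m"
        using \<open>T > 0\<close> m by (simp add: field_simps)
      finally show "\<bar>t - real (nat \<lfloor>t * m / T\<rfloor>) * T / m\<bar> \<le> T / m" .
    qed
    have "\<exists>x\<in>{x. \<forall>i<Suc m. 0 \<le> x i \<and> x i \<le> 1}. \<forall>i<Suc m. \<bar>f x i - x i\<bar> \<le> \<epsilon> / (4 * B)"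
    proof (rule approximate_fixed_point_cube)
      show "f x \<in> {x. \<forall>i<Suc m. 0 \<le> x i \<and> x i \<le> 1}" for x
      proof (intro CollectI allI impI)
        fix i assume "i < Suc m"
        from bound[OF step_meas node[OF this], of x] \<open>B > 0\<close> show "0 \<le> f x i \<and> f x i \<le> 1"
          by (simp add: f_def abs_le_iff divide_le_eq)
      qed
      show "\<exists>\<delta>>0. \<forall>x\<in>{x. \<forall>i<Suc m. 0 \<le> x i \<and> x i \<le> 1}. \<forall>y\<in>{x. \<forall>i<Suc m. 0 \<le> x i \<and> x i \<le> 1}.
          (\<forall>i<Suc m. \<bar>x i - y i\<bar> \<le> \<delta>) \<longrightarrow> (\<forall>i<Suc m. \<bar>f x i - f y i\<bar> \<le> e)" if "e > 0" for e
      proof -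
        obtain \<delta> where "\<delta> > 0" and \<delta>: "\<And>u w t. u \<in> meas \<Longrightarrow> w \<in> meas \<Longrightarrow> (\<And>t. t \<in> {0..T} \<Longrightarrow> \<bar>u t - w t\<bar> \<le> \<delta>)
            \<Longrightarrow> t \<in> {0..T} \<Longrightarrow> \<bar>G u t - G w t\<bar> \<le> 2 * B * e"
          using uc[of "2 * B * e"] \<open>e > 0\<close> \<open>B > 0\<close>
          by (metis mult_pos_pos zero_less_numeral)
        show ?thesis
        proof (intro exI[of _ "\<delta> / (2*B)"] conjI ballI impI allI)
          fix x y i assume xy: "\<forall>i<Suc m. \<bar>x i - y i\<bar> \<le> \<delta> / (2 * B)" and "i < Suc m"
          have "\<bar>G (step x) (i * T / m) - G (step y) (i * T / m)\<bar> \<le> 2 * B * e"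
          proof (rule \<delta>[OF step_meas step_meas _ node[OF \<open>i < Suc m\<close>]])
            fix t assume t: "t \<in> {0..T}"
            have "step x t - step y t = 2 * B * (x (nat \<lfloor>t * m / T\<rfloor>) - y (nat \<lfloor>t * m / T\<rfloor>))"
              by (simp add: step_def algebra_simps)
            moreover have "2 * B * \<bar>x (nat \<lfloor>t * m / T\<rfloor>) - y (nat \<lfloor>t * m / T\<rfloor>)\<bar> \<le> \<delta>"
              using xy cell(1)[OF t] \<open>B > 0\<close> by (auto simp: field_simps)
            ultimately show "\<bar>step x t - step y t\<bar> \<le> \<delta>"
              using \<open>B > 0\<close> by (simp add: abs_mult)
          qed
          moreover have "f x i - f y i = (G (step x) (i * T / m) - G (step y) (i * T / m)) / (2 * B)"
            using \<open>B > 0\<close> by (simp add: f_def field_simps)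
          ultimately show "\<bar>f x i - f y i\<bar> \<le> e"
            using \<open>B > 0\<close> by (simp only: abs_divide) (simp add: pos_divide_le_eq mult.commute)
        qed (use \<open>\<delta> > 0\<close> \<open>B > 0\<close> in auto)
      qed
    qed (use eps \<open>B > 0\<close> in auto)
    then obtain x where x: "\<And>i. i < Suc m \<Longrightarrow> \<bar>f x i - x i\<bar> \<le> \<epsilon> / (4 * B)"
      by blast
    have "\<bar>G (step x) t - step x t\<bar> \<le> \<epsilon>" if t: "t \<in> {0..T}" for t
    proof -
      define i where "i = nat \<lfloor>t * m / T\<rfloor>"
      have i: "i < Suc m" "\<bar>t - i * T / m\<bar> \<le> T / m" using cell[OF t] by (auto simp: i_def)
      have "G (step x) (i * T / m) - step x t = 2 * B * (f x i - x i)"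
        using \<open>B > 0\<close> by (simp add: f_def step_def i_def[symmetric] field_simps)
      moreover have "2 * B * \<bar>f x i - x i\<bar> \<le> \<epsilon>/2"
        using x[OF i(1)] \<open>B > 0\<close> by (simp add: field_simps)
      ultimately have "\<bar>G (step x) (i * T / m) - step x t\<bar> \<le> \<epsilon>/2"
        using \<open>B > 0\<close> by (simp add: abs_mult)
      moreover have "\<bar>G (step x) t - G (step x) (i * T / m)\<bar> \<le> L * (T / m)"
        using lip[OF step_meas t node[OF i(1)], of x] i(2) L0 by (meson mult_left_mono order_trans)
      moreover have "L * (T / m) \<le> \<epsilon>/2" using m(2) by simp
      ultimately show ?thesis by linarith
    qed
    then show ?thesis using step_meas by blast
  qed
  then have "\<forall>n. \<exists>u\<in>meas. \<forall>t\<in>{0..T}. \<bar>G u t - u t\<bar> \<le> 1 / Suc n" by simp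
  then obtain u where u: "\<And>n. u n \<in> meas" "\<And>n t. t \<in> {0..T} \<Longrightarrow> \<bar>G (u n) t - u n t\<bar> \<le> 1 / Suc n"
    by metis
  obtain v k where v: "continuous_on {0..T} v" and k: "strict_mono (k::nat \<Rightarrow> nat)"
    and lim: "\<And>e. 0 < e \<Longrightarrow> \<exists>N. \<forall>n x. n \<ge> N \<and> x \<in> {0..T} \<longrightarrow> norm (G (u (k n)) x - v x) < e"
  proof (rule Arzela_Ascoli[of "{0..T}" "\<lambda>n. G (u n)" B])
    fix x e :: real assume "x \<in> {0..T}" "0 < e"
    show "\<exists>d>0. \<forall>n y. y \<in> {0..T} \<and> norm (x - y) < d \<longrightarrow> norm (G (u n) x - G (u n) y) < e"
    proof (intro exI[of _ "e / (L + 1)"] conjI allI impI)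
      fix n y assume "y \<in> {0..T} \<and> norm (x - y) < e / (L + 1)"
      then have "\<bar>G (u n) x - G (u n) y\<bar> \<le> L * \<bar>x - y\<bar>" "(L + 1) * \<bar>x - y\<bar> < e"
        using lip[OF u(1) \<open>x \<in> {0..T}\<close>] L0 by (auto simp: field_simps)
      then show "norm (G (u n) x - G (u n) y) < e" by (simp add: algebra_simps)
    qed (use L0 \<open>0 < e\<close> in auto)
  qed (use bound u in auto)
  have v_meas: "v \<in> meas"
    unfolding meas_def by (rule continuous_imp_measurable_on_sets_lebesgue[OF v]) auto
  have "G v t = v t" if t: "t \<in> {0..T}" for t
  proof (rule ccontr)
    assume "G v t \<noteq> v t"
    define e where "e = \<bar>G v t - v t\<bar> / 3"
    have "e > 0" using \<open>G v t \<noteq> v t\<close> by (simp add: e_def)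
    obtain \<delta> where "\<delta> > 0" and \<delta>: "\<And>u w t. u \<in> meas \<Longrightarrow> w \<in> meas \<Longrightarrow> (\<And>t. t \<in> {0..T} \<Longrightarrow> \<bar>u t - w t\<bar> \<le> \<delta>)
            \<Longrightarrow> t \<in> {0..T} \<Longrightarrow> \<bar>G u t - G w t\<bar> \<le> e"
      using uc[OF \<open>e > 0\<close>] by metis
    obtain N where N: "\<And>n x. n \<ge> N \<Longrightarrow> x \<in> {0..T} \<Longrightarrow> \<bar>G (u (k n)) x - v x\<bar> < min e (\<delta>/2)"
      using lim[of "min e (\<delta>/2)"] \<open>e > 0\<close> \<open>\<delta> > 0\<close> by auto
    obtain N' :: nat where "1 / Suc N' < \<delta>/2"
      using nat_approx_posE[of "\<delta>/2"] \<open>\<delta> > 0\<close> by auto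
    define n where "n = max N N'"
    have "k n \<ge> N'" using seq_suble[OF k, of n] by (simp add: n_def)
    then have "1 / Suc (k n) \<le> 1 / Suc N'" by (intro divide_left_mono) auto
    then have small: "1 / Suc (k n) < \<delta>/2" using \<open>1 / Suc N' < \<delta>/2\<close> by simp
    have "\<bar>G (u (k n)) t - G v t\<bar> \<le> e"
    proof (rule \<delta>[OF u(1) v_meas _ t])
      fix x assume "x \<in> {0..T}"
      have "N \<le> n" by (simp add: n_def)
      show "\<bar>u (k n) x - v x\<bar> \<le> \<delta>"
        using N[OF \<open>N \<le> n\<close> \<open>x \<in> {0..T}\<close>] u(2)[OF \<open>x \<in> {0..T}\<close>, of "k n"] small by linarith
    qed
    moreover have "\<bar>G (u (k n)) t - v t\<bar> < e" using N[of n t] t by (simp add: n_def)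
    ultimately have "\<bar>G v t - v t\<bar> \<le> e + e" by linarith
    then show False using \<open>e > 0\<close> by (simp add: e_def)
  qed
  then show thesis using that v by blast
qed

section \<open>Absolutely continuous functions\<close>

text \<open>Allows the intervals to be indexed by the pieces of a tagged division.\<close>

lemma abs_cont_on_finite_family:
  assumes "abs_cont_on a b G" "\<epsilon> > 0"
  shows "\<exists>\<delta>>0. \<forall>(I :: 'i set) x y. finite I \<and> (\<forall>i\<in>I. a \<le> x i \<and> x i \<le> y i \<and> y i \<le> b) \<and>
       (\<forall>i\<in>I. \<forall>j\<in>I. i \<noteq> j \<longrightarrow> y i \<le> x j \<or> y j \<le> x i) \<and>
       (\<Sum>i\<in>I. y i - x i) < \<delta> \<longrightarrow> (\<Sum>i\<in>I. \<bar>G (y i) - G (x i)\<bar>) < \<epsilon>"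
proof -
  obtain \<delta> where "\<delta> > 0" and \<delta>: "\<forall>(n::nat) x y. (\<forall>i<n. a \<le> x i \<and> x i \<le> y i \<and> y i \<le> b) \<and>
        (\<forall>i<n. \<forall>j<n. i \<noteq> j \<longrightarrow> y i \<le> x j \<or> y j \<le> x i) \<and>
        (\<Sum>i<n. y i - x i) < \<delta> \<longrightarrow> (\<Sum>i<n. \<bar>G (y i) - G (x i)\<bar>) < \<epsilon>"
    using assms unfolding abs_cont_on_def by blast
  show ?thesis
  proof (intro exI[of _ \<delta>] conjI allI impI \<open>\<delta> > 0\<close>, elim conjE)
    fix I :: "'i set" and x y :: "'i \<Rightarrow> real"
    assume I: "finite I" "\<forall>i\<in>I. a \<le> x i \<and> x i \<le> y i \<and> y i \<le> b"
      "\<forall>i\<in>I. \<forall>j\<in>I. i \<noteq> j \<longrightarrow> y i \<le> x j \<or> y j \<le> x i" "(\<Sum>i\<in>I. y i - x i) < \<delta>"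
    obtain h where h: "bij_betw h {..<card I} I"
      using ex_bij_betw_nat_finite[OF I(1)] by (auto simp: atLeast0LessThan)
    have hI: "h i \<in> I" if "i < card I" for i
      using h that by (auto simp: bij_betw_def)
    have hinj: "h i \<noteq> h j" if "i < card I" "j < card I" "i \<noteq> j" for i j
      using h that by (auto simp: bij_betw_def inj_on_def)
    have "(\<Sum>i<card I. y (h i) - x (h i)) < \<delta>"
      using I(4) sum.reindex_bij_betw[OF h, of "\<lambda>i. y i - x i"] by simp
    then have "(\<Sum>i<card I. \<bar>G (y (h i)) - G (x (h i))\<bar>) < \<epsilon>"
      using I(2,3) hI hinj
      by (intro \<delta>[rule_format, of "card I" "\<lambda>i. x (h i)" "\<lambda>i. y (h i)"] conjI allI impI) auto
    then show "(\<Sum>i\<in>I. \<bar>G (y i) - G (x i)\<bar>) < \<epsilon>"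
      using sum.reindex_bij_betw[OF h, of "\<lambda>i. \<bar>G (y i) - G (x i)\<bar>"] by simp
  qed
qed

text \<open>
  Tags in the null set are controlled by a gauge that confines them to an open set of small measure;
  degenerate intervals have to be discarded first, as \<open>abs_cont_on\<close> does not tolerate them inside others.
\<close>

lemma abs_cont_on_has_integral_derivative:
  fixes G g :: "real \<Rightarrow> real"
  assumes "a \<le> b" and ac: "abs_cont_on a b G" and N: "negligible N"
    and deriv: "\<And>t. t \<in> {a..b} - N \<Longrightarrow> (G has_real_derivative g t) (at t within {a..b})"
  shows "(g has_integral (G b - G a)) {a..b}"
proof -
  \<comment> \<open>Nothing is known about \<open>g\<close> on \<open>N\<close>. With the value 0, a
    piece tagged there contributes only its increment of \<open>G\<close>.\<close>
  define g' where "g' t = (if t \<in> N then 0 else g t)" for t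
  have "(g' has_integral (G b - G a)) {a..b}"
    unfolding has_integral_real
  proof (intro allI impI)
    fix \<epsilon> :: real assume "\<epsilon> > 0"
    then have "\<epsilon>/2 > 0" by simp
    obtain \<delta> where "\<delta> > 0" and \<delta>:
       "\<forall>(I :: (real \<times> real set) set) x y. finite I \<and> (\<forall>i\<in>I. a \<le> x i \<and> x i \<le> y i \<and> y i \<le> b) \<and>
       (\<forall>i\<in>I. \<forall>j\<in>I. i \<noteq> j \<longrightarrow> y i \<le> x j \<or> y j \<le> x i) \<and>
       (\<Sum>i\<in>I. y i - x i) < \<delta> \<longrightarrow> (\<Sum>i\<in>I. \<bar>G (y i) - G (x i)\<bar>) < \<epsilon>/2"
      using abs_cont_on_finite_family[OF ac \<open>\<epsilon>/2 > 0\<close>] by blast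
    obtain U where U: "open U" "N \<subseteq> U" "U \<in> lmeasurable" "measure lebesgue U < \<delta>"
    proof -
      obtain U where U: "open U" "N \<subseteq> U" "U - N \<in> lmeasurable" "emeasure lebesgue (U - N) < ennreal \<delta>"
        using sets_lebesgue_outer_open[OF negligible_imp_sets[OF N] \<open>\<delta> > 0\<close>] by blast
      have "U = (U - N) \<union> N" using U(2) by blast
      moreover have "measure lebesgue ((U - N) \<union> N) \<le> measure lebesgue (U - N) + measure lebesgue N"
        using U(3) negligible_imp_sets[OF N] by (intro measure_Un_le) auto
      moreover have "measure lebesgue (U - N) < \<delta>"
        using U(4) \<open>\<delta> > 0\<close> by (simp add: emeasure_eq_measure2[OF U(3)] ennreal_less_iff)
      moreover have "(U - N) \<union> N \<in> lmeasurable"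
        using U(3) negligible_imp_measurable[OF N] by (rule fmeasurable.Un)
      ultimately show thesis
        using negligible_imp_measure0[OF N] by (intro that[of U]) (use U in auto)
    qed
    \<comment> \<open>The derivative errors, each at most \<open>\<eta>\<close> times the length of
      its piece, sum to at most \<open>\<eta> * (b - a)\<close>. The added 1 covers the case
      \<open>a = b\<close>.\<close>
    define \<eta> where "\<eta> = \<epsilon> / (4 * (b - a + 1))"
    have \<eta>: "\<eta> > 0" "\<eta> * (b - a) < \<epsilon>/2"
    proof -
      show "\<eta> > 0" using \<open>\<epsilon> > 0\<close> \<open>a \<le> b\<close> by (simp add: \<eta>_def)
      have "\<eta> * (b - a) \<le> \<eta> * (b - a + 1)" using \<open>\<eta> > 0\<close> by simp
      also have "\<dots> = \<epsilon>/4" using \<open>a \<le> b\<close> by (simp add: \<eta>_def divide_simps)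
      finally show "\<eta> * (b - a) < \<epsilon>/2" using \<open>\<epsilon> > 0\<close> by simp
    qed
    have "\<exists>d>0. \<forall>y\<in>{a..b}. \<bar>y - t\<bar> < d \<longrightarrow> \<bar>G y - G t - g t * (y - t)\<bar> \<le> \<eta> * \<bar>y - t\<bar>"
      if "t \<in> {a..b} - N" for t
      using deriv[OF that, unfolded has_field_derivative_def has_derivative_within_alt] \<eta>(1)
      by auto
    then obtain d where d: "\<And>t. t \<in> {a..b} - N \<Longrightarrow> d t > 0"
       "\<And>t y. t \<in> {a..b} - N \<Longrightarrow> y \<in> {a..b} \<Longrightarrow> \<bar>y - t\<bar> < d t \<Longrightarrow> \<bar>G y - G t - g t * (y - t)\<bar> \<le> \<eta> * \<bar>y - t\<bar>"
      by metis
    define \<gamma> where "\<gamma> t = (if t \<in> N then U else ball t (if t \<in> {a..b} then d t else 1))" for t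
    have gauge: "gauge \<gamma>"
      unfolding gauge_def \<gamma>_def using U d(1) by auto
    have close: "norm ((\<Sum>(x, K)\<in>p. measure lborel K *\<^sub>R g' x) - (G b - G a)) < \<epsilon>"
      if p: "p tagged_division_of {a..b}" and fine: "\<gamma> fine p" for p
    proof -
      define r where "r = (\<lambda>(x,K). measure lborel K *\<^sub>R g' x - (G (Sup K) - G (Inf K)))"
      have fin: "finite p" using p by blast
      have part: "p tagged_partial_division_of {a..b}" using p by (simp add: tagged_division_of_def)
      have K: "\<exists>u v. K = {u..v} \<and> u \<le> x \<and> x \<le> v \<and> a \<le> u \<and> v \<le> b \<and> K \<subseteq> \<gamma> x" if xK: "(x, K) \<in> p" for x K
      proof -
        obtain u v where "K = cbox u v" "x \<in> K" "K \<subseteq> {a..b}"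
          using tagged_division_ofD(2,3,4)[OF p xK] by blast
        moreover have "K \<subseteq> \<gamma> x" using fine xK by (auto simp: fine_def)
        ultimately show ?thesis by auto
      qed
      define p1 where "p1 = {(x, K) \<in> p. x \<in> N \<and> measure lborel K \<noteq> 0}"
      have p1: "p1 \<subseteq> p" "finite p1" using fin by (auto simp: p1_def intro: finite_subset)
      have eq: "(\<Sum>(x, K)\<in>p. measure lborel K *\<^sub>R g' x) - (G b - G a) = sum r (p - p1) + sum r p1"
      proof -
        have "(\<Sum>(x, K)\<in>p. measure lborel K *\<^sub>R g' x) - (G b - G a) = sum r p"
          unfolding r_def additive_tagged_division_1[OF \<open>a \<le> b\<close> p, symmetric] sum_subtractf[symmetric]
          by (intro sum.cong) auto
        then show ?thesis using sum.subset_diff[OF p1(1) fin, of r] by simp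
      qed
      have "\<bar>sum r (p - p1)\<bar> \<le> (\<Sum>(x, K)\<in>p - p1. \<eta> * measure lborel K)"
      proof (rule order_trans[OF sum_abs sum_mono], clarsimp)
        fix x K assume xK: "(x, K) \<in> p" "(x, K) \<notin> p1"
        obtain u v where uv: "K = {u..v}" "u \<le> x" "x \<le> v" "a \<le> u" "v \<le> b" "K \<subseteq> \<gamma> x"
          using K[OF xK(1)] by blast
        show "\<bar>r (x, K)\<bar> \<le> \<eta> * measure lborel K"
        proof (cases "x \<in> N")
          case True
          then have "u = v" using xK uv by (auto simp: p1_def)
          then show ?thesis using uv by (simp add: r_def)
        next
          case False
          have x: "x \<in> {a..b} - N" using uv False by auto
          have "{u..v} \<subseteq> ball x (d x)" using uv False x by (auto simp: \<gamma>_def)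
          moreover have "u \<in> {u..v}" "v \<in> {u..v}" using uv by auto
          ultimately have "u \<in> ball x (d x)" "v \<in> ball x (d x)" by blast+
          then have "\<bar>G u - G x - g x * (u - x)\<bar> \<le> \<eta> * \<bar>u - x\<bar>" "\<bar>G v - G x - g x * (v - x)\<bar> \<le> \<eta> * \<bar>v - x\<bar>"
            using d(2)[OF x, of u] d(2)[OF x, of v] uv by (simp_all add: dist_real_def abs_minus_commute)
          \<comment> \<open>Straddle estimate: the tag lies between \<open>u\<close> and
            \<open>v\<close>, so the errors on its two sides add up to
            \<open>\<eta> * (v - u)\<close> without loss.\<close>
          moreover have "r (x, K) = (G u - G x - g x * (u - x)) - (G v - G x - g x * (v - x))"
            using uv False by (simp add: r_def g'_def algebra_simps)
          moreover have "\<eta> * \<bar>u - x\<bar> + \<eta> * \<bar>v - x\<bar> = \<eta> * measure lborel K" using uv by (simp add: algebra_simps)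
          ultimately show ?thesis by linarith
        qed
      qed
      also have "(\<Sum>(x, K)\<in>p - p1. \<eta> * measure lborel K) \<le> (\<Sum>(x, K)\<in>p. \<eta> * measure lborel K)"
        using fin \<eta>(1) by (intro sum_mono2) auto
      also have "\<dots> = \<eta> * (\<Sum>(x, K)\<in>p. measure lborel K)"
        by (simp add: sum_distrib_left case_prod_unfold)
      also have "\<dots> = \<eta> * (b - a)"
        using additive_content_tagged_division[of p a b] p \<open>a \<le> b\<close> by simp
      finally have 1: "\<bar>sum r (p - p1)\<bar> < \<epsilon>/2"
        using \<eta>(2) by linarith
      have int: "interior (snd i) \<noteq> {}" if "i \<in> p1" for i
        using that K[of "fst i" "snd i"] by (force simp: p1_def)
      \<comment> \<open>A piece with nonempty interior occurs with one tag only, so the total length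
        is the measure of a union, which lies in \<open>U\<close>.\<close>
      have inj: "inj_on snd p1"
      proof (rule inj_onI)
        fix i j assume ij: "i \<in> p1" "j \<in> p1" "snd i = snd j"
        show "i = j"
        proof (rule ccontr)
          assume "i \<noteq> j"
          moreover have "(fst i, snd i) \<in> p" "(fst j, snd j) \<in> p"
            using p1(1) ij(1,2) unfolding prod.collapse by blast+
          ultimately have "interior (snd i) \<inter> interior (snd j) = {}"
            using tagged_division_ofD(5)[OF p, of "fst i" "snd i" "fst j" "snd j"] by (auto simp: prod_eq_iff)
          then show False using int[of i] ij by auto
        qed
      qed
      have div: "snd ` p1 division_of \<Union>(snd ` p1)"
        by (rule partial_division_of_tagged_division[OF tagged_partial_division_subset[OF part p1(1)]])
      have "(\<Sum>i\<in>p1. Sup (snd i) - Inf (snd i)) = (\<Sum>i\<in>p1. measure lborel (snd i))"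
      proof (rule sum.cong[OF refl])
        fix i assume "i \<in> p1"
        then have "(fst i, snd i) \<in> p" using p1(1) by auto
        from K[OF this] show "Sup (snd i) - Inf (snd i) = measure lborel (snd i)" by force
      qed
      also have "\<dots> = (\<Sum>K\<in>snd ` p1. measure lborel K)" by (simp add: sum.reindex[OF inj])
      also have "\<dots> = measure lebesgue (\<Union>(snd ` p1))"
      proof -
        have "(\<Sum>K\<in>snd ` p1. measure lborel K) = (\<Sum>K\<in>snd ` p1. measure lebesgue K)"
        proof (rule sum.cong[OF refl])
          fix K assume "K \<in> snd ` p1"
          then obtain u v where "K = cbox u v" using division_ofD(4)[OF div] by blast
          then show "measure lborel K = measure lebesgue K" by simp
        qed
        then show ?thesis using content_division[OF div] by simp
      qed
      also have "\<dots> \<le> measure lebesgue U"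
      proof (rule measure_mono_fmeasurable)
        show "\<Union>(snd ` p1) \<subseteq> U"
        proof
          fix z assume "z \<in> \<Union>(snd ` p1)"
          then obtain x L where "(x, L) \<in> p1" "z \<in> L" by auto
          then show "z \<in> U" using K[of x L] by (auto simp: p1_def \<gamma>_def)
        qed
        show "\<Union>(snd ` p1) \<in> sets lebesgue"
          using lmeasurable_division[OF div] by blast
      qed (fact U)
      also have "\<dots> < \<delta>" by (fact U)
      finally have len: "(\<Sum>i\<in>p1. Sup (snd i) - Inf (snd i)) < \<delta>" .
      have "(\<Sum>i\<in>p1. \<bar>G (Sup (snd i)) - G (Inf (snd i))\<bar>) < \<epsilon>/2"
      proof (rule \<delta>[rule_format], intro conjI ballI impI p1(2) len)
        fix i assume "i \<in> p1"
        then have "(fst i, snd i) \<in> p" using p1(1) by auto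
        from K[OF this] show "a \<le> Inf (snd i)" "Inf (snd i) \<le> Sup (snd i)" "Sup (snd i) \<le> b" by force+
      next
        fix i j assume ij: "i \<in> p1" "j \<in> p1" "i \<noteq> j"
        then have "(fst i, snd i) \<in> p" "(fst j, snd j) \<in> p"
          using p1(1) unfolding prod.collapse by blast+
        from K[OF \<open>(fst i, snd i) \<in> p\<close>] K[OF \<open>(fst j, snd j) \<in> p\<close>] obtain u v u' v' where
          uv: "snd i = {u..v}" "u \<le> v" "snd j = {u'..v'}" "u' \<le> v'" by auto
        have "u < v" "u' < v'"
          using int[of i] int[of j] ij uv by auto
        have "interior (snd i) \<inter> interior (snd j) = {}"
          using tagged_division_ofD(5)[OF p, of "fst i" "snd i" "fst j" "snd j"] ij \<open>(fst i, snd i) \<in> p\<close>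
            \<open>(fst j, snd j) \<in> p\<close> by (auto simp: prod_eq_iff)
        then have "{max u u'<..<min v v'} = {}" using uv by auto
        then have "min v v' \<le> max u u'" by (simp only: greaterThanLessThan_empty_iff)
        then show "Sup (snd i) \<le> Inf (snd j) \<or> Sup (snd j) \<le> Inf (snd i)"
          using uv \<open>u < v\<close> \<open>u' < v'\<close> by (auto simp: min_def max_def split: if_splits)
      qed
      moreover have "\<bar>sum r p1\<bar> \<le> (\<Sum>i\<in>p1. \<bar>G (Sup (snd i)) - G (Inf (snd i))\<bar>)"
        by (rule order_trans[OF sum_abs sum_mono]) (auto simp: r_def p1_def g'_def)
      ultimately show ?thesis using 1 unfolding eq real_norm_def by linarith
    qed
    show "\<exists>\<gamma>. gauge \<gamma> \<and> (\<forall>\<D>. \<D> tagged_division_of {a..b} \<and> \<gamma> fine \<D> \<longrightarrow>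
        norm ((\<Sum>(x, k)\<in>\<D>. measure lborel k *\<^sub>R g' x) - (G b - G a)) < \<epsilon>)"
      by (intro exI[of _ \<gamma>] conjI allI impI gauge close; elim conjE; assumption)
  qed
  then show ?thesis
    by (rule has_integral_spike[OF N, rotated]) (auto simp: g'_def)
qed

lemma sum_integral_nonoverlapping_le:
  fixes w :: "real \<Rightarrow> real"
  assumes w: "w integrable_on {a..b}" and nonneg: "\<And>t. t \<in> {a..b} \<Longrightarrow> w t \<ge> 0"
    and "finite I" and xy: "\<And>i. i \<in> I \<Longrightarrow> a \<le> x i \<and> x i \<le> y i \<and> y i \<le> b"
    and disj: "\<And>i j. i \<in> I \<Longrightarrow> j \<in> I \<Longrightarrow> i \<noteq> j \<Longrightarrow> y i \<le> x j \<or> y j \<le> x i"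
  shows "(\<Sum>i\<in>I. integral {x i..y i} w) \<le> integral {a..b} w"
proof -
  \<comment> \<open>Open intervals, so that common endpoints are not counted twice.\<close>
  define W where "W i t = (if t \<in> {x i<..<y i} then w t else 0)" for i t
  have W: "(W i has_integral integral {x i..y i} w) {a..b}" if "i \<in> I" for i
  proof -
    have "w integrable_on {x i..y i}"
      using w xy[OF that] by (auto intro: integrable_on_subinterval)
    then have "(w has_integral integral {x i..y i} w) {x i<..<y i}"
      by (simp add: has_integral_Icc_iff_Ioo[symmetric] has_integral_integral)
    moreover have "{x i<..<y i} \<subseteq> {a..b}" using xy[OF that] by auto
    ultimately show ?thesis unfolding W_def
      by (simp only: has_integral_restrict)
  qed
  have "((\<lambda>t. \<Sum>i\<in>I. W i t) has_integral (\<Sum>i\<in>I. integral {x i..y i} w)) {a..b}"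
    using \<open>finite I\<close> W by (rule has_integral_sum)
  moreover have "(\<Sum>i\<in>I. W i t) \<le> w t" if t: "t \<in> {a..b}" for t
  proof (cases "\<exists>i\<in>I. t \<in> {x i<..<y i}")
    case True
    then obtain i where i: "i \<in> I" "t \<in> {x i<..<y i}" by blast
    have "W j t = 0" if "j \<in> I - {i}" for j
      using disj[of i j] i that by (auto simp: W_def)
    then have "(\<Sum>i\<in>I. W i t) = W i t"
      using sum.remove[OF \<open>finite I\<close> i(1), of "\<lambda>i. W i t"] by simp
    then show ?thesis using i by (simp add: W_def)
  next
    case False
    then have "(\<Sum>i\<in>I. W i t) = 0" by (intro sum.neutral) (auto simp: W_def)
    then show ?thesis using nonneg[OF t] by simp
  qed
  ultimately show ?thesis
    using has_integral_le integrable_integral[OF w] by blast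
qed

text \<open>Truncation: \<open>\<bar>h\<bar> \<le> k + v k\<close>, where the excess
  \<open>v k\<close> has small integral for large \<open>k\<close> by dominated convergence. The
  bounded part contributes at most \<open>k\<close> times the total length, which determines
  \<delta>.\<close>

lemma abs_cont_on_integral:
  fixes h :: "real \<Rightarrow> real"
  assumes h: "h absolutely_integrable_on {a..b}"
  shows "abs_cont_on a b (\<lambda>t. integral {a..t} h)"
  unfolding abs_cont_on_def
proof (intro allI impI)
  fix \<epsilon> :: real assume "\<epsilon> > 0"
  define w where "w t = \<bar>h t\<bar>" for t
  have w: "w absolutely_integrable_on {a..b}"
    using absolutely_integrable_norm[OF h] by (simp add: w_def[abs_def] o_def)
  define v where "v k t = max (w t - real k) 0" for k t
  have v: "v k absolutely_integrable_on {a..b}" for k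
    unfolding v_def by (intro absolutely_integrable_max_1 set_integral_diff w) auto
  have "(\<lambda>k. integral {a..b} (v k)) \<longlonglongrightarrow> integral {a..b} (\<lambda>t. 0)"
  proof (rule dominated_convergence)
    show "w integrable_on {a..b}" "\<And>k. v k integrable_on {a..b}"
      using w v by (auto simp: absolutely_integrable_on_def)
    show "norm (v k t) \<le> w t" for k t by (auto simp: v_def w_def)
    fix t
    obtain K :: nat where "w t \<le> K" using real_arch_simple by blast
    then have "v k t = 0" if "k \<ge> K" for k using that by (simp add: v_def)
    then show "(\<lambda>k. v k t) \<longlonglongrightarrow> 0"
      by (intro tendsto_eventually) (auto simp: eventually_sequentially)
  qed
  then have "eventually (\<lambda>k. integral {a..b} (v k) < \<epsilon>/2) sequentially"
    using \<open>\<epsilon> > 0\<close> by (intro order_tendstoD) auto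
  then obtain k where k: "integral {a..b} (v k) < \<epsilon>/2"
    by (auto simp: eventually_sequentially)
  show "\<exists>\<delta>>0. \<forall>(n::nat) x y. (\<forall>i<n. a \<le> x i \<and> x i \<le> y i \<and> y i \<le> b) \<and>
        (\<forall>i<n. \<forall>j<n. i \<noteq> j \<longrightarrow> y i \<le> x j \<or> y j \<le> x i) \<and> (\<Sum>i<n. y i - x i) < \<delta> \<longrightarrow>
        (\<Sum>i<n. \<bar>integral {a..y i} h - integral {a..x i} h\<bar>) < \<epsilon>"
  proof (intro exI[of _ "\<epsilon> / (2 * (real k + 1))"] conjI allI impI; (elim conjE)?)
    fix n :: nat and x y :: "nat \<Rightarrow> real"
    assume xy: "\<forall>i<n. a \<le> x i \<and> x i \<le> y i \<and> y i \<le> b"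
      and disj: "\<forall>i<n. \<forall>j<n. i \<noteq> j \<longrightarrow> y i \<le> x j \<or> y j \<le> x i"
      and len: "(\<Sum>i<n. y i - x i) < \<epsilon> / (2 * (real k + 1))"
    have "\<bar>integral {a..y i} h - integral {a..x i} h\<bar> \<le> k * (y i - x i) + integral {x i..y i} (v k)"
      if i: "i < n" for i
    proof -
      have i': "a \<le> x i" "x i \<le> y i" "y i \<le> b" using xy i by auto
      have sub: "f integrable_on {x i..y i}" if "f absolutely_integrable_on {a..b}" for f :: "real \<Rightarrow> real"
        using set_lebesgue_integral_eq_integral(1)[OF that] i' by (auto intro: integrable_on_subinterval)
      have "h integrable_on {a..y i}"
        using set_lebesgue_integral_eq_integral(1)[OF h] i' by (auto intro: integrable_on_subinterval)
      then have "integral {a..y i} h - integral {a..x i} h = integral {x i..y i} h"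
        using Henstock_Kurzweil_Integration.integral_combine[OF i'(1,2)] by fastforce
      also have "\<bar>\<dots>\<bar> \<le> integral {x i..y i} (\<lambda>t. k + v k t)"
      proof -
        have "norm (integral {x i..y i} h) \<le> integral {x i..y i} (\<lambda>t. k + v k t)"
          by (intro integral_norm_bound_integral integrable_add sub[OF h] sub[OF v])
            (auto simp: v_def w_def)
        then show ?thesis by simp
      qed
      also have "\<dots> = k * (y i - x i) + integral {x i..y i} (v k)"
        using sub[OF v] i' by (subst integral_add) auto
      finally show ?thesis .
    qed
    then have "(\<Sum>i<n. \<bar>integral {a..y i} h - integral {a..x i} h\<bar>)
        \<le> (\<Sum>i<n. k * (y i - x i) + integral {x i..y i} (v k))"
      by (intro sum_mono) auto
    also have "\<dots> = k * (\<Sum>i<n. y i - x i) + (\<Sum>i<n. integral {x i..y i} (v k))"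
      by (simp add: sum.distrib sum_distrib_left)
    also have "(\<Sum>i<n. integral {x i..y i} (v k)) \<le> integral {a..b} (v k)"
      using xy disj v[of k] by (intro sum_integral_nonoverlapping_le) (auto simp: v_def absolutely_integrable_on_def)
    also have "k * (\<Sum>i<n. y i - x i) \<le> k * (\<epsilon> / (2 * (real k + 1)))"
      using len by (intro mult_left_mono) auto
    also have "\<dots> \<le> \<epsilon>/2" using \<open>\<epsilon> > 0\<close> by (simp add: field_simps)
    finally show "(\<Sum>i<n. \<bar>integral {a..y i} h - integral {a..x i} h\<bar>) < \<epsilon>"
      using k by simp
  qed (use \<open>\<epsilon> > 0\<close> in auto)
qed

text \<open>The differentiation theorem used here concerns intervals to the right of a point.
  Applied to the reflected function it yields the derivative from the left, off the reflected
  exceptional set.\<close>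

lemma negligible_derivative_indefinite_integral:
  fixes h :: "real \<Rightarrow> real"
  assumes h: "h integrable_on {a..b}"
  obtains N where "negligible N"
    "\<And>t. t \<in> {a..b} - N \<Longrightarrow> ((\<lambda>t. integral {a..t} h) has_real_derivative h t) (at t within {a..b})"
proof -
  define h0 where "h0 t = (if t \<in> {a..b} then h t else 0)" for t
  have "h0 integrable_on UNIV"
    using h unfolding h0_def by (simp only: integrable_restrict_UNIV)
  then have h0: "h0 integrable_on {c..d}" for c d
    using integrable_on_subinterval by blast
  have h0': "(\<lambda>t. h0 (-t)) integrable_on {c..d}" for c d
    using h0[of "-d" "-c"] Henstock_Kurzweil_Integration.integrable_reflect_real[where f=h0 and a="-d" and b="-c"]
    unfolding minus_minus by blast
  obtain N1 where "negligible N1" and N1: "\<And>x e. \<lbrakk>x \<notin> N1; 0 < e\<rbrakk> \<Longrightarrow>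
      \<exists>d>0. \<forall>s. 0 < s \<and> s < d \<longrightarrow> norm(integral (cbox x (x + s *\<^sub>R One)) h0 /\<^sub>R s ^ DIM(real) - h0 x) < e"
    using integrable_ccontinuous_explicit[of h0] h0 by (metis box_real(2))
  obtain N2 where "negligible N2" and N2: "\<And>x e. \<lbrakk>x \<notin> N2; 0 < e\<rbrakk> \<Longrightarrow>
      \<exists>d>0. \<forall>s. 0 < s \<and> s < d \<longrightarrow> norm(integral (cbox x (x + s *\<^sub>R One)) (\<lambda>t. h0 (-t)) /\<^sub>R s ^ DIM(real) - h0 (-x)) < e"
    using integrable_ccontinuous_explicit[of "\<lambda>t. h0 (-t)"] h0' by (metis box_real(2))
  have "negligible (uminus ` N2)"
    by (intro negligible_differentiable_image_negligible \<open>negligible N2\<close>) (auto intro!: derivative_intros differentiable_on_minus differentiable_on_ident)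
  show thesis
  proof
    show "negligible (N1 \<union> uminus ` N2 \<union> {a, b})"
      using \<open>negligible N1\<close> \<open>negligible (uminus ` N2)\<close> by (intro negligible_Un) auto
    fix t assume t: "t \<in> {a..b} - (N1 \<union> uminus ` N2 \<union> {a, b})"
    then have tab: "a < t" "t < b" "t \<notin> N1" "-t \<notin> N2" by (auto simp: image_iff)
    have h0t: "h0 t = h t" using tab by (simp add: h0_def)
    have diff: "integral {a..z} h - integral {a..x} h = integral {x..z} h0" if "a \<le> x" "x \<le> z" "z \<le> b" for x z
    proof -
      have "h integrable_on {a..z}" using h that by (auto intro: integrable_on_subinterval)
      then have "integral {a..z} h - integral {a..x} h = integral {x..z} h"
        using Henstock_Kurzweil_Integration.integral_combine[OF that(1,2)] by fastforce
      also have "\<dots> = integral {x..z} h0"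
        using that by (intro integral_cong) (auto simp: h0_def)
      finally show ?thesis .
    qed
    show "((\<lambda>t. integral {a..t} h) has_real_derivative h t) (at t within {a..b})"
      unfolding has_field_derivative_iff Lim_within
    proof (intro allI impI)
      fix e :: real assume "e > 0"
      obtain d1 where d1: "d1 > 0" "\<And>s. 0 < s \<Longrightarrow> s < d1 \<Longrightarrow> \<bar>integral {t..t + s} h0 / s - h t\<bar> < e"
        using N1[OF tab(3) \<open>e > 0\<close>] by (auto simp: h0t divide_inverse mult.commute)
      obtain d2 where d2: "d2 > 0" "\<And>s. 0 < s \<Longrightarrow> s < d2 \<Longrightarrow> \<bar>integral {-t..-t + s} (\<lambda>t. h0 (-t)) / s - h t\<bar> < e"
        using N2[OF tab(4) \<open>e > 0\<close>] by (auto simp: h0t divide_inverse mult.commute)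
      have refl: "integral {-t..-t + s} (\<lambda>t. h0 (-t)) = integral {t - s..t} h0" for s
        using Henstock_Kurzweil_Integration.integral_reflect_real[of t "t - s" h0] by simp
      show "\<exists>d>0. \<forall>x\<in>{a..b}. 0 < dist x t \<and> dist x t < d \<longrightarrow>
          dist ((integral {a..x} h - integral {a..t} h) / (x - t)) (h t) < e"
      proof (intro exI[of _ "min d1 d2"] conjI ballI impI; (elim conjE)?)
        fix x assume x: "x \<in> {a..b}" "0 < dist x t" "dist x t < min d1 d2"
        show "dist ((integral {a..x} h - integral {a..t} h) / (x - t)) (h t) < e"
        proof (cases "x > t")
          case True
          then show ?thesis using d1(2)[of "x - t"] diff[of t x] x tab by (simp add: dist_real_def)
        next
          case False
          then have "(integral {a..x} h - integral {a..t} h) / (x - t) = integral {x..t} h0 / (t - x)"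
            using diff[of x t] x tab by (simp add: field_simps)
          then show ?thesis using d2(2)[of "t - x"] refl[of "t - x"] x False by (simp add: dist_real_def)
        qed
      qed (use d1 d2 in auto)
    qed
  qed
qed

section \<open>Closure properties of absolute continuity\<close>

lemma abs_cont_on_subinterval:
  assumes "abs_cont_on a b G" "a \<le> c" "d \<le> b"
  shows "abs_cont_on c d G"
  unfolding abs_cont_on_def
proof (intro allI impI)
  fix \<epsilon> :: real assume "\<epsilon> > 0"
  then obtain \<delta> where "\<delta> > 0" and \<delta>: "\<forall>(n::nat) x y. (\<forall>i<n. a \<le> x i \<and> x i \<le> y i \<and> y i \<le> b) \<and>
        (\<forall>i<n. \<forall>j<n. i \<noteq> j \<longrightarrow> y i \<le> x j \<or> y j \<le> x i) \<and>
        (\<Sum>i<n. y i - x i) < \<delta> \<longrightarrow> (\<Sum>i<n. \<bar>G (y i) - G (x i)\<bar>) < \<epsilon>"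
    using assms(1) unfolding abs_cont_on_def by blast
  show "\<exists>\<delta>>0. \<forall>(n::nat) x y. (\<forall>i<n. c \<le> x i \<and> x i \<le> y i \<and> y i \<le> d) \<and>
        (\<forall>i<n. \<forall>j<n. i \<noteq> j \<longrightarrow> y i \<le> x j \<or> y j \<le> x i) \<and>
        (\<Sum>i<n. y i - x i) < \<delta> \<longrightarrow> (\<Sum>i<n. \<bar>G (y i) - G (x i)\<bar>) < \<epsilon>"
  proof (intro exI[of _ \<delta>] conjI allI impI \<open>\<delta> > 0\<close>; elim conjE)
    fix n :: nat and x y :: "nat \<Rightarrow> real"
    assume "\<forall>i<n. c \<le> x i \<and> x i \<le> y i \<and> y i \<le> d" "\<forall>i<n. \<forall>j<n. i \<noteq> j \<longrightarrow> y i \<le> x j \<or> y j \<le> x i"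
      "(\<Sum>i<n. y i - x i) < \<delta>"
    then show "(\<Sum>i<n. \<bar>G (y i) - G (x i)\<bar>) < \<epsilon>"
      using assms(2,3) by (intro \<delta>[rule_format]) force
  qed
qed

lemma abs_cont_on_diff:
  assumes "abs_cont_on a b G" "abs_cont_on a b H"
  shows "abs_cont_on a b (\<lambda>t. G t - H t)"
  unfolding abs_cont_on_def
proof (intro allI impI)
  fix \<epsilon> :: real assume "\<epsilon> > 0"
  then have "\<epsilon>/2 > 0" by simp
  obtain \<delta>1 where "\<delta>1 > 0" and \<delta>1: "\<forall>(n::nat) x y. (\<forall>i<n. a \<le> x i \<and> x i \<le> y i \<and> y i \<le> b) \<and>
        (\<forall>i<n. \<forall>j<n. i \<noteq> j \<longrightarrow> y i \<le> x j \<or> y j \<le> x i) \<and>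
        (\<Sum>i<n. y i - x i) < \<delta>1 \<longrightarrow> (\<Sum>i<n. \<bar>G (y i) - G (x i)\<bar>) < \<epsilon>/2"
    using assms(1) \<open>\<epsilon>/2 > 0\<close> unfolding abs_cont_on_def by blast
  obtain \<delta>2 where "\<delta>2 > 0" and \<delta>2: "\<forall>(n::nat) x y. (\<forall>i<n. a \<le> x i \<and> x i \<le> y i \<and> y i \<le> b) \<and>
        (\<forall>i<n. \<forall>j<n. i \<noteq> j \<longrightarrow> y i \<le> x j \<or> y j \<le> x i) \<and>
        (\<Sum>i<n. y i - x i) < \<delta>2 \<longrightarrow> (\<Sum>i<n. \<bar>H (y i) - H (x i)\<bar>) < \<epsilon>/2"
    using assms(2) \<open>\<epsilon>/2 > 0\<close> unfolding abs_cont_on_def by blast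
  show "\<exists>\<delta>>0. \<forall>(n::nat) x y. (\<forall>i<n. a \<le> x i \<and> x i \<le> y i \<and> y i \<le> b) \<and>
        (\<forall>i<n. \<forall>j<n. i \<noteq> j \<longrightarrow> y i \<le> x j \<or> y j \<le> x i) \<and>
        (\<Sum>i<n. y i - x i) < \<delta> \<longrightarrow> (\<Sum>i<n. \<bar>G (y i) - H (y i) - (G (x i) - H (x i))\<bar>) < \<epsilon>"
  proof (rule exI[of _ "min \<delta>1 \<delta>2"], intro conjI allI impI)
    show "0 < min \<delta>1 \<delta>2" using \<open>\<delta>1 > 0\<close> \<open>\<delta>2 > 0\<close> by simp
    fix n :: nat and x y :: "nat \<Rightarrow> real"
    assume *: "(\<forall>i<n. a \<le> x i \<and> x i \<le> y i \<and> y i \<le> b) \<and>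
      (\<forall>i<n. \<forall>j<n. i \<noteq> j \<longrightarrow> y i \<le> x j \<or> y j \<le> x i) \<and> (\<Sum>i<n. y i - x i) < min \<delta>1 \<delta>2"
    have "(\<Sum>i<n. \<bar>G (y i) - H (y i) - (G (x i) - H (x i))\<bar>)
        \<le> (\<Sum>i<n. \<bar>G (y i) - G (x i)\<bar> + \<bar>H (y i) - H (x i)\<bar>)"
      by (intro sum_mono) linarith
    also have "\<dots> = (\<Sum>i<n. \<bar>G (y i) - G (x i)\<bar>) + (\<Sum>i<n. \<bar>H (y i) - H (x i)\<bar>)"
      by (rule sum.distrib)
    also have "\<dots> < \<epsilon>/2 + \<epsilon>/2"
      using * by (intro add_strict_mono \<delta>1[rule_format] \<delta>2[rule_format]) auto
    finally show "(\<Sum>i<n. \<bar>G (y i) - H (y i) - (G (x i) - H (x i))\<bar>) < \<epsilon>" by simp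
  qed
qed

lemma abs_cont_on_Lipschitz:
  assumes "\<And>x y. x \<in> {a..b} \<Longrightarrow> y \<in> {a..b} \<Longrightarrow> \<bar>G y - G x\<bar> \<le> L * \<bar>y - x\<bar>"
  shows "abs_cont_on a b G"
  unfolding abs_cont_on_def
proof (intro allI impI)
  fix \<epsilon> :: real assume "\<epsilon> > 0"
  show "\<exists>\<delta>>0. \<forall>(n::nat) x y. (\<forall>i<n. a \<le> x i \<and> x i \<le> y i \<and> y i \<le> b) \<and>
        (\<forall>i<n. \<forall>j<n. i \<noteq> j \<longrightarrow> y i \<le> x j \<or> y j \<le> x i) \<and>
        (\<Sum>i<n. y i - x i) < \<delta> \<longrightarrow> (\<Sum>i<n. \<bar>G (y i) - G (x i)\<bar>) < \<epsilon>"
  proof (rule exI[of _ "\<epsilon> / (\<bar>L\<bar> + 1)"], intro conjI allI impI)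
    show "0 < \<epsilon> / (\<bar>L\<bar> + 1)" using \<open>\<epsilon> > 0\<close> by simp
    fix n :: nat and x y :: "nat \<Rightarrow> real"
    assume *: "(\<forall>i<n. a \<le> x i \<and> x i \<le> y i \<and> y i \<le> b) \<and>
      (\<forall>i<n. \<forall>j<n. i \<noteq> j \<longrightarrow> y i \<le> x j \<or> y j \<le> x i) \<and> (\<Sum>i<n. y i - x i) < \<epsilon> / (\<bar>L\<bar> + 1)"
    have "\<bar>G (y i) - G (x i)\<bar> \<le> (\<bar>L\<bar> + 1) * (y i - x i)" if "i < n" for i
    proof -
      have i: "a \<le> x i" "x i \<le> y i" "y i \<le> b" using * that by auto
      then have "\<bar>G (y i) - G (x i)\<bar> \<le> L * \<bar>y i - x i\<bar>" by (intro assms) auto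
      also have "\<dots> \<le> (\<bar>L\<bar> + 1) * \<bar>y i - x i\<bar>" by (intro mult_right_mono) auto
      finally show ?thesis using i by simp
    qed
    then have "(\<Sum>i<n. \<bar>G (y i) - G (x i)\<bar>) \<le> (\<Sum>i<n. (\<bar>L\<bar> + 1) * (y i - x i))"
      by (intro sum_mono) auto
    also have "\<dots> = (\<bar>L\<bar> + 1) * (\<Sum>i<n. y i - x i)" by (simp add: sum_distrib_left)
    also have "\<dots> < \<epsilon>" using * by (simp add: pos_less_divide_eq mult.commute add_nonneg_pos)
    finally show "(\<Sum>i<n. \<bar>G (y i) - G (x i)\<bar>) < \<epsilon>" .
  qed
qed

lemma abs_cont_on_C1:
  fixes G :: "real \<Rightarrow> real"
  assumes "\<And>t. t \<in> {a..b} \<Longrightarrow> (G has_real_derivative G' t) (at t within {a..b})" "continuous_on {a..b} G'"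
  shows "abs_cont_on a b G"
proof -
  have "bounded (G' ` {a..b})"
    using assms(2) by (intro compact_imp_bounded compact_continuous_image) auto
  then obtain L where L: "\<And>t. t \<in> {a..b} \<Longrightarrow> \<bar>G' t\<bar> \<le> L"
    unfolding bounded_iff by (metis imageI real_norm_def)
  show ?thesis
  proof (rule abs_cont_on_Lipschitz)
    fix x y assume "x \<in> {a..b}" "y \<in> {a..b}"
    then have "norm (G y - G x) \<le> L * norm (y - x)"
      using L by (intro field_differentiable_bound[of "{a..b}" G G']) (auto intro: assms(1))
    then show "\<bar>G y - G x\<bar> \<le> L * \<bar>y - x\<bar>" by simp
  qed
qed

lemma abs_cont_on_cong:
  assumes "abs_cont_on a b G" "\<And>t. t \<in> {a..b} \<Longrightarrow> H t = G t"
  shows "abs_cont_on a b H"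
  unfolding abs_cont_on_def
proof (intro allI impI)
  fix \<epsilon> :: real assume "\<epsilon> > 0"
  then obtain \<delta> where "\<delta> > 0" and \<delta>: "\<forall>(n::nat) x y. (\<forall>i<n. a \<le> x i \<and> x i \<le> y i \<and> y i \<le> b) \<and>
        (\<forall>i<n. \<forall>j<n. i \<noteq> j \<longrightarrow> y i \<le> x j \<or> y j \<le> x i) \<and>
        (\<Sum>i<n. y i - x i) < \<delta> \<longrightarrow> (\<Sum>i<n. \<bar>G (y i) - G (x i)\<bar>) < \<epsilon>"
    using assms(1) unfolding abs_cont_on_def by blast
  show "\<exists>\<delta>>0. \<forall>(n::nat) x y. (\<forall>i<n. a \<le> x i \<and> x i \<le> y i \<and> y i \<le> b) \<and>
        (\<forall>i<n. \<forall>j<n. i \<noteq> j \<longrightarrow> y i \<le> x j \<or> y j \<le> x i) \<and>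
        (\<Sum>i<n. y i - x i) < \<delta> \<longrightarrow> (\<Sum>i<n. \<bar>H (y i) - H (x i)\<bar>) < \<epsilon>"
  proof (rule exI[of _ \<delta>], intro conjI allI impI \<open>\<delta> > 0\<close>)
    fix n :: nat and x y :: "nat \<Rightarrow> real"
    assume *: "(\<forall>i<n. a \<le> x i \<and> x i \<le> y i \<and> y i \<le> b) \<and>
      (\<forall>i<n. \<forall>j<n. i \<noteq> j \<longrightarrow> y i \<le> x j \<or> y j \<le> x i) \<and> (\<Sum>i<n. y i - x i) < \<delta>"
    have "(\<Sum>i<n. \<bar>H (y i) - H (x i)\<bar>) = (\<Sum>i<n. \<bar>G (y i) - G (x i)\<bar>)"
    proof (rule sum.cong[OF refl])
      fix i assume "i \<in> {..<n}"
      then have "a \<le> x i" "x i \<le> y i" "y i \<le> b" using * by auto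
      then show "\<bar>H (y i) - H (x i)\<bar> = \<bar>G (y i) - G (x i)\<bar>" by (simp add: assms(2))
    qed
    then show "(\<Sum>i<n. \<bar>H (y i) - H (x i)\<bar>) < \<epsilon>" using \<delta> * by presburger
  qed
qed

section \<open>Weak periodic solutions\<close>

lemma continuous_imp_antiderivative:
  fixes f :: "real \<Rightarrow> real"
  assumes "continuous_on UNIV f"
  shows "\<exists>F. \<forall>x. (F has_real_derivative f x) (at x)"
proof -
  have "\<exists>F. \<forall>x. - \<infinity> < ereal x \<longrightarrow> ereal x < \<infinity> \<longrightarrow> (F has_vector_derivative f x) (at x)"
    using assms by (intro einterval_antiderivative) (auto simp: continuous_on_eq_continuous_at)
  then show ?thesis by (auto simp: has_real_derivative_iff_has_vector_derivative)
qed

text \<open>The bounds on \<open>a\<close> hold at every point: the coefficients are modified on a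
  null set before the locale is interpreted, so that the estimates below carry no exceptional
  sets.\<close>

locale periodic_phi_laplacian =
  fixes T :: real and \<phi> \<psi> a e :: "real \<Rightarrow> real" and A :: real
  assumes T: "T > 0"
    and \<phi>_mono: "strict_mono \<phi>" and \<phi>\<psi>: "\<And>y. \<phi> (\<psi> y) = y"
    and \<phi>_cont: "continuous_on UNIV \<phi>" and \<psi>_cont: "continuous_on UNIV \<psi>" and \<phi>0: "\<phi> 0 = 0"
    and a_meas: "a \<in> borel_measurable (lebesgue_on {0..T})"
    and a_bounds: "\<And>t. t \<in> {0..T} \<Longrightarrow> 0 \<le> a t \<and> a t \<le> A"
    and e_int: "e absolutely_integrable_on {0..T}" and e_mean: "integral {0..T} e = 0"
begin

definition rhs :: "(real \<Rightarrow> real) \<Rightarrow> real \<Rightarrow> (real \<Rightarrow> real) \<Rightarrow> real \<Rightarrow> real" where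
  "rhs q s u t = s + e t - a t * q (u t)"

text \<open>The damping enters through its primitive \<open>F\<close> and not through
  \<open>f\<close>, so that the notion also makes sense for the clipped primitive, which may fail to
  be differentiable at the clipping height.\<close>

definition weak_sol :: "(real \<Rightarrow> real) \<Rightarrow> (real \<Rightarrow> real) \<Rightarrow> real \<Rightarrow> (real \<Rightarrow> real) \<Rightarrow> (real \<Rightarrow> real) \<Rightarrow> bool" where
  "weak_sol F q s u u' \<longleftrightarrow>
     (\<forall>t\<in>{0..T}. (u has_real_derivative u' t) (at t within {0..T})) \<and> continuous_on {0..T} u' \<and>
     u 0 = u T \<and> u' 0 = u' T \<and>
     (\<forall>t\<in>{0..T}. \<phi> (u' t) + F (u t) = \<phi> (u' 0) + F (u 0) + integral {0..t} (rhs q s u))"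

lemma \<psi>\<phi>: "\<psi> (\<phi> x) = x"
  using \<phi>_mono \<phi>\<psi> by (metis strict_mono_eq)

lemma \<psi>_less_iff: "\<psi> x < \<psi> y \<longleftrightarrow> x < y"
  using \<phi>_mono \<phi>\<psi> by (metis strict_mono_less)

lemma \<psi>_le_iff: "\<psi> x \<le> \<psi> y \<longleftrightarrow> x \<le> y"
  using \<psi>_less_iff[of y x] by linarith

lemma \<psi>0: "\<psi> 0 = 0"
  using \<psi>\<phi>[of 0] \<phi>0 by simp

lemma integrable_a_mult:
  assumes "g \<in> borel_measurable (lebesgue_on {0..T})" "\<And>t. t \<in> {0..T} \<Longrightarrow> \<bar>g t\<bar> \<le> B"
  shows "(\<lambda>t. a t * g t) absolutely_integrable_on {0..T}"
proof (rule measurable_bounded_by_integrable_imp_absolutely_integrable)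
  show "(\<lambda>t. a t * g t) \<in> borel_measurable (lebesgue_on {0..T})"
    by (rule borel_measurable_times[OF a_meas assms(1)])
  fix t assume t: "t \<in> {0..T}"
  show "norm (a t * g t) \<le> A * B"
    using a_bounds[OF t] assms(2)[OF t] by (auto simp: abs_mult intro!: mult_mono)
qed auto

lemma rhs_integrable:
  assumes "u \<in> borel_measurable (lebesgue_on {0..T})" "continuous_on UNIV q"
    "\<And>t. t \<in> {0..T} \<Longrightarrow> \<bar>q (u t)\<bar> \<le> B"
  shows "(\<lambda>t. a t * q (u t)) absolutely_integrable_on {0..T}" "rhs q s u absolutely_integrable_on {0..T}"
proof -
  show aq: "(\<lambda>t. a t * q (u t)) absolutely_integrable_on {0..T}"
    using assms by (intro integrable_a_mult measurable_compose[OF assms(1) borel_measurable_continuous_onI])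
  show "rhs q s u absolutely_integrable_on {0..T}"
    unfolding rhs_def[abs_def] by (intro set_integral_diff(1) set_integral_add(1) aq e_int) auto
qed

lemma rhs_integrable_continuous:
  assumes u: "continuous_on {0..T} u" and q: "continuous_on UNIV q"
  shows "(\<lambda>t. a t * q (u t)) absolutely_integrable_on {0..T}" "rhs q s u absolutely_integrable_on {0..T}"
proof -
  have "continuous_on {0..T} (\<lambda>t. q (u t))"
    using continuous_on_compose2[OF q u] by auto
  then have "bounded ((\<lambda>t. q (u t)) ` {0..T})"
    by (intro compact_imp_bounded compact_continuous_image) auto
  then obtain B where "\<And>t. t \<in> {0..T} \<Longrightarrow> \<bar>q (u t)\<bar> \<le> B"
    unfolding bounded_iff by (metis imageI real_norm_def)
  moreover have "u \<in> borel_measurable (lebesgue_on {0..T})"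
    by (rule continuous_imp_measurable_on_sets_lebesgue[OF u]) auto
  ultimately show "(\<lambda>t. a t * q (u t)) absolutely_integrable_on {0..T}" "rhs q s u absolutely_integrable_on {0..T}"
    using rhs_integrable[of u q B] q by blast+
qed

lemma weak_solD:
  assumes "weak_sol F q s u u'"
  shows "\<And>t. t \<in> {0..T} \<Longrightarrow> (u has_real_derivative u' t) (at t within {0..T})"
    "continuous_on {0..T} u'" "continuous_on {0..T} u" "u 0 = u T" "u' 0 = u' T"
    "\<And>t. t \<in> {0..T} \<Longrightarrow> \<phi> (u' t) + F (u t) = \<phi> (u' 0) + F (u 0) + integral {0..t} (rhs q s u)"
proof -
  show 1: "\<And>t. t \<in> {0..T} \<Longrightarrow> (u has_real_derivative u' t) (at t within {0..T})"
    "continuous_on {0..T} u'" "u 0 = u T" "u' 0 = u' T"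
    "\<And>t. t \<in> {0..T} \<Longrightarrow> \<phi> (u' t) + F (u t) = \<phi> (u' 0) + F (u 0) + integral {0..t} (rhs q s u)"
    using assms unfolding weak_sol_def by blast+
  show "continuous_on {0..T} u" by (rule DERIV_continuous_on[OF 1(1)])
qed

section \<open>Mean values and a priori bounds\<close>

lemma integral_rhs:
  assumes "continuous_on {0..T} u" "continuous_on UNIV q"
  shows "integral {0..T} (rhs q s u) = s * T - integral {0..T} (\<lambda>t. a t * q (u t))"
proof -
  have "integral {0..T} (rhs q s u) = integral {0..T} (\<lambda>t. s + e t) - integral {0..T} (\<lambda>t. a t * q (u t))"
    unfolding rhs_def[abs_def]
    using rhs_integrable_continuous(1)[OF assms] e_int
    by (intro integral_diff integrable_add) (auto simp: absolutely_integrable_on_def)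
  also have "integral {0..T} (\<lambda>t. s + e t) = s * T"
    using e_int T by (subst integral_add) (auto simp: absolutely_integrable_on_def e_mean)
  finally show ?thesis .
qed

lemma weak_sol_mean:
  assumes "weak_sol F q s u u'" "continuous_on UNIV q"
  shows "integral {0..T} (\<lambda>t. a t * q (u t)) = s * T"
proof -
  have "\<phi> (u' T) + F (u T) = \<phi> (u' T) + F (u T) + integral {0..T} (rhs q s u)"
    using weak_solD(6)[OF assms(1), of T] T unfolding weak_solD(4,5)[OF assms(1)] by simp
  then show ?thesis
    using integral_rhs[OF weak_solD(3)[OF assms(1)] assms(2), of s] by linarith
qed

lemma integral_deriv_comp_eq_0:
  assumes "\<And>t. t \<in> {0..T} \<Longrightarrow> (u has_real_derivative u' t) (at t within {0..T})" "u 0 = u T"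
    and "continuous_on UNIV F"
  shows "integral {0..T} (\<lambda>t. F (u t) * u' t) = 0"
proof -
  obtain G where G: "\<And>x. (G has_real_derivative F x) (at x)"
    using continuous_imp_antiderivative[OF assms(3)] by blast
  have "((\<lambda>t. F (u t) * u' t) has_integral G (u T) - G (u 0)) {0..T}"
  proof (rule fundamental_theorem_of_calculus)
    fix t assume t: "t \<in> {0..T}"
    have "((\<lambda>t. G (u t)) has_real_derivative F (u t) * u' t) (at t within {0..T})"
      using DERIV_chain2[OF G assms(1)[OF t]] .
    then show "((\<lambda>t. G (u t)) has_vector_derivative F (u t) * u' t) (at t within {0..T})"
      by (simp add: has_real_derivative_iff_has_vector_derivative)
  qed (use T in auto)
  then show ?thesis using assms(2) by (simp add: integral_unique)
qed

text \<open>Only an upper bound of \<open>q\<close> is available. From \<open>a t \<ge> 0\<close>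
  and \<open>q x \<le> Q\<close> follows
  \<open>\<bar>a t * q (u t)\<bar> \<le> 2 * Q * a t - a t * q (u t)\<close>, and the integral of
  the last term is known to be \<open>s * T\<close>. It cancels a large positive level, so only the
  lower bound \<open>S\<close> of the level remains in the estimate.\<close>

lemma rhs_L1_bound:
  assumes w: "weak_sol F q s u u'" and q: "continuous_on UNIV q" and Q: "\<And>x. q x \<le> Q" "0 \<le> Q" and "S \<le> s"
  shows "integral {0..T} (\<lambda>t. \<bar>rhs q s u t\<bar>) \<le> integral {0..T} (\<lambda>t. \<bar>e t\<bar>) + 2 * Q * integral {0..T} a + 2 * \<bar>S\<bar> * T"
proof -
  note u = weak_solD(3)[OF w]
  have e': "(\<lambda>t. \<bar>e t\<bar>) integrable_on {0..T}"
    using absolutely_integrable_norm[OF e_int] by (simp add: o_def absolutely_integrable_on_def)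
  have aq: "(\<lambda>t. a t * q (u t)) integrable_on {0..T}"
    using rhs_integrable_continuous(1)[OF u q] by (simp add: absolutely_integrable_on_def)
  have ai: "a integrable_on {0..T}"
    using integrable_a_mult[of "\<lambda>_. 1" 1] by (simp add: absolutely_integrable_on_def)
  have "integral {0..T} (\<lambda>t. \<bar>rhs q s u t\<bar>) \<le> integral {0..T} (\<lambda>t. (\<bar>s\<bar> + \<bar>e t\<bar>) + (2 * Q * a t - a t * q (u t)))"
  proof (rule integral_le)
    show "(\<lambda>t. \<bar>rhs q s u t\<bar>) integrable_on {0..T}"
      using absolutely_integrable_norm[OF rhs_integrable_continuous(2)[OF u q, of s]]
      by (simp add: o_def absolutely_integrable_on_def)
    show "(\<lambda>t. (\<bar>s\<bar> + \<bar>e t\<bar>) + (2 * Q * a t - a t * q (u t))) integrable_on {0..T}"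
      by (intro integrable_add integrable_diff e' aq integrable_on_mult_right ai) auto
    fix t assume t: "t \<in> {0..T}"
    have "a t * \<bar>q (u t)\<bar> \<le> a t * (2 * Q - q (u t))"
      using a_bounds[OF t] Q(1)[of "u t"] Q(2) by (intro mult_left_mono) auto
    then have "\<bar>a t * q (u t)\<bar> \<le> 2 * Q * a t - a t * q (u t)"
      using a_bounds[OF t] by (simp add: abs_mult algebra_simps)
    then show "\<bar>rhs q s u t\<bar> \<le> (\<bar>s\<bar> + \<bar>e t\<bar>) + (2 * Q * a t - a t * q (u t))"
      unfolding rhs_def by linarith
  qed
  also have "\<dots> = (\<bar>s\<bar> * T + integral {0..T} (\<lambda>t. \<bar>e t\<bar>)) + (2 * Q * integral {0..T} a - s * T)"
  proof (rule integral_unique)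
    have "((\<lambda>t. \<bar>s\<bar>) has_integral \<bar>s\<bar> * T) {0..T}"
      using has_integral_const_real[of "\<bar>s\<bar>" 0 T] T by (simp add: mult.commute)
    moreover have "((\<lambda>t. a t * q (u t)) has_integral s * T) {0..T}"
      using integrable_integral[OF aq] weak_sol_mean[OF w q] by simp
    ultimately show "((\<lambda>t. (\<bar>s\<bar> + \<bar>e t\<bar>) + (2 * Q * a t - a t * q (u t))) has_integral
        (\<bar>s\<bar> * T + integral {0..T} (\<lambda>t. \<bar>e t\<bar>)) + (2 * Q * integral {0..T} a - s * T)) {0..T}"
      by (intro has_integral_add has_integral_diff has_integral_mult_right integrable_integral e' ai)
  qed
  finally have "integral {0..T} (\<lambda>t. \<bar>rhs q s u t\<bar>)
      \<le> (\<bar>s\<bar> * T + integral {0..T} (\<lambda>t. \<bar>e t\<bar>)) + (2 * Q * integral {0..T} a - s * T)" .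
  moreover have "\<bar>s\<bar> * T - s * T \<le> 2 * \<bar>S\<bar> * T"
    using \<open>S \<le> s\<close> T by (simp add: left_diff_distrib[symmetric])
  ultimately show ?thesis by linarith
qed

text \<open>
  The bound \<open>R\<close> depends only on \<open>Q\<close> and \<open>S\<close>. Testing the equation with \<open>u'\<close> works since
  \<open>F(u) u'\<close> has integral zero, and \<open>\<phi> (u') + F u\<close> deviates from a constant by at most the
  \<open>L\<^sup>1\<close> norm of the right-hand side.
\<close>

lemma oscillation_bound:
  obtains R where "R \<ge> 0"
    "\<And>F q s u u' t t'. weak_sol F q s u u' \<Longrightarrow> continuous_on UNIV F \<Longrightarrow> continuous_on UNIV q \<Longrightarrow>
       (\<And>x. q x \<le> Q) \<Longrightarrow> 0 \<le> Q \<Longrightarrow> S \<le> s \<Longrightarrow> t \<in> {0..T} \<Longrightarrow> t' \<in> {0..T} \<Longrightarrow> \<bar>u t - u t'\<bar> \<le> R"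
proof -
  define K where "K = max 0 (integral {0..T} (\<lambda>t. \<bar>e t\<bar>) + 2 * Q * integral {0..T} a + 2 * \<bar>S\<bar> * T)"
  have K0: "K \<ge> 0" by (simp add: K_def)
  \<comment> \<open>Beyond \<rho> one has \<open>\<bar>\<phi> x\<bar> \<ge> K + 1\<close>. The slope
    is one more than \<open>K\<close>, so that absorbing \<open>K\<close> times the integral of
    \<open>\<bar>u'\<bar>\<close> leaves that integral once.\<close>
  define \<rho> where "\<rho> = max (\<psi> (K + 1)) (- \<psi> (- (K + 1)))"
  have "\<psi> (K + 1) > 0" using \<psi>_less_iff[of 0 "K + 1"] \<psi>0 K0 by simp
  then have \<rho>0: "\<rho> > 0" by (simp add: \<rho>_def)
  have coercive: "(K + 1) * \<bar>x\<bar> \<le> \<phi> x * x + (K + 1) * \<rho>" for x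
  proof -
    consider "x \<ge> \<rho>" | "x \<le> - \<rho>" | "\<bar>x\<bar> \<le> \<rho>" by linarith
    then show ?thesis
    proof cases
      case 1
      then have "\<psi> (K + 1) \<le> \<psi> (\<phi> x)" by (simp add: \<psi>\<phi> \<rho>_def)
      then have "(K + 1) * x \<le> \<phi> x * x" using 1 \<rho>0 by (intro mult_right_mono) (auto simp: \<psi>_le_iff)
      then show ?thesis using 1 \<rho>0 K0 by (smt (verit) mult_nonneg_nonneg)
    next
      case 2
      then have "\<psi> (\<phi> x) \<le> \<psi> (- (K + 1))" by (simp add: \<psi>\<phi> \<rho>_def)
      then have "- (K + 1) * x \<le> \<phi> x * x" using 2 \<rho>0 by (intro mult_right_mono_neg) (auto simp: \<psi>_le_iff)
      moreover have "(K + 1) * \<bar>x\<bar> = - (K + 1) * x" using 2 \<rho>0 by (simp add: algebra_simps)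
      ultimately show ?thesis using \<rho>0 K0 by (smt (verit) mult_nonneg_nonneg)
    next
      case 3
      have "0 \<le> \<phi> x * x"
        using \<phi>_mono \<phi>0 strict_mono_less_eq[OF \<phi>_mono, of 0 x] strict_mono_less_eq[OF \<phi>_mono, of x 0]
        by (auto simp: zero_le_mult_iff)
      moreover have "(K + 1) * \<bar>x\<bar> \<le> (K + 1) * \<rho>" using 3 K0 by (intro mult_left_mono) auto
      ultimately show ?thesis by linarith
    qed
  qed
  show thesis
  proof
    show "(K + 1) * \<rho> * T \<ge> 0" using K0 \<rho>0 T by simp
    fix F q s u u' t t'
    assume w: "weak_sol F q s u u'" and F: "continuous_on UNIV F" and q: "continuous_on UNIV q"
      and Q: "\<And>x. q x \<le> Q" "0 \<le> Q" and "S \<le> s" and tt: "t \<in> {0..T}" "t' \<in> {0..T}"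
    note u = weak_solD[OF w]
    have rhs_int: "rhs q s u absolutely_integrable_on {0..T}"
      using rhs_integrable_continuous(2)[OF u(3) q] .
    have rhs_abs: "(\<lambda>t. \<bar>rhs q s u t\<bar>) integrable_on {0..T}"
      using absolutely_integrable_norm[OF rhs_int] by (simp add: o_def absolutely_integrable_on_def)
    define I where "I r = integral {0..r} (rhs q s u)" for r
    have I: "\<bar>I r\<bar> \<le> K" if r: "r \<in> {0..T}" for r
    proof -
      have sub: "{0..r} \<subseteq> {0..T}" using r by auto
      have "norm (I r) \<le> integral {0..r} (\<lambda>t. \<bar>rhs q s u t\<bar>)"
        unfolding I_def using rhs_int rhs_abs sub
        by (intro integral_norm_bound_integral) (auto intro: integrable_on_subinterval simp: absolutely_integrable_on_def)
      also have "\<dots> \<le> integral {0..T} (\<lambda>t. \<bar>rhs q s u t\<bar>)"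
        using rhs_abs sub by (intro integral_subset_le) (auto intro: integrable_on_subinterval)
      also have "\<dots> \<le> K"
        using rhs_L1_bound[OF w q Q \<open>S \<le> s\<close>] by (simp add: K_def)
      finally show ?thesis by simp
    qed
    define C where "C = \<phi> (u' 0) + F (u 0)"
    have y: "\<phi> (u' r) = C + I r - F (u r)" if "r \<in> {0..T}" for r
      using u(6)[OF that] by (simp add: I_def C_def)
    have I_cont: "continuous_on {0..T} I"
      unfolding I_def using rhs_int by (intro indefinite_integral_continuous_1) (simp add: absolutely_integrable_on_def)
    have Fu_cont: "continuous_on {0..T} (\<lambda>t. F (u t))"
      using continuous_on_compose2[OF F u(3)] by auto
    have int_u': "(u' has_integral 0) {0..T}"
      using fundamental_theorem_of_calculus[of 0 T u u'] u(1,4) T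
      by (simp add: has_real_derivative_iff_has_vector_derivative)
    have "integral {0..T} (\<lambda>r. \<phi> (u' r) * u' r)
        = integral {0..T} (\<lambda>r. C * u' r + I r * u' r - F (u r) * u' r)"
      by (intro integral_cong) (simp add: y algebra_simps)
    also have "\<dots> = C * 0 + integral {0..T} (\<lambda>r. I r * u' r) - 0"
    proof (rule integral_unique, intro has_integral_diff has_integral_add has_integral_mult_right int_u')
      show "((\<lambda>r. I r * u' r) has_integral integral {0..T} (\<lambda>r. I r * u' r)) {0..T}"
        by (intro integrable_integral integrable_continuous_real continuous_on_mult I_cont u(2))
      have "(\<lambda>r. F (u r) * u' r) integrable_on {0..T}"
        by (intro integrable_continuous_real continuous_on_mult Fu_cont u(2))
      then show "((\<lambda>r. F (u r) * u' r) has_integral 0) {0..T}"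
        using integral_deriv_comp_eq_0[OF u(1,4) F] by (metis integrable_integral)
    qed
    also have "\<dots> = integral {0..T} (\<lambda>r. I r * u' r)" by simp
    also have "\<dots> \<le> integral {0..T} (\<lambda>r. K * \<bar>u' r\<bar>)"
    proof (rule integral_le)
      fix r assume "r \<in> {0..T}"
      then have "\<bar>I r\<bar> * \<bar>u' r\<bar> \<le> K * \<bar>u' r\<bar>" using I by (intro mult_right_mono) auto
      then show "I r * u' r \<le> K * \<bar>u' r\<bar>" by (metis abs_ge_self abs_mult order_trans)
    qed (use I_cont u(2) in \<open>auto intro!: integrable_continuous_real continuous_intros\<close>)
    finally have 1: "integral {0..T} (\<lambda>r. \<phi> (u' r) * u' r) \<le> K * integral {0..T} (\<lambda>r. \<bar>u' r\<bar>)" by simp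
    have \<phi>u': "continuous_on {0..T} (\<lambda>r. \<phi> (u' r))"
      using continuous_on_compose2[OF \<phi>_cont u(2)] by auto
    have "integral {0..T} (\<lambda>r. (K + 1) * \<bar>u' r\<bar>) \<le> integral {0..T} (\<lambda>r. \<phi> (u' r) * u' r + (K + 1) * \<rho>)"
      using \<phi>u' u(2) coercive by (intro integral_le integrable_continuous_real continuous_intros) auto
    also have "\<dots> = integral {0..T} (\<lambda>r. \<phi> (u' r) * u' r) + (K + 1) * \<rho> * T"
      using \<phi>u' u(2) T by (subst integral_add) (auto intro!: integrable_continuous_real continuous_intros)
    finally have "(K + 1) * integral {0..T} (\<lambda>r. \<bar>u' r\<bar>)
        \<le> integral {0..T} (\<lambda>r. \<phi> (u' r) * u' r) + (K + 1) * \<rho> * T"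
      by (simp only: integral_mult_right)
    moreover have "(K + 1) * integral {0..T} (\<lambda>r. \<bar>u' r\<bar>) = K * integral {0..T} (\<lambda>r. \<bar>u' r\<bar>) + integral {0..T} (\<lambda>r. \<bar>u' r\<bar>)"
      by (simp only: distrib_right mult_1_left)
    ultimately have R: "integral {0..T} (\<lambda>r. \<bar>u' r\<bar>) \<le> (K + 1) * \<rho> * T"
      using 1 by linarith
    have le: "\<bar>u r - u r'\<bar> \<le> (K + 1) * \<rho> * T" if r: "0 \<le> r'" "r' \<le> r" "r \<le> T" for r r'
    proof -
      have sub: "{r'..r} \<subseteq> {0..T}" using r by auto
      have "(u' has_integral u r - u r') {r'..r}"
      proof (rule fundamental_theorem_of_calculus)
        fix x assume "x \<in> {r'..r}"
        then have "(u has_real_derivative u' x) (at x within {r'..r})"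
          using DERIV_subset[OF u(1) sub] sub by blast
        then show "(u has_vector_derivative u' x) (at x within {r'..r})"
          by (simp only: has_real_derivative_iff_has_vector_derivative)
      qed (use r in auto)
      then have "u r - u r' = integral {r'..r} u'" by (simp add: integral_unique)
      also have "norm \<dots> \<le> integral {r'..r} (\<lambda>r. \<bar>u' r\<bar>)"
      proof (rule integral_norm_bound_integral)
        show "u' integrable_on {r'..r}" "(\<lambda>r. \<bar>u' r\<bar>) integrable_on {r'..r}"
          using continuous_on_subset[OF u(2) sub]
          by (intro integrable_continuous_real continuous_on_rabs; assumption)+
      qed simp
      also have "\<dots> \<le> integral {0..T} (\<lambda>r. \<bar>u' r\<bar>)"
        using continuous_on_subset[OF u(2) sub] u(2) sub
        by (intro integral_subset_le integrable_continuous_real continuous_on_rabs) auto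
      finally show ?thesis using R by simp
    qed
    show "\<bar>u t - u t'\<bar> \<le> (K + 1) * \<rho> * T"
    proof (cases "t' \<le> t")
      case True
      then show ?thesis using le[of t' t] tt by simp
    next
      case False
      then show ?thesis using le[of t t'] tt by (simp only: atLeastAtMost_iff abs_minus_commute[of "u t"])
    qed
  qed
qed

text \<open>As \<open>F (u t)\<close> is continuously differentiable, absolute continuity passes
  between \<open>\<phi> (u' t)\<close> and \<open>\<phi> (u' t) + F (u t)\<close>. In one direction
  an absolutely continuous function is the integral of its almost everywhere derivative; in the
  other an indefinite integral is absolutely continuous with the integrand as derivative almost
  everywhere.\<close>

lemma periodic_solution_iff_weak_sol:
  assumes F: "\<And>x. (F has_real_derivative f x) (at x)" and f: "continuous_on UNIV f"
    and q: "continuous_on UNIV q"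
  shows "periodic_solution T \<phi> f a q e s u \<longleftrightarrow> (\<exists>u'. weak_sol F q s u u')"
proof -
  have chain: "((\<lambda>t. F (u t)) has_real_derivative f (u t) * u' t) (at t within {0..T})"
    if "(u has_real_derivative u' t) (at t within {0..T})" for u u' :: "real \<Rightarrow> real" and t
    using DERIV_chain2[OF F that] .
  have Fu: "abs_cont_on 0 T (\<lambda>t. F (u t))"
    if u: "\<And>t. t \<in> {0..T} \<Longrightarrow> (u has_real_derivative u' t) (at t within {0..T})" and u': "continuous_on {0..T} u'"
    for u u'
  proof (rule abs_cont_on_C1)
    show "continuous_on {0..T} (\<lambda>t. f (u t) * u' t)"
      using DERIV_continuous_on[OF u] u' by (intro continuous_on_mult continuous_on_compose2[OF f]) auto
  qed (rule chain[OF u])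
  show ?thesis
  proof
    assume "periodic_solution T \<phi> f a q e s u"
    then obtain u' where u: "\<And>t. t \<in> {0..T} \<Longrightarrow> (u has_real_derivative u' t) (at t within {0..T})"
      and u': "continuous_on {0..T} u'" and per: "u 0 = u T" "u' 0 = u' T"
      and ac: "abs_cont_on 0 T (\<lambda>t. \<phi> (u' t))"
      and ae: "AE t in lebesgue. t \<in> {0..T} \<longrightarrow> ((\<lambda>r. \<phi> (u' r)) has_real_derivative
                 (s + e t - f (u t) * u' t - a t * q (u t))) (at t within {0..T})"
      unfolding periodic_solution_def by blast
    obtain N where N: "negligible N" "{t. \<not> (t \<in> {0..T} \<longrightarrow> ((\<lambda>r. \<phi> (u' r)) has_real_derivative
                 (s + e t - f (u t) * u' t - a t * q (u t))) (at t within {0..T}))} \<subseteq> N"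
      using ae unfolding eventually_ae_filter_negligible by blast
    \<comment> \<open>The sum is written as a difference to match
      \<open>abs_cont_on_diff\<close>.\<close>
    define y where "y t = \<phi> (u' t) - (- F (u t))" for t
    have "abs_cont_on 0 T (\<lambda>t. 0 - F (u t))"
      by (intro abs_cont_on_diff Fu[OF u u'] abs_cont_on_Lipschitz[of _ _ _ 0]) auto
    then have y_ac: "abs_cont_on 0 T y"
      unfolding y_def by (intro abs_cont_on_diff ac) simp
    have y_deriv: "(y has_real_derivative rhs q s u t) (at t within {0..T})" if t: "t \<in> {0..T} - N" for t
    proof -
      have 1: "((\<lambda>r. \<phi> (u' r)) has_real_derivative (s + e t - f (u t) * u' t - a t * q (u t))) (at t within {0..T})"
        using N(2) t by blast
      have "(y has_real_derivative (s + e t - f (u t) * u' t - a t * q (u t)) - (- (f (u t) * u' t))) (at t within {0..T})"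
        unfolding y_def[abs_def] using t by (intro DERIV_diff 1 DERIV_minus chain u) auto
      then show ?thesis by (simp add: rhs_def algebra_simps)
    qed
    have "\<phi> (u' t) + F (u t) = \<phi> (u' 0) + F (u 0) + integral {0..t} (rhs q s u)" if t: "t \<in> {0..T}" for t
    proof -
      have sub: "{0..t} \<subseteq> {0..T}" using t by auto
      have "(rhs q s u has_integral y t - y 0) {0..t}"
      proof (rule abs_cont_on_has_integral_derivative[OF _ _ N(1)])
        show "abs_cont_on 0 t y" using y_ac t by (intro abs_cont_on_subinterval[OF y_ac]) auto
        show "(y has_real_derivative rhs q s u r) (at r within {0..t})" if "r \<in> {0..t} - N" for r
          using that sub by (intro DERIV_subset[OF y_deriv sub]) auto
      qed (use t in auto)
      then show ?thesis by (simp add: integral_unique y_def)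
    qed
    then show "\<exists>u'. weak_sol F q s u u'"
      unfolding weak_sol_def using u u' per by blast
  next
    assume "\<exists>u'. weak_sol F q s u u'"
    then obtain u' where w: "weak_sol F q s u u'" ..
    note u = weak_solD[OF w]
    define y where "y t = (\<phi> (u' 0) + F (u 0)) + integral {0..t} (rhs q s u)" for t
    have \<phi>u': "\<phi> (u' t) = y t - F (u t)" if "t \<in> {0..T}" for t
      using u(6)[OF that] by (simp add: y_def)
    have rhs_int: "rhs q s u absolutely_integrable_on {0..T}"
      using rhs_integrable_continuous(2)[OF u(3) q] .
    have "abs_cont_on 0 T (\<lambda>t. integral {0..t} (rhs q s u) - (- (\<phi> (u' 0) + F (u 0))))"
      by (intro abs_cont_on_diff abs_cont_on_integral rhs_int abs_cont_on_Lipschitz[of _ _ _ 0]) auto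
    then have "abs_cont_on 0 T y"
      by (rule abs_cont_on_cong) (simp add: y_def)
    then have "abs_cont_on 0 T (\<lambda>t. y t - F (u t))"
      by (intro abs_cont_on_diff Fu[OF u(1,2)])
    then have ac: "abs_cont_on 0 T (\<lambda>t. \<phi> (u' t))"
      by (rule abs_cont_on_cong) (rule \<phi>u')
    obtain N where "negligible N" and N:
      "\<And>t. t \<in> {0..T} - N \<Longrightarrow> ((\<lambda>t. integral {0..t} (rhs q s u)) has_real_derivative rhs q s u t) (at t within {0..T})"
      using negligible_derivative_indefinite_integral[of "rhs q s u" 0 T] rhs_int
      by (auto simp: absolutely_integrable_on_def)
    have "((\<lambda>r. \<phi> (u' r)) has_real_derivative (s + e t - f (u t) * u' t - a t * q (u t))) (at t within {0..T})"
      if t: "t \<in> {0..T} - N" for t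
    proof (rule has_field_derivative_transform_within)
      have "((\<lambda>t. y t - F (u t)) has_real_derivative (0 + rhs q s u t) - f (u t) * u' t) (at t within {0..T})"
        unfolding y_def using t u(1) by (intro DERIV_diff DERIV_add DERIV_const N chain) auto
      then show "((\<lambda>t. y t - F (u t)) has_real_derivative (s + e t - f (u t) * u' t - a t * q (u t))) (at t within {0..T})"
        by (simp add: rhs_def algebra_simps)
    qed (use t \<phi>u' in \<open>auto intro: zero_less_one\<close>)
    then have "AE t in lebesgue. t \<in> {0..T} \<longrightarrow> ((\<lambda>r. \<phi> (u' r)) has_real_derivative
                 (s + e t - f (u t) * u' t - a t * q (u t))) (at t within {0..T})"
      unfolding eventually_ae_filter_negligible using \<open>negligible N\<close> by (intro exI[of _ N]) auto
    then show "periodic_solution T \<phi> f a q e s u"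
      unfolding periodic_solution_def using u ac by blast
  qed
qed

end

section \<open>The problem with free level\<close>

lemma integral_const_0: "0 \<le> t \<Longrightarrow> integral {0..t} (\<lambda>r. c) = c * (t::real)" for c :: real
  by simp

text \<open>\<open>F\<close> and \<open>q\<close> stand for the clipped functions. Being bounded and
  uniformly continuous, they can be composed with arbitrary measurable functions, with estimates
  uniform in the function.\<close>

locale truncated_problem = periodic_phi_laplacian +
  fixes F q :: "real \<Rightarrow> real" and B :: real
  assumes F_uc: "uniformly_continuous_on UNIV F" and q_uc: "uniformly_continuous_on UNIV q"
    and F_bound: "\<And>x. \<bar>F x\<bar> \<le> B" and q_bound: "\<And>x. \<bar>q x\<bar> \<le> B"
begin

abbreviation meas :: "(real \<Rightarrow> real) set" where
  "meas \<equiv> borel_measurable (lebesgue_on {0..T})"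

text \<open>Uniform continuity for the supremum distance on all measurable functions. Scalar
  quantities such as \<sigma> and \<kappa> are treated as operators whose values are constant in
  \<open>t\<close>, so that the same closure rules apply to them.\<close>

definition sup_uc :: "((real \<Rightarrow> real) \<Rightarrow> real \<Rightarrow> real) \<Rightarrow> bool" where
  "sup_uc G \<longleftrightarrow> (\<forall>\<epsilon>>0. \<exists>\<delta>>0. \<forall>u\<in>meas. \<forall>w\<in>meas. (\<forall>t\<in>{0..T}. \<bar>u t - w t\<bar> \<le> \<delta>) \<longrightarrow>
     (\<forall>t\<in>{0..T}. \<bar>G u t - G w t\<bar> \<le> \<epsilon>))"

text \<open>
  \<open>\<sigma> u\<close> is the only level for which the right-hand side has mean zero, and \<open>\<kappa> g\<close> the only constant for
  which \<open>\<psi> (g + \<kappa> g)\<close> has, so that \<open>N u\<close> is periodic.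
\<close>

definition \<sigma> :: "(real \<Rightarrow> real) \<Rightarrow> real" where
  "\<sigma> u = integral {0..T} (\<lambda>t. a t * q (u t)) / T"

definition H :: "(real \<Rightarrow> real) \<Rightarrow> real \<Rightarrow> real" where
  "H u t = integral {0..t} (rhs q (\<sigma> u) u)"

definition \<kappa> :: "(real \<Rightarrow> real) \<Rightarrow> real" where
  "\<kappa> g = Sup {C. integral {0..T} (\<lambda>t. \<psi> (g t + C)) \<le> 0}"

definition flux :: "(real \<Rightarrow> real) \<Rightarrow> real \<Rightarrow> real" where
  "flux u t = H u t - F (u t)"

definition slope :: "(real \<Rightarrow> real) \<Rightarrow> real \<Rightarrow> real" where
  "slope u t = \<psi> (flux u t + \<kappa> (flux u))"

definition N :: "(real \<Rightarrow> real) \<Rightarrow> real \<Rightarrow> real" where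
  "N u t = integral {0..t} (slope u)"

lemma F_cont: "continuous_on UNIV F" and q_cont: "continuous_on UNIV q"
  using F_uc q_uc by (simp_all add: uniformly_continuous_imp_continuous)

lemma B_nonneg: "0 \<le> B"
  using F_bound[of 0] by linarith

lemma A_nonneg: "0 \<le> A"
  using a_bounds[of 0] T by auto

section \<open>Closure rules for uniformly continuous operators\<close>

lemma sup_ucD:
  assumes "sup_uc G" "\<epsilon> > 0"
  shows "\<exists>\<delta>>0. \<forall>u\<in>meas. \<forall>w\<in>meas. (\<forall>t\<in>{0..T}. \<bar>u t - w t\<bar> \<le> \<delta>) \<longrightarrow>
     (\<forall>t\<in>{0..T}. \<bar>G u t - G w t\<bar> \<le> \<epsilon>)"
  using assms unfolding sup_uc_def by blast

text \<open>The bound \<open>d\<close> is assumed on the whole interval, so \<open>G'\<close> may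
  depend on \<open>G\<close> nonlocally: through integrals, minima or \<kappa>.\<close>

lemma sup_uc_Lipschitz:
  assumes G: "sup_uc G" and "L \<ge> 0"
    and L: "\<And>u w d. u \<in> meas \<Longrightarrow> w \<in> meas \<Longrightarrow> d \<ge> 0 \<Longrightarrow> (\<And>t. t \<in> {0..T} \<Longrightarrow> \<bar>G u t - G w t\<bar> \<le> d) \<Longrightarrow>
              (\<And>t. t \<in> {0..T} \<Longrightarrow> \<bar>G' u t - G' w t\<bar> \<le> L * d)"
  shows "sup_uc G'"
  unfolding sup_uc_def
proof (intro allI impI)
  fix \<epsilon> :: real assume "\<epsilon> > 0"
  then have pos: "\<epsilon> / (L + 1) > 0" using \<open>L \<ge> 0\<close> by simp
  have "L * (\<epsilon> / (L + 1)) \<le> (L + 1) * (\<epsilon> / (L + 1))"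
    using pos by (intro mult_right_mono) auto
  also have "\<dots> = \<epsilon>" using \<open>L \<ge> 0\<close> by simp
  finally have le: "L * (\<epsilon> / (L + 1)) \<le> \<epsilon>" .
  obtain \<delta> where "\<delta> > 0" and \<delta>: "\<forall>u\<in>meas. \<forall>w\<in>meas. (\<forall>t\<in>{0..T}. \<bar>u t - w t\<bar> \<le> \<delta>) \<longrightarrow>
     (\<forall>t\<in>{0..T}. \<bar>G u t - G w t\<bar> \<le> \<epsilon> / (L + 1))"
    using sup_ucD[OF G pos] by blast
  show "\<exists>\<delta>>0. \<forall>u\<in>meas. \<forall>w\<in>meas. (\<forall>t\<in>{0..T}. \<bar>u t - w t\<bar> \<le> \<delta>) \<longrightarrow>
     (\<forall>t\<in>{0..T}. \<bar>G' u t - G' w t\<bar> \<le> \<epsilon>)"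
  proof (rule exI[of _ \<delta>], intro conjI ballI impI \<open>\<delta> > 0\<close>)
    fix u w t assume uw: "u \<in> meas" "w \<in> meas" "\<forall>t\<in>{0..T}. \<bar>u t - w t\<bar> \<le> \<delta>" and t: "t \<in> {0..T}"
    have "\<bar>G' u t - G' w t\<bar> \<le> L * (\<epsilon> / (L + 1))"
      using pos t uw \<delta> by (intro L[OF uw(1,2)]) auto
    then show "\<bar>G' u t - G' w t\<bar> \<le> \<epsilon>" using le by linarith
  qed
qed

lemma sup_uc_add:
  assumes "sup_uc G" "sup_uc G'"
  shows "sup_uc (\<lambda>u t. G u t + G' u t)"
  unfolding sup_uc_def
proof (intro allI impI)
  fix \<epsilon> :: real assume "\<epsilon> > 0"
  then have "\<epsilon>/2 > 0" by simp
  obtain \<delta> where "\<delta> > 0" and \<delta>: "\<forall>u\<in>meas. \<forall>w\<in>meas. (\<forall>t\<in>{0..T}. \<bar>u t - w t\<bar> \<le> \<delta>) \<longrightarrow>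
     (\<forall>t\<in>{0..T}. \<bar>G u t - G w t\<bar> \<le> \<epsilon>/2)"
    using sup_ucD[OF assms(1) \<open>\<epsilon>/2 > 0\<close>] by blast
  obtain \<delta>' where "\<delta>' > 0" and \<delta>': "\<forall>u\<in>meas. \<forall>w\<in>meas. (\<forall>t\<in>{0..T}. \<bar>u t - w t\<bar> \<le> \<delta>') \<longrightarrow>
     (\<forall>t\<in>{0..T}. \<bar>G' u t - G' w t\<bar> \<le> \<epsilon>/2)"
    using sup_ucD[OF assms(2) \<open>\<epsilon>/2 > 0\<close>] by blast
  show "\<exists>\<delta>>0. \<forall>u\<in>meas. \<forall>w\<in>meas. (\<forall>t\<in>{0..T}. \<bar>u t - w t\<bar> \<le> \<delta>) \<longrightarrow>
     (\<forall>t\<in>{0..T}. \<bar>G u t + G' u t - (G w t + G' w t)\<bar> \<le> \<epsilon>)"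
  proof (rule exI[of _ "min \<delta> \<delta>'"], intro conjI ballI impI)
    fix u w t assume "u \<in> meas" "w \<in> meas" "\<forall>t\<in>{0..T}. \<bar>u t - w t\<bar> \<le> min \<delta> \<delta>'" "t \<in> {0..T}"
    then have "\<bar>G u t - G w t\<bar> \<le> \<epsilon>/2" "\<bar>G' u t - G' w t\<bar> \<le> \<epsilon>/2"
      using \<delta> \<delta>' by auto
    then show "\<bar>G u t + G' u t - (G w t + G' w t)\<bar> \<le> \<epsilon>" by linarith
  qed (use \<open>\<delta> > 0\<close> \<open>\<delta>' > 0\<close> in auto)
qed

text \<open>The range restriction \<open>X\<close> is made for \<psi>, whose uniform continuity is
  used on a compact interval only.\<close>

lemma sup_uc_compose:
  assumes G: "sup_uc G" and h: "uniformly_continuous_on X h"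
    and X: "\<And>u t. u \<in> meas \<Longrightarrow> t \<in> {0..T} \<Longrightarrow> G u t \<in> X"
  shows "sup_uc (\<lambda>u t. h (G u t))"
  unfolding sup_uc_def
proof (intro allI impI)
  fix \<epsilon> :: real assume "\<epsilon> > 0"
  obtain d where "d > 0" and d: "\<And>x y. x \<in> X \<Longrightarrow> y \<in> X \<Longrightarrow> dist y x < d \<Longrightarrow> dist (h y) (h x) < \<epsilon>"
    using h \<open>\<epsilon> > 0\<close> unfolding uniformly_continuous_on_def by metis
  then have "d/2 > 0" by simp
  obtain \<delta> where "\<delta> > 0" and \<delta>: "\<forall>u\<in>meas. \<forall>w\<in>meas. (\<forall>t\<in>{0..T}. \<bar>u t - w t\<bar> \<le> \<delta>) \<longrightarrow>
     (\<forall>t\<in>{0..T}. \<bar>G u t - G w t\<bar> \<le> d/2)"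
    using sup_ucD[OF G \<open>d/2 > 0\<close>] by blast
  show "\<exists>\<delta>>0. \<forall>u\<in>meas. \<forall>w\<in>meas. (\<forall>t\<in>{0..T}. \<bar>u t - w t\<bar> \<le> \<delta>) \<longrightarrow>
     (\<forall>t\<in>{0..T}. \<bar>h (G u t) - h (G w t)\<bar> \<le> \<epsilon>)"
  proof (rule exI[of _ \<delta>], intro conjI ballI impI \<open>\<delta> > 0\<close>)
    fix u w t assume uw: "u \<in> meas" "w \<in> meas" "\<forall>t\<in>{0..T}. \<bar>u t - w t\<bar> \<le> \<delta>" "t \<in> {0..T}"
    then have "\<bar>G u t - G w t\<bar> \<le> d/2" using \<delta> by blast
    then have "dist (h (G u t)) (h (G w t)) < \<epsilon>"
      using \<open>d > 0\<close> X uw by (intro d) (auto simp: dist_real_def)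
    then show "\<bar>h (G u t) - h (G w t)\<bar> \<le> \<epsilon>" by (simp add: dist_real_def)
  qed
qed

lemma sup_uc_eval: "sup_uc (\<lambda>u t. u t)" "sup_uc (\<lambda>u t. u 0)"
  unfolding sup_uc_def using T by auto

section \<open>Estimates for the level and the flux\<close>

lemma rhs_int: "u \<in> meas \<Longrightarrow> (\<lambda>t. a t * q (u t)) absolutely_integrable_on {0..T}"
   "u \<in> meas \<Longrightarrow> rhs q s u absolutely_integrable_on {0..T}"
  using rhs_integrable[of u q B] q_cont q_bound by blast+

lemma aq_integrable: "u \<in> meas \<Longrightarrow> (\<lambda>t. a t * q (u t)) integrable_on {0..T}"
  using rhs_int(1) by (simp add: absolutely_integrable_on_def)

lemma rhs_integrable_on: "u \<in> meas \<Longrightarrow> t \<in> {0..T} \<Longrightarrow> rhs q s u integrable_on {0..t}"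
  using rhs_int(2)[of u s] by (auto intro: integrable_on_subinterval simp: absolutely_integrable_on_def)

lemma \<sigma>_diff:
  assumes "u \<in> meas" "w \<in> meas" "\<And>t. t \<in> {0..T} \<Longrightarrow> \<bar>q (u t) - q (w t)\<bar> \<le> d"
  shows "\<bar>\<sigma> u - \<sigma> w\<bar> \<le> A * d"
proof -
  have "integral {0..T} (\<lambda>t. a t * q (u t)) - integral {0..T} (\<lambda>t. a t * q (w t))
      = integral {0..T} (\<lambda>t. a t * q (u t) - a t * q (w t))"
    by (rule integral_diff[symmetric]) (intro aq_integrable assms)+
  also have "norm \<dots> \<le> integral {0..T} (\<lambda>t. A * d)"
  proof (rule integral_norm_bound_integral)
    fix t assume t: "t \<in> {0..T}"
    have "a t * q (u t) - a t * q (w t) = a t * (q (u t) - q (w t))" by (simp add: algebra_simps)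
    moreover have "\<bar>a t\<bar> * \<bar>q (u t) - q (w t)\<bar> \<le> A * d"
      using a_bounds[OF t] assms(3)[OF t] by (intro mult_mono) auto
    ultimately show "norm (a t * q (u t) - a t * q (w t)) \<le> A * d" by (simp add: abs_mult)
  qed (intro integrable_diff aq_integrable assms integrable_const_ivl)+
  also have "\<dots> = A * d * T" using T by simp
  finally show ?thesis
    using T by (simp add: \<sigma>_def diff_divide_distrib[symmetric] pos_divide_le_eq)
qed

lemma \<sigma>_bound: assumes "u \<in> meas" shows "\<bar>\<sigma> u\<bar> \<le> A * B"
proof -
  have "norm (integral {0..T} (\<lambda>t. a t * q (u t))) \<le> integral {0..T} (\<lambda>t. A * B)"
  proof (rule integral_norm_bound_integral)
    fix t assume t: "t \<in> {0..T}"
    show "norm (a t * q (u t)) \<le> A * B"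
      using a_bounds[OF t] q_bound[of "u t"] by (auto simp: abs_mult intro!: mult_mono)
  qed (use aq_integrable[OF assms] in auto)
  then show ?thesis
    using T by (simp add: \<sigma>_def pos_divide_le_eq mult_ac)
qed

text \<open>A bound for the flux: the level and \<open>a t * q (u t)\<close> each contribute
  \<open>A * B * T\<close>, the forcing its norm, and \<open>F\<close> the last
  \<open>B\<close>.\<close>

definition D :: real where
  "D = 2 * A * B * T + integral {0..T} (\<lambda>t. \<bar>e t\<bar>) + B"

lemma H_bound: assumes u: "u \<in> meas" and t: "t \<in> {0..T}" shows "\<bar>H u t\<bar> \<le> D - B"
proof -
  have e': "(\<lambda>t. \<bar>e t\<bar>) integrable_on {0..T}"
    using absolutely_integrable_norm[OF e_int] by (simp add: o_def absolutely_integrable_on_def)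
  have int: "(\<lambda>t. 2 * A * B + \<bar>e t\<bar>) integrable_on {0..T}"
    by (intro integrable_add e') auto
  have sub: "{0..t} \<subseteq> {0..T}" using t by auto
  have "norm (H u t) \<le> integral {0..t} (\<lambda>t. 2 * A * B + \<bar>e t\<bar>)"
    unfolding H_def
  proof (rule integral_norm_bound_integral[OF rhs_integrable_on[OF u t]])
    show "(\<lambda>t. 2 * A * B + \<bar>e t\<bar>) integrable_on {0..t}"
      using int sub by (rule integrable_on_subinterval)
    fix r assume "r \<in> {0..t}"
    then have r: "r \<in> {0..T}" using sub by blast
    have "\<bar>a r * q (u r)\<bar> \<le> A * B"
      using a_bounds[OF r] q_bound[of "u r"] by (auto simp: abs_mult intro!: mult_mono)
    then show "norm (rhs q (\<sigma> u) u r) \<le> 2 * A * B + \<bar>e r\<bar>"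
      using \<sigma>_bound[OF u] unfolding rhs_def real_norm_def by linarith
  qed
  also have "\<dots> \<le> integral {0..T} (\<lambda>t. 2 * A * B + \<bar>e t\<bar>)"
    using int sub A_nonneg B_nonneg by (intro integral_subset_le integrable_on_subinterval[OF int sub]) auto
  also have "\<dots> = D - B"
    using e' T by (subst integral_add) (auto simp: D_def)
  finally show ?thesis by simp
qed

lemma H_diff:
  assumes u: "u \<in> meas" "w \<in> meas" and d: "d \<ge> 0" "\<And>t. t \<in> {0..T} \<Longrightarrow> \<bar>q (u t) - q (w t)\<bar> \<le> d"
    and t: "t \<in> {0..T}"
  shows "\<bar>H u t - H w t\<bar> \<le> 2 * A * T * d"
proof -
  have eq: "H u t - H w t = integral {0..t} (\<lambda>r. rhs q (\<sigma> u) u r - rhs q (\<sigma> w) w r)"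
    unfolding H_def by (rule integral_diff[symmetric]) (intro rhs_integrable_on u t)+
  have "norm (H u t - H w t) \<le> integral {0..t} (\<lambda>r. 2 * A * d)"
    unfolding eq
  proof (rule integral_norm_bound_integral)
    fix r assume "r \<in> {0..t}"
    then have r: "r \<in> {0..T}" using t by auto
    have "rhs q (\<sigma> u) u r - rhs q (\<sigma> w) w r = \<sigma> u - \<sigma> w - a r * (q (u r) - q (w r))"
      by (simp add: rhs_def algebra_simps)
    moreover have "\<bar>a r * (q (u r) - q (w r))\<bar> \<le> A * d"
      using a_bounds[OF r] d(2)[OF r] by (auto simp: abs_mult intro!: mult_mono)
    ultimately show "norm (rhs q (\<sigma> u) u r - rhs q (\<sigma> w) w r) \<le> 2 * A * d"
      using \<sigma>_diff[OF u d(2)] unfolding real_norm_def by linarith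
  qed (intro integrable_diff rhs_integrable_on u t integrable_const_ivl)+
  also have "\<dots> = 2 * A * d * t" using t by (intro integral_const_0) simp
  also have "\<dots> \<le> 2 * A * d * T" using t A_nonneg d(1) by (intro mult_left_mono) auto
  finally show ?thesis by (simp add: mult_ac)
qed

lemma H_cont: "u \<in> meas \<Longrightarrow> continuous_on {0..T} (H u)"
  unfolding H_def[abs_def] using T by (intro indefinite_integral_continuous_1 rhs_integrable_on) auto

lemma flux_meas: assumes "u \<in> meas" shows "flux u \<in> meas"
  unfolding flux_def[abs_def]
  by (intro borel_measurable_diff continuous_imp_measurable_on_sets_lebesgue[OF H_cont] assms
      measurable_compose[OF assms borel_measurable_continuous_onI[OF F_cont]]) auto

lemma flux_bound: "u \<in> meas \<Longrightarrow> t \<in> {0..T} \<Longrightarrow> \<bar>flux u t\<bar> \<le> D"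
  using H_bound[of u t] F_bound[of "u t"] unfolding flux_def by linarith

lemma D_nonneg: "0 \<le> D"
  using flux_bound[of "\<lambda>_. 0" 0] T by auto

lemma \<psi>_abs_le: "\<bar>x\<bar> \<le> c \<Longrightarrow> \<bar>\<psi> x\<bar> \<le> max (\<psi> c) (- \<psi> (- c))"
  using \<psi>_le_iff[of x c] \<psi>_le_iff[of "-c" x] by linarith

section \<open>The constant for which the slope has mean zero\<close>

context
  fixes g :: "real \<Rightarrow> real"
  assumes g: "g \<in> meas" "\<And>t. t \<in> {0..T} \<Longrightarrow> \<bar>g t\<bar> \<le> D"
begin

lemma \<psi>_shift_integrable: "(\<lambda>t. \<psi> (g t + C)) integrable_on {0..T}"
proof -
  have "(\<lambda>t. \<psi> (g t + C)) absolutely_integrable_on {0..T}"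
  proof (rule measurable_bounded_by_integrable_imp_absolutely_integrable)
    show "(\<lambda>t. \<psi> (g t + C)) \<in> borel_measurable (lebesgue_on {0..T})"
      by (intro measurable_compose[OF _ borel_measurable_continuous_onI[OF \<psi>_cont]] borel_measurable_add g) auto
    fix t assume t: "t \<in> {0..T}"
    show "norm (\<psi> (g t + C)) \<le> max (\<psi> (D + \<bar>C\<bar>)) (- \<psi> (- (D + \<bar>C\<bar>)))"
      unfolding real_norm_def by (rule \<psi>_abs_le) (use g(2)[OF t] in linarith)
  qed auto
  then show ?thesis by (simp add: absolutely_integrable_on_def)
qed

lemma J_mono: "C \<le> C' \<Longrightarrow> integral {0..T} (\<lambda>t. \<psi> (g t + C)) \<le> integral {0..T} (\<lambda>t. \<psi> (g t + C'))"
  by (intro integral_le \<psi>_shift_integrable) (simp add: \<psi>_le_iff)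

lemma J_cont: "continuous_on UNIV (\<lambda>C. integral {0..T} (\<lambda>t. \<psi> (g t + C)))"
  unfolding continuous_on_sequentially
proof (intro allI ballI impI; elim conjE)
  fix x :: "nat \<Rightarrow> real" and c assume lim: "x \<longlonglongrightarrow> c"
  then have "bounded (range x)" by (intro convergent_imp_bounded) (auto simp: convergent_def)
  then obtain c0 where c0: "\<And>n. \<bar>x n\<bar> \<le> c0" unfolding bounded_iff by auto
  have "(\<lambda>n. integral {0..T} (\<lambda>t. \<psi> (g t + x n))) \<longlonglongrightarrow> integral {0..T} (\<lambda>t. \<psi> (g t + c))"
  proof (rule dominated_convergence)
    show "(\<lambda>t. max (\<psi> (D + c0)) (- \<psi> (- (D + c0)))) integrable_on {0..T}" by (rule integrable_const_ivl)
    fix n t assume t: "t \<in> {0..T}"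
    show "norm (\<psi> (g t + x n)) \<le> max (\<psi> (D + c0)) (- \<psi> (- (D + c0)))"
      unfolding real_norm_def by (rule \<psi>_abs_le) (use g(2)[OF t] c0[of n] in linarith)
  next
    fix t
    have "isCont \<psi> (g t + c)" using \<psi>_cont by (simp add: continuous_on_eq_continuous_at)
    then show "(\<lambda>n. \<psi> (g t + x n)) \<longlonglongrightarrow> \<psi> (g t + c)"
      by (rule isCont_tendsto_compose) (intro tendsto_intros lim)
  qed (rule \<psi>_shift_integrable)
  then show "((\<lambda>C. integral {0..T} (\<lambda>t. \<psi> (g t + C))) \<circ> x) \<longlonglongrightarrow> integral {0..T} (\<lambda>t. \<psi> (g t + c))"
    by (simp add: o_def)
qed

lemma J_neg: "integral {0..T} (\<lambda>t. \<psi> (g t + - D)) \<le> 0"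
proof -
  have "integral {0..T} (\<lambda>t. \<psi> (g t + - D)) \<le> integral {0..T} (\<lambda>t. 0)"
  proof (intro integral_le \<psi>_shift_integrable)
    fix t assume "t \<in> {0..T}"
    then have "\<psi> (g t + - D) \<le> \<psi> 0" using g(2)[of t] unfolding \<psi>_le_iff by linarith
    then show "\<psi> (g t + - D) \<le> 0" by (simp add: \<psi>0)
  qed (rule integrable_const_ivl)
  then show ?thesis by simp
qed

text \<open>The extra 1 makes the inequality strict, which is what bounds the set defining \<kappa>
  from above.\<close>

lemma J_pos: "0 < integral {0..T} (\<lambda>t. \<psi> (g t + (D + 1)))"
proof -
  have "\<psi> 1 > 0" using \<psi>_less_iff[of 0 1] \<psi>0 by simp
  then have "0 < integral {0..T} (\<lambda>t. \<psi> 1)" using T by simp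
  also have "\<dots> \<le> integral {0..T} (\<lambda>t. \<psi> (g t + (D + 1)))"
  proof (intro integral_le \<psi>_shift_integrable)
    fix t assume "t \<in> {0..T}"
    then show "\<psi> 1 \<le> \<psi> (g t + (D + 1))" using g(2)[of t] unfolding \<psi>_le_iff by linarith
  qed (rule integrable_const_ivl)
  finally show ?thesis .
qed

lemma \<kappa>_set: "{C. integral {0..T} (\<lambda>t. \<psi> (g t + C)) \<le> 0} \<noteq> {}"
  "bdd_above {C. integral {0..T} (\<lambda>t. \<psi> (g t + C)) \<le> 0}"
  "C \<in> {C. integral {0..T} (\<lambda>t. \<psi> (g t + C)) \<le> 0} \<Longrightarrow> C \<le> D + 1"
proof -
  show "{C. integral {0..T} (\<lambda>t. \<psi> (g t + C)) \<le> 0} \<noteq> {}" using J_neg by blast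
  show *: "C \<le> D + 1" if "C \<in> {C. integral {0..T} (\<lambda>t. \<psi> (g t + C)) \<le> 0}" for C
  proof (rule ccontr)
    assume "\<not> C \<le> D + 1"
    then have "integral {0..T} (\<lambda>t. \<psi> (g t + (D + 1))) \<le> integral {0..T} (\<lambda>t. \<psi> (g t + C))"
      by (intro J_mono) auto
    then show False using that J_pos by simp
  qed
  show "bdd_above {C. integral {0..T} (\<lambda>t. \<psi> (g t + C)) \<le> 0}"
    by (rule bdd_aboveI) (rule *)
qed

lemma \<kappa>_bound: "\<bar>\<kappa> g\<bar> \<le> D + 1"
proof -
  have "\<kappa> g \<le> D + 1" unfolding \<kappa>_def by (rule cSup_least[OF \<kappa>_set(1,3)])
  moreover have "- D \<le> \<kappa> g" unfolding \<kappa>_def using J_neg by (intro cSup_upper \<kappa>_set(2)) blast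
  ultimately show ?thesis by linarith
qed

text \<open>The set defining \<kappa> is closed, so the integral is nonpositive at its supremum. A
  zero from the intermediate value theorem belongs to the set, hence lies below \<kappa>, and
  monotonicity gives the other sign.\<close>

lemma \<kappa>_zero: "integral {0..T} (\<lambda>t. \<psi> (g t + \<kappa> g)) = 0"
proof (rule antisym)
  have "closed {C. integral {0..T} (\<lambda>t. \<psi> (g t + C)) \<le> 0}"
    by (intro closed_Collect_le J_cont) auto
  from closed_contains_Sup[OF \<kappa>_set(1,2) this]
  show "integral {0..T} (\<lambda>t. \<psi> (g t + \<kappa> g)) \<le> 0" by (simp add: \<kappa>_def)
  have "\<exists>C\<ge>- D. C \<le> D + 1 \<and> integral {0..T} (\<lambda>t. \<psi> (g t + C)) = 0"
    using J_neg J_pos D_nonneg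
    by (intro IVT') (auto intro: continuous_on_subset[OF J_cont])
  then obtain C where C: "integral {0..T} (\<lambda>t. \<psi> (g t + C)) = 0" by blast
  then have "C \<le> \<kappa> g" unfolding \<kappa>_def by (intro cSup_upper \<kappa>_set(2)) simp
  from J_mono[OF this] show "0 \<le> integral {0..T} (\<lambda>t. \<psi> (g t + \<kappa> g))" using C by simp
qed

end

text \<open>If \<open>C\<close> is admissible for \<open>g\<close>, then \<open>C - d\<close> is
  admissible for \<open>h\<close>, by monotonicity of \<psi>. Used in both directions, this makes
  \<kappa> nonexpansive for the supremum distance.\<close>

lemma \<kappa>_le:
  assumes g: "g \<in> meas" "\<And>t. t \<in> {0..T} \<Longrightarrow> \<bar>g t\<bar> \<le> D" and h: "h \<in> meas" "\<And>t. t \<in> {0..T} \<Longrightarrow> \<bar>h t\<bar> \<le> D"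
    and d: "\<And>t. t \<in> {0..T} \<Longrightarrow> \<bar>g t - h t\<bar> \<le> d"
  shows "\<kappa> g \<le> \<kappa> h + d"
  unfolding \<kappa>_def[of g]
proof (rule cSup_least[OF \<kappa>_set(1)[OF g]])
  fix C assume "C \<in> {C. integral {0..T} (\<lambda>t. \<psi> (g t + C)) \<le> 0}"
  then have C: "integral {0..T} (\<lambda>t. \<psi> (g t + C)) \<le> 0" by simp
  have "integral {0..T} (\<lambda>t. \<psi> (h t + (C - d))) \<le> integral {0..T} (\<lambda>t. \<psi> (g t + C))"
  proof (intro integral_le \<psi>_shift_integrable g h)
    fix t assume "t \<in> {0..T}"
    then show "\<psi> (h t + (C - d)) \<le> \<psi> (g t + C)" using d[of t] unfolding \<psi>_le_iff by linarith
  qed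
  then have "C - d \<le> \<kappa> h"
    unfolding \<kappa>_def using C by (intro cSup_upper \<kappa>_set(2)[OF h]) simp
  then show "C \<le> \<kappa> h + d" by simp
qed

lemma sup_uc_slope: "sup_uc slope"
proof -
  have "sup_uc (\<lambda>u t. q (u t))"
    by (rule sup_uc_compose[OF sup_uc_eval(1) q_uc]) auto
  then have H: "sup_uc H"
    by (rule sup_uc_Lipschitz[where L = "2 * A * T"]) (use A_nonneg T H_diff in auto)
  have "sup_uc (\<lambda>u t. F (u t))"
    by (rule sup_uc_compose[OF sup_uc_eval(1) F_uc]) auto
  then have "sup_uc (\<lambda>u t. - F (u t))"
    by (rule sup_uc_Lipschitz[where L = 1]) (auto simp: abs_minus_commute)
  from sup_uc_add[OF H this] have flux: "sup_uc flux"
    by (simp add: flux_def[abs_def])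
  then have "sup_uc (\<lambda>u t. \<kappa> (flux u))"
  proof (rule sup_uc_Lipschitz[where L = 1])
    fix u w d t assume "u \<in> meas" "w \<in> meas" "\<And>t. t \<in> {0..T} \<Longrightarrow> \<bar>flux u t - flux w t\<bar> \<le> d"
    then have "\<kappa> (flux u) \<le> \<kappa> (flux w) + d" "\<kappa> (flux w) \<le> \<kappa> (flux u) + d"
      by (auto intro!: \<kappa>_le flux_meas flux_bound simp: abs_minus_commute)
    then show "\<bar>\<kappa> (flux u) - \<kappa> (flux w)\<bar> \<le> 1 * d" by linarith
  qed simp
  from sup_uc_add[OF flux this] show ?thesis
    unfolding slope_def[abs_def]
  proof (rule sup_uc_compose)
    \<comment> \<open>The flux is at most \<open>D\<close> and \<kappa> at most \<open>D + 1\<close>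
      in absolute value.\<close>
    show "uniformly_continuous_on {- (2 * D + 1)..2 * D + 1} \<psi>"
      by (intro compact_uniformly_continuous continuous_on_subset[OF \<psi>_cont]) auto
    fix u t assume "u \<in> meas" "t \<in> {0..T}"
    then have "\<bar>flux u t\<bar> \<le> D" "\<bar>\<kappa> (flux u)\<bar> \<le> D + 1"
      by (auto intro: flux_bound \<kappa>_bound flux_meas)
    then have "\<bar>flux u t + \<kappa> (flux u)\<bar> \<le> 2 * D + 1" by linarith
    then show "flux u t + \<kappa> (flux u) \<in> {- (2 * D + 1)..2 * D + 1}"
      unfolding atLeastAtMost_iff by linarith
  qed
qed

section \<open>Bounds for the fixed-point operator\<close>

definition L :: real where
  "L = max (\<psi> (2 * D + 1)) (- \<psi> (- (2 * D + 1)))"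

lemma slope_bound: assumes u: "u \<in> meas" and t: "t \<in> {0..T}" shows "\<bar>slope u t\<bar> \<le> L"
proof -
  have "\<bar>\<kappa> (flux u)\<bar> \<le> D + 1" by (intro \<kappa>_bound flux_meas flux_bound u)
  then have "\<bar>flux u t + \<kappa> (flux u)\<bar> \<le> 2 * D + 1" using flux_bound[OF u t] by linarith
  then show ?thesis
    unfolding slope_def L_def by (rule \<psi>_abs_le)
qed

lemma slope_integrable: assumes u: "u \<in> meas" and t: "0 \<le> t" "t' \<le> T" shows "slope u integrable_on {t..t'}"
proof -
  have "slope u integrable_on {0..T}"
    unfolding slope_def[abs_def] by (intro \<psi>_shift_integrable flux_meas flux_bound u)
  then show ?thesis by (rule integrable_on_subinterval) (use t in auto)
qed

lemma L_nonneg: "0 \<le> L"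
  using slope_bound[of "\<lambda>_. 0" 0] T by auto

lemma N_Lipschitz: assumes u: "u \<in> meas" and t: "t \<in> {0..T}" "t' \<in> {0..T}"
  shows "\<bar>N u t - N u t'\<bar> \<le> L * \<bar>t - t'\<bar>"
proof -
  have *: "\<bar>N u r - N u r'\<bar> \<le> L * (r - r')" if "0 \<le> r'" "r' \<le> r" "r \<le> T" for r r'
  proof -
    have "slope u integrable_on {0..r}" using u that by (intro slope_integrable) auto
    then have "N u r - N u r' = integral {r'..r} (slope u)"
      unfolding N_def using Henstock_Kurzweil_Integration.integral_combine[OF that(1,2)] by fastforce
    also have "norm \<dots> \<le> integral {r'..r} (\<lambda>t. L)"
      using u that slope_bound[OF u] by (intro integral_norm_bound_integral slope_integrable) auto
    finally show ?thesis using that by (simp add: mult.commute)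
  qed
  show ?thesis
  proof (cases "t' \<le> t")
    case True
    then show ?thesis using *[of t' t] t by simp
  next
    case False
    then show ?thesis using *[of t t'] t by (simp add: abs_minus_commute)
  qed
qed

lemma N_bound: assumes "u \<in> meas" "t \<in> {0..T}" shows "\<bar>N u t\<bar> \<le> L * T"
proof -
  have "\<bar>N u t - N u 0\<bar> \<le> L * \<bar>t - 0\<bar>" using assms T by (intro N_Lipschitz) auto
  also have "\<dots> \<le> L * T" using assms L_nonneg by (intro mult_left_mono) auto
  finally show ?thesis by (simp add: N_def)
qed

lemma N_cont: assumes "u \<in> meas" shows "continuous_on {0..T} (N u)"
  unfolding N_def[abs_def] using assms T by (intro indefinite_integral_continuous_1 slope_integrable) auto

lemma sup_uc_N: "sup_uc N"
  using sup_uc_slope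
proof (rule sup_uc_Lipschitz[where L = T])
  fix u w d t assume uw: "u \<in> meas" "w \<in> meas" and d: "d \<ge> 0" "\<And>t. t \<in> {0..T} \<Longrightarrow> \<bar>slope u t - slope w t\<bar> \<le> d"
    and t: "t \<in> {0..T}"
  have eq: "N u t - N w t = integral {0..t} (\<lambda>r. slope u r - slope w r)"
    unfolding N_def by (rule integral_diff[symmetric]) (use uw t in \<open>auto intro: slope_integrable\<close>)
  have "norm (N u t - N w t) \<le> integral {0..t} (\<lambda>r. d)"
    unfolding eq using uw t d(2) by (intro integral_norm_bound_integral integrable_diff slope_integrable) auto
  also have "\<dots> = d * t" using t by (intro integral_const_0) simp
  also have "\<dots> \<le> d * T" using t d(1) by (intro mult_left_mono) auto
  finally show "\<bar>N u t - N w t\<bar> \<le> T * d" by (simp add: mult.commute)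
qed (use T in simp)

text \<open>
  The parameter \<open>c = \<eta> \<gamma>\<close> is encoded in the value \<open>u 0\<close>, so no product space is needed: at a fixed point
  \<open>\<gamma> = \<eta> (u 0 + m u)\<close>, where \<open>m u\<close> is the minimum of \<open>N u - us\<close>.
\<close>

lemma fixed_point:
  assumes us: "continuous_on {0..T} us" and "\<Gamma> \<ge> 0" and \<eta>: "\<bar>\<eta>\<bar> = 1"
  obtains v v' s' \<gamma> t0 where "weak_sol F q s' v v'" "\<gamma> = max 0 (min \<Gamma> (\<gamma> + s' - s))"
    "\<And>t. t \<in> {0..T} \<Longrightarrow> us t + \<eta> * \<gamma> \<le> v t" "t0 \<in> {0..T}" "v t0 = us t0 + \<eta> * \<gamma>"
proof -
  define m where "m u = Inf ((\<lambda>t. N u t - us t) ` {0..T})" for u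
  have m_attained: "\<exists>t0\<in>{0..T}. m u = N u t0 - us t0 \<and> (\<forall>t\<in>{0..T}. m u \<le> N u t - us t)" if "u \<in> meas" for u
  proof -
    have "continuous_on {0..T} (\<lambda>t. N u t - us t)" by (intro continuous_on_diff N_cont us that)
    then obtain t0 where t0: "t0 \<in> {0..T}" "\<forall>t\<in>{0..T}. N u t0 - us t0 \<le> N u t - us t"
      using continuous_attains_inf[of "{0..T}" "\<lambda>t. N u t - us t"] T by auto
    then have "m u = N u t0 - us t0"
      unfolding m_def by (intro cInf_eq_minimum) auto
    then show ?thesis using t0 by metis
  qed
  define clip where "clip x = max 0 (min \<Gamma> x)" for x
  \<comment> \<open>Subtracting \<open>m u\<close> makes \<open>\<eta> * clip (...)\<close> the
    minimum of \<open>G u - us\<close>. The added \<open>\<sigma> u - s\<close> moves the parameter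
    until the level equals \<open>s\<close> or \<open>clip\<close> stops it at \<open>0\<close> or
    \<Gamma>.\<close>
  define G where "G u t = N u t + (- m u + \<eta> * clip (\<eta> * (u 0 + m u) + (\<sigma> u - s)))" for u t
  obtain U where U: "\<And>t. t \<in> {0..T} \<Longrightarrow> \<bar>us t\<bar> \<le> U"
  proof -
    have "bounded (us ` {0..T})" by (intro compact_imp_bounded compact_continuous_image us) auto
    then obtain U where "\<forall>x\<in>us ` {0..T}. norm x \<le> U" unfolding bounded_iff by blast
    then show ?thesis by (intro that[of U]) auto
  qed
  have uc_m: "sup_uc (\<lambda>u t. m u)"
    using sup_uc_N
  proof (rule sup_uc_Lipschitz[where L = 1])
    fix u w d t assume uw: "u \<in> meas" "w \<in> meas" and d: "\<And>t. t \<in> {0..T} \<Longrightarrow> \<bar>N u t - N w t\<bar> \<le> d"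
    obtain t1 where t1: "t1 \<in> {0..T}" "m u = N u t1 - us t1" "\<forall>t\<in>{0..T}. m u \<le> N u t - us t"
      using m_attained[OF uw(1)] by blast
    obtain t2 where t2: "t2 \<in> {0..T}" "m w = N w t2 - us t2" "\<forall>t\<in>{0..T}. m w \<le> N w t - us t"
      using m_attained[OF uw(2)] by blast
    have "m w \<le> N w t1 - us t1" "m u \<le> N u t2 - us t2" using t1 t2 by blast+
    then show "\<bar>m u - m w\<bar> \<le> 1 * d"
      using d[OF t1(1)] d[OF t2(1)] t1(2) t2(2) by linarith
  qed simp
  have uc_\<sigma>: "sup_uc (\<lambda>u t. \<sigma> u - s)"
    by (rule sup_uc_Lipschitz[OF sup_uc_compose[OF sup_uc_eval(1) q_uc], where L = A])
       (use A_nonneg \<sigma>_diff in auto)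
  have "sup_uc (\<lambda>u t. \<eta> * (u 0 + m u))"
    using sup_uc_add[OF sup_uc_eval(2) uc_m]
    by (rule sup_uc_Lipschitz[where L = 1]) (auto simp: right_diff_distrib[symmetric] abs_mult \<eta>)
  from sup_uc_add[OF this uc_\<sigma>]
  have "sup_uc (\<lambda>u t. \<eta> * clip (\<eta> * (u 0 + m u) + (\<sigma> u - s)))"
  proof (rule sup_uc_Lipschitz[where L = 1])
    fix u w d t assume "t \<in> {0..T}" "\<And>t. t \<in> {0..T} \<Longrightarrow> \<bar>\<eta> * (u 0 + m u) + (\<sigma> u - s) - (\<eta> * (w 0 + m w) + (\<sigma> w - s))\<bar> \<le> d"
    then have le: "\<bar>\<eta> * (u 0 + m u) + (\<sigma> u - s) - (\<eta> * (w 0 + m w) + (\<sigma> w - s))\<bar> \<le> d" by blast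
    have "\<bar>clip x - clip y\<bar> \<le> \<bar>x - y\<bar>" for x y unfolding clip_def by linarith
    from order_trans[OF this le]
    show "\<bar>\<eta> * clip (\<eta> * (u 0 + m u) + (\<sigma> u - s)) - \<eta> * clip (\<eta> * (w 0 + m w) + (\<sigma> w - s))\<bar> \<le> 1 * d"
      by (simp add: right_diff_distrib[symmetric] abs_mult \<eta>)
  qed simp
  moreover have "sup_uc (\<lambda>u t. - m u)"
    using uc_m by (rule sup_uc_Lipschitz[where L = 1]) (auto simp: abs_minus_commute)
  ultimately have uc_G: "sup_uc G"
    unfolding G_def[abs_def] by (intro sup_uc_add[OF sup_uc_N] sup_uc_add)
  have "\<exists>v. continuous_on {0..T} v \<and> (\<forall>t\<in>{0..T}. G v t = v t)"
  proof (rule schauder_Lipschitz_maps[of T "2 * (L * T) + U + \<Gamma> + 1" G L])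
    have "0 \<le> U" using U[of 0] T by auto
    then show "0 < 2 * (L * T) + U + \<Gamma> + 1" using L_nonneg T \<open>\<Gamma> \<ge> 0\<close> by (simp add: add_nonneg_pos)
    fix u t assume u: "u \<in> meas" and t: "t \<in> {0..T}"
    obtain t1 where t1: "t1 \<in> {0..T}" "m u = N u t1 - us t1"
      using m_attained[OF u] by blast
    have "\<bar>\<eta> * clip (\<eta> * (u 0 + m u) + (\<sigma> u - s))\<bar> \<le> \<Gamma>"
      using \<open>\<Gamma> \<ge> 0\<close> by (simp add: abs_mult \<eta> clip_def)
    then show "\<bar>G u t\<bar> \<le> 2 * (L * T) + U + \<Gamma> + 1"
      unfolding G_def using N_bound[OF u t] N_bound[OF u t1(1)] U[OF t1(1)] t1(2) by linarith
  next
    fix u t t' assume "u \<in> meas" "t \<in> {0..T}" "t' \<in> {0..T}"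
    then show "\<bar>G u t - G u t'\<bar> \<le> L * \<bar>t - t'\<bar>"
      unfolding G_def using N_Lipschitz[of u t t'] by simp
  next
    fix v assume "continuous_on {0..T} v" "\<And>t. t \<in> {0..T} \<Longrightarrow> G v t = v t"
    then show ?thesis by blast
  qed (use T sup_ucD[OF uc_G] in auto)
  then obtain v where v: "continuous_on {0..T} v" and Gv: "\<And>t. t \<in> {0..T} \<Longrightarrow> G v t = v t" by blast
  have vm: "v \<in> meas" by (rule continuous_imp_measurable_on_sets_lebesgue[OF v]) auto
  define \<gamma> where "\<gamma> = clip (\<eta> * (v 0 + m v) + (\<sigma> v - s))"
  have v_eq: "v t = N v t - m v + \<eta> * \<gamma>" if "t \<in> {0..T}" for t
    using Gv[OF that] by (simp add: G_def \<gamma>_def)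
  have "\<eta> * \<eta> = 1" using \<eta> by (metis abs_mult_self_eq mult_1)
  have "v 0 + m v = \<eta> * \<gamma>" using v_eq[of 0] T by (simp add: N_def)
  then have "\<eta> * (v 0 + m v) = \<gamma>" using \<open>\<eta> * \<eta> = 1\<close> by (simp add: mult.assoc[symmetric])
  then have \<gamma>: "\<gamma> = max 0 (min \<Gamma> (\<gamma> + \<sigma> v - s))"
    by (metis \<gamma>_def clip_def add_diff_eq)
  have flux_cont: "continuous_on {0..T} (flux v)"
    unfolding flux_def[abs_def]
    by (intro continuous_on_diff H_cont vm continuous_on_compose2[OF F_cont v]) auto
  have slope_cont: "continuous_on {0..T} (slope v)"
    unfolding slope_def[abs_def]
    by (intro continuous_on_compose2[OF \<psi>_cont] continuous_on_add flux_cont) auto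
  have H0: "H v 0 = 0" by (simp add: H_def)
  have HT: "H v T = 0"
    using integral_rhs[OF v q_cont, of "\<sigma> v"] T by (simp add: H_def \<sigma>_def)
  have NT: "N v T = 0" unfolding N_def slope_def[abs_def]
    by (intro \<kappa>_zero flux_meas flux_bound vm)
  have v0T: "v 0 = v T" using v_eq[of 0] v_eq[of T] NT T by (simp add: N_def)
  have "weak_sol F q (\<sigma> v) v (slope v)"
    unfolding weak_sol_def
  proof (intro conjI ballI slope_cont v0T)
    fix t assume t: "t \<in> {0..T}"
    have "(N v has_real_derivative slope v t) (at t within {0..T})"
      unfolding N_def[abs_def] using integral_has_real_derivative[OF slope_cont t] .
    then have "((\<lambda>t. N v t + (- m v + \<eta> * \<gamma>)) has_real_derivative slope v t + 0) (at t within {0..T})"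
      by (intro DERIV_add DERIV_const)
    then show "(v has_real_derivative slope v t) (at t within {0..T})"
      unfolding add_0_right
      by (rule has_field_derivative_transform_within[OF _ zero_less_one t]) (simp add: v_eq)
    show "\<phi> (slope v t) + F (v t) = \<phi> (slope v 0) + F (v 0) + integral {0..t} (rhs q (\<sigma> v) v)"
      unfolding slope_def \<phi>\<psi> flux_def H0 by (simp add: H_def)
  next
    show "slope v 0 = slope v T" by (simp add: slope_def flux_def H0 HT v0T)
  qed
  moreover obtain t0 where t0: "t0 \<in> {0..T}" "m v = N v t0 - us t0" "\<forall>t\<in>{0..T}. m v \<le> N v t - us t"
    using m_attained[OF vm] by blast
  moreover have "us t + \<eta> * \<gamma> \<le> v t" if "t \<in> {0..T}" for t
    using t0(3) v_eq[OF that] that by fastforce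
  moreover have "v t0 = us t0 + \<eta> * \<gamma>" using t0 v_eq[OF t0(1)] by simp
  ultimately show thesis using that \<gamma> by blast
qed

end

section \<open>Lower solutions and multiplicity\<close>

context periodic_phi_laplacian
begin

text \<open>Integrated form of \<open>(\<phi> (u') + F u)' \<ge> s + e - a q(u)\<close>. Arbitrary
  subintervals are needed because the comparison starts at a touching point, whose position is not
  known in advance.\<close>

definition lower_sol :: "(real \<Rightarrow> real) \<Rightarrow> (real \<Rightarrow> real) \<Rightarrow> real \<Rightarrow> (real \<Rightarrow> real) \<Rightarrow> (real \<Rightarrow> real) \<Rightarrow> bool" where
  "lower_sol F q s u u' \<longleftrightarrow>
     (\<forall>t\<in>{0..T}. (u has_real_derivative u' t) (at t within {0..T})) \<and>
     u 0 = u T \<and> u' 0 = u' T \<and>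
     (\<forall>t\<in>{0..T}. \<forall>r\<in>{0..t}.
        integral {r..t} (rhs q s u) \<le> \<phi> (u' t) + F (u t) - (\<phi> (u' r) + F (u r)))"

section \<open>Comparison with lower solutions and solutions beside them\<close>

lemma weak_sol_increment:
  assumes w: "weak_sol F q s u u'" and q: "continuous_on UNIV q" and "t \<in> {0..T}" "r \<in> {0..t}"
  shows "integral {r..t} (rhs q s u) = \<phi> (u' t) + F (u t) - (\<phi> (u' r) + F (u r))"
proof -
  have "rhs q s u integrable_on {0..T}"
    using rhs_integrable_continuous(2)[OF weak_solD(3)[OF w] q] by (simp add: absolutely_integrable_on_def)
  then have "rhs q s u integrable_on {0..t}"
    using assms(3) by (auto intro: integrable_on_subinterval)
  then have "integral {0..r} (rhs q s u) + integral {r..t} (rhs q s u) = integral {0..t} (rhs q s u)"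
    using assms(4) by (intro Henstock_Kurzweil_Integration.integral_combine) auto
  moreover have "r \<in> {0..T}" using assms(3,4) by auto
  ultimately show ?thesis
    using weak_solD(6)[OF w \<open>t \<in> {0..T}\<close>] weak_solD(6)[OF w \<open>r \<in> {0..T}\<close>] by linarith
qed

lemma weak_sol_imp_lower_sol:
  assumes "weak_sol F q s u u'" "continuous_on UNIV q"
  shows "lower_sol F q s u u'"
  unfolding lower_sol_def
  by (intro conjI ballI weak_solD[OF assms(1)] eq_refl weak_sol_increment[OF assms])

text \<open>The slopes agree where \<open>v - u\<close> attains its minimum zero. If
  \<open>s < s'\<close>, then just to the right of that point the terms with \<open>q\<close> nearly
  cancel, and \<open>\<phi> (v') + F v\<close> falls behind \<open>\<phi> (u') + F u\<close> at a
  linear rate. The difference \<open>F v - F u\<close> is of smaller order, hence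
  \<open>v' < u'\<close> and \<open>v\<close> drops below \<open>u\<close>. The derivative of
  \<open>F\<close> is required only at values of \<open>u\<close> because the lemma is applied to a
  clipped primitive.\<close>

lemma touching_lower_sol:
  assumes w: "weak_sol F q s v v'" and l: "lower_sol F q s' u u'" and q: "continuous_on UNIV q"
    and le: "\<And>t. t \<in> {0..T} \<Longrightarrow> u t \<le> v t" and t0: "t0 \<in> {0..T}" "v t0 = u t0"
    and F: "\<And>t. t \<in> {0..T} \<Longrightarrow> (F has_real_derivative f (u t)) (at (u t))"
  shows "s' \<le> s"
proof (rule ccontr)
  assume "\<not> s' \<le> s"
  define \<delta> where "\<delta> = s' - s"
  have "\<delta> > 0" using \<open>\<not> s' \<le> s\<close> by (simp add: \<delta>_def)
  have u: "\<And>t. t \<in> {0..T} \<Longrightarrow> (u has_real_derivative u' t) (at t within {0..T})" "u 0 = u T" "u' 0 = u' T"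
    and u_inc: "\<And>t r. t \<in> {0..T} \<Longrightarrow> r \<in> {0..t} \<Longrightarrow>
        integral {r..t} (rhs q s' u) \<le> \<phi> (u' t) + F (u t) - (\<phi> (u' r) + F (u r))"
    using l unfolding lower_sol_def by blast+
  have uc: "continuous_on {0..T} u" by (rule DERIV_continuous_on[OF u(1)])
  note v = weak_solD[OF w]
  define d where "d t = v t - u t" for t
  have d_deriv: "(d has_real_derivative v' t - u' t) (at t within {0..T})" if "t \<in> {0..T}" for t
    unfolding d_def[abs_def] by (intro DERIV_diff v(1) u(1) that)
  have d_nonneg: "0 \<le> d t" if "t \<in> {0..T}" for t using le[OF that] by (simp add: d_def)
  have right: "0 \<le> v' t - u' t" if tt: "t \<in> {0..<T}" "d t = 0" for t
  proof (rule ccontr)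
    assume "\<not> 0 \<le> v' t - u' t"
    then obtain h0 where "h0 > 0" and h0: "\<And>h. h > 0 \<Longrightarrow> t + h \<in> {0..T} \<Longrightarrow> h < h0 \<Longrightarrow> d (t + h) < d t"
      using has_real_derivative_neg_dec_right[OF d_deriv[of t]] tt by fastforce
    define h where "h = min (h0/2) (T - t)"
    have "h > 0" "h < h0" "t + h \<in> {0..T}" using \<open>h0 > 0\<close> tt by (auto simp: h_def)
    then show False using h0[of h] d_nonneg[of "t + h"] tt(2) by simp
  qed
  have left: "v' t - u' t \<le> 0" if tt: "t \<in> {0<..T}" "d t = 0" for t
  proof (rule ccontr)
    assume "\<not> v' t - u' t \<le> 0"
    then obtain h0 where "h0 > 0" and h0: "\<And>h. h > 0 \<Longrightarrow> t - h \<in> {0..T} \<Longrightarrow> h < h0 \<Longrightarrow> d (t - h) < d t"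
      using has_real_derivative_pos_inc_left[OF d_deriv[of t]] tt by fastforce
    define h where "h = min (h0/2) t"
    have "h > 0" "h < h0" "t - h \<in> {0..T}" using \<open>h0 > 0\<close> tt by (auto simp: h_def)
    then show False using h0[of h] d_nonneg[of "t - h"] tt(2) by simp
  qed
  \<comment> \<open>By periodicity a touching point \<open>T\<close> may be replaced by
    \<open>0\<close>, which leaves room to the right. At \<open>0\<close> the left-hand comparison
    of slopes is made at \<open>T\<close>.\<close>
  define t1 where "t1 = (if t0 = T then 0 else t0)"
  have t1: "t1 \<in> {0..<T}" "d t1 = 0"
    using t0 T v(4) u(2) by (auto simp: t1_def d_def)
  have dT: "d T = 0" if "t1 = 0" using t1 that v(4) u(2) by (simp add: d_def)
  have "v' t1 - u' t1 \<le> 0"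
  proof (cases "t1 = 0")
    case True
    then show ?thesis using left[of T] dT T v(5) u(3) by simp
  next
    case False
    then show ?thesis using left[of t1] t1 by simp
  qed
  with right[OF t1] have slope: "v' t1 = u' t1" by simp
  have vu: "v t1 = u t1" using t1 by (simp add: d_def)
  have t1': "t1 \<in> {0..T}" using t1 by simp
  define \<epsilon> where "\<epsilon> = \<delta> / (2 * (A + 1))"
  have A0: "0 \<le> A" using a_bounds[of 0] T by auto
  have "\<epsilon> > 0" using \<open>\<delta> > 0\<close> A0 by (simp add: \<epsilon>_def)
  have A\<epsilon>: "A * \<epsilon> \<le> \<delta> / 2"
  proof -
    have "A * \<epsilon> \<le> (A + 1) * \<epsilon>" using \<open>\<epsilon> > 0\<close> by simp
    also have "\<dots> = \<delta> / 2" using A0 by (simp add: \<epsilon>_def divide_simps)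
    finally show ?thesis .
  qed
  have "continuous_on {0..T} (\<lambda>t. q (u t) - q (v t))"
    by (intro continuous_on_diff continuous_on_compose2[OF q] uc v(3)) auto
  then obtain r1 where "r1 > 0" and r1: "\<And>t. t \<in> {0..T} \<Longrightarrow> \<bar>t - t1\<bar> < r1 \<Longrightarrow> \<bar>q (u t) - q (v t)\<bar> < \<epsilon>"
    using t1' \<open>\<epsilon> > 0\<close> unfolding continuous_on_iff by (fastforce simp: dist_real_def vu)
  \<comment> \<open>Equal slopes make this difference vanish to first order at \<open>t1\<close>.
    The bound \<open>\<delta>/4\<close> per unit length stays below the gain
    \<open>\<delta>/2\<close> from the levels, the other half of \<delta> being reserved for the
    terms with \<open>q\<close>.\<close>
  have "((\<lambda>t. F (v t) - F (u t)) has_real_derivative f (u t1) * v' t1 - f (u t1) * u' t1) (at t1 within {0..T})"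
  proof (intro DERIV_diff)
    show "((\<lambda>t. F (u t)) has_real_derivative f (u t1) * u' t1) (at t1 within {0..T})"
      using DERIV_chain2[OF F[OF t1'] u(1)[OF t1']] .
    have "(F has_real_derivative f (u t1)) (at (v t1))" using F[OF t1'] by (simp add: vu)
    from DERIV_chain2[OF this v(1)[OF t1']]
    show "((\<lambda>t. F (v t)) has_real_derivative f (u t1) * v' t1) (at t1 within {0..T})" .
  qed
  then have "((\<lambda>t. F (v t) - F (u t)) has_derivative (*) 0) (at t1 within {0..T})"
    by (simp add: slope has_field_derivative_def)
  moreover have "\<delta>/4 > 0" using \<open>\<delta> > 0\<close> by simp
  ultimately obtain r2 where "r2 > 0" and r2': "\<forall>t\<in>{0..T}. norm (t - t1) < r2 \<longrightarrow>
      norm (F (v t) - F (u t) - (F (v t1) - F (u t1)) - 0 * (t - t1)) \<le> \<delta>/4 * norm (t - t1)"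
    unfolding has_derivative_within_alt by blast
  have r2: "\<bar>F (v t) - F (u t)\<bar> \<le> \<delta>/4 * \<bar>t - t1\<bar>" if "t \<in> {0..T}" "\<bar>t - t1\<bar> < r2" for t
    using r2' that by (auto simp: vu)
  define r where "r = min (min r1 r2) (T - t1) / 2"
  have "r > 0" using \<open>r1 > 0\<close> \<open>r2 > 0\<close> t1 by (simp add: r_def)
  have r_le: "r < r1" "r < r2" "t1 + r < T"
  proof -
    have "2 * r \<le> r1" "2 * r \<le> r2" "2 * r \<le> T - t1" by (simp_all add: r_def)
    then show "r < r1" "r < r2" "t1 + r < T" using \<open>r > 0\<close> by linarith+
  qed
  have neg: "v' t < u' t" if t: "t1 < t" "t < t1 + r" for t
  proof -
    have tT: "t \<in> {0..T}" "t1 \<in> {0..t}" using t t1 r_le by auto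
    have int: "rhs q s v integrable_on {t1..t}" "rhs q s' u integrable_on {t1..t}"
      using rhs_integrable_continuous(2)[OF v(3) q, of s] rhs_integrable_continuous(2)[OF uc q, of s'] tT t1
      by (auto simp: absolutely_integrable_on_def intro: integrable_on_subinterval)
    have "integral {t1..t} (rhs q s v) \<le> integral {t1..t} (\<lambda>r. rhs q s' u r + (- \<delta>/2))"
    proof (intro integral_le int integrable_add integrable_const_ivl)
      fix x assume x: "x \<in> {t1..t}"
      have xT: "x \<in> {0..T}" using x t t1 r_le by auto
      have "\<bar>q (u x) - q (v x)\<bar> \<le> \<epsilon>" using r1[OF xT] x t r_le by auto
      then have "a x * (q (u x) - q (v x)) \<le> a x * \<epsilon>"
        using a_bounds[OF xT] by (intro mult_left_mono) auto
      also have "\<dots> \<le> A * \<epsilon>"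
        using a_bounds[OF xT] \<open>\<epsilon> > 0\<close> by (intro mult_right_mono) auto
      also note A\<epsilon>
      finally show "rhs q s v x \<le> rhs q s' u x + (- \<delta>/2)"
        using \<delta>_def unfolding rhs_def right_diff_distrib by (simp add: field_simps)
    qed
    also have "\<dots> = integral {t1..t} (rhs q s' u) + (- \<delta>/2) * (t - t1)"
      using int(2) t by (subst integral_add) auto
    finally have "\<phi> (v' t) + F (v t) - (\<phi> (v' t1) + F (v t1))
        \<le> \<phi> (u' t) + F (u t) - (\<phi> (u' t1) + F (u t1)) + (- \<delta>/2) * (t - t1)"
      using u_inc[OF tT] weak_sol_increment[OF w q tT] by linarith
    then have "\<phi> (v' t) - \<phi> (u' t) \<le> (F (u t) - F (v t)) + (- \<delta>/2) * (t - t1)"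
      by (simp add: slope vu)
    moreover have "\<bar>F (v t) - F (u t)\<bar> \<le> \<delta>/4 * (t - t1)"
      using r2[OF tT(1)] t r_le by auto
    moreover have "\<delta>/4 * (t - t1) > 0" using \<open>\<delta> > 0\<close> t by simp
    moreover have "(- \<delta>/2) * (t - t1) = - 2 * (\<delta>/4 * (t - t1))" by simp
    ultimately have "\<phi> (v' t) < \<phi> (u' t)" by linarith
    then show ?thesis using \<phi>_mono by (simp add: strict_mono_less)
  qed
  have "d (t1 + r) < d t1"
  proof (rule DERIV_neg_imp_decreasing_open[where f = d and a = t1 and b = "t1 + r"])
    show "t1 < t1 + r" using \<open>r > 0\<close> by simp
    show "continuous_on {t1..t1 + r} d"
      by (rule continuous_on_subset[OF DERIV_continuous_on[OF d_deriv]]) (use t1 r_le in auto)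
    fix x assume x: "t1 < x" "x < t1 + r"
    then have "(d has_real_derivative v' x - u' x) (at x)"
      using d_deriv[of x] t1 r_le by (simp add: at_within_Icc_at)
    then show "\<exists>y. (d has_real_derivative y) (at x) \<and> y < 0" using neg[OF x] by force
  qed
  then show False using d_nonneg[of "t1 + r"] t1 r_le \<open>r > 0\<close> by simp
qed

text \<open>The sign \<eta> selects the side. For the clipped problem, \<open>\<gamma> = 0\<close>
  is excluded by the touching argument and \<open>\<gamma> = \<Gamma>\<close> by the mean value of
  \<open>a q(v)\<close>; hence the level is \<open>s\<close>, and the a priori bound removes the
  clipping.\<close>

lemma exists_sol_beside_lower_sol:
  assumes F: "\<And>x. (F has_real_derivative f x) (at x)" and q: "continuous_on UNIV q"
    and Q: "\<And>x. q x \<le> Q" "0 \<le> Q"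
    and l: "lower_sol F q s' u u'" and "s < s'"
    and \<eta>: "\<eta> = 1 \<or> \<eta> = - 1" and far: "\<And>x. X \<le> \<eta> * x \<Longrightarrow> q x \<le> k" and k: "k * integral {0..T} a < s * T"
  obtains v v' \<gamma> t0 where "weak_sol F q s v v'" "\<gamma> > 0"
    "\<And>t. t \<in> {0..T} \<Longrightarrow> u t + \<eta> * \<gamma> \<le> v t" "t0 \<in> {0..T}" "v t0 = u t0 + \<eta> * \<gamma>"
proof -
  have u_deriv: "\<And>t. t \<in> {0..T} \<Longrightarrow> (u has_real_derivative u' t) (at t within {0..T})"
    using l unfolding lower_sol_def by blast
  have uc: "continuous_on {0..T} u" by (rule DERIV_continuous_on[OF u_deriv])
  have F_cont: "continuous_on UNIV F" by (rule DERIV_continuous_on[OF F])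
  have "bounded (u ` {0..T})" by (intro compact_imp_bounded compact_continuous_image uc) auto
  then obtain U where "\<forall>x\<in>u ` {0..T}. norm x \<le> U" unfolding bounded_iff by blast
  then have U: "\<And>t. t \<in> {0..T} \<Longrightarrow> \<bar>u t\<bar> \<le> U" by simp
  \<comment> \<open>The bound is uniform over \<open>F\<close> and \<open>q\<close>. It therefore
    applies to the clipped problem, although the clipping height \<open>M\<close> is chosen from
    it.\<close>
  obtain R where "R \<ge> 0" and R: "\<And>F q \<sigma> v v' t t'. weak_sol F q \<sigma> v v' \<Longrightarrow> continuous_on UNIV F \<Longrightarrow> continuous_on UNIV q \<Longrightarrow>
       (\<And>x. q x \<le> Q) \<Longrightarrow> 0 \<le> Q \<Longrightarrow> s \<le> \<sigma> \<Longrightarrow> t \<in> {0..T} \<Longrightarrow> t' \<in> {0..T} \<Longrightarrow> \<bar>v t - v t'\<bar> \<le> R"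
    using oscillation_bound[of Q s] by blast
  \<comment> \<open>If \<open>v\<close> meets \<open>u + \<eta> * \<Gamma>\<close> at one point, the
    allowances \<open>U\<close> for \<open>u\<close> and \<open>R\<close> for the oscillation keep
    all of \<open>v\<close> in the region where \<open>q\<close> is at most
    \<open>k\<close>.\<close>
  define \<Gamma> where "\<Gamma> = \<bar>X\<bar> + U + R + 1"
  have "U \<ge> 0" using U[of 0] T by auto
  have "\<Gamma> > 0" using \<open>U \<ge> 0\<close> \<open>R \<ge> 0\<close> by (simp add: \<Gamma>_def)
  \<comment> \<open>Exceeds \<open>U + \<Gamma> + R\<close>, the bound for the solution to be found,
    so clipping will not affect it. Also \<open>U < M\<close>, so clipping is the identity near
    every value of \<open>u\<close>.\<close>
  define M where "M = U + \<Gamma> + R + 1"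
  have "M > 0" "U < M" using \<open>U \<ge> 0\<close> \<open>R \<ge> 0\<close> \<open>\<Gamma> > 0\<close> by (auto simp: M_def)
  define clip where "clip x = max (- M) (min M x)" for x
  have clip_in: "clip x \<in> {- M..M}" for x using \<open>M > 0\<close> by (simp add: clip_def)
  have clip_id: "clip x = x" if "\<bar>x\<bar> \<le> M" for x using that by (simp add: clip_def)
  have clip_uc: "uniformly_continuous_on UNIV (\<lambda>x. G (clip x))" if "continuous_on UNIV G" for G :: "real \<Rightarrow> real"
  proof -
    have G: "uniformly_continuous_on {- M..M} G"
      by (intro compact_uniformly_continuous continuous_on_subset[OF that]) auto
    show ?thesis
      unfolding uniformly_continuous_on_def
    proof (intro allI impI)
      fix e :: real assume "e > 0"
      then obtain d where "d > 0" and d: "\<And>x y. x \<in> {- M..M} \<Longrightarrow> y \<in> {- M..M} \<Longrightarrow> dist y x < d \<Longrightarrow> dist (G y) (G x) < e"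
        using G unfolding uniformly_continuous_on_def by metis
      have "dist (G (clip y)) (G (clip x)) < e" if "dist y x < d" for x y
      proof (rule d[OF clip_in clip_in])
        show "dist (clip y) (clip x) < d"
          using that unfolding clip_def dist_real_def by linarith
      qed
      then show "\<exists>d>0. \<forall>x\<in>UNIV. \<forall>y\<in>UNIV. dist y x < d \<longrightarrow> dist (G (clip y)) (G (clip x)) < e"
        using \<open>d > 0\<close> by blast
    qed
  qed
  have clip_bounded: "\<exists>b. \<forall>x. \<bar>G (clip x)\<bar> \<le> b" if "continuous_on UNIV G" for G :: "real \<Rightarrow> real"
  proof -
    have "bounded (G ` {- M..M})"
      by (intro compact_imp_bounded compact_continuous_image continuous_on_subset[OF that]) auto
    then obtain b where "\<forall>y\<in>G ` {- M..M}. norm y \<le> b" unfolding bounded_iff by blast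
    then show ?thesis using clip_in by (intro exI[of _ b]) auto
  qed
  obtain b1 where b1: "\<And>x. \<bar>F (clip x)\<bar> \<le> b1" using clip_bounded[OF F_cont] by blast
  obtain b2 where b2: "\<And>x. \<bar>q (clip x)\<bar> \<le> b2" using clip_bounded[OF q] by blast
  interpret trunc: truncated_problem T \<phi> \<psi> a e A "\<lambda>x. F (clip x)" "\<lambda>x. q (clip x)" "max b1 b2"
  proof unfold_locales
    show "\<bar>F (clip x)\<bar> \<le> max b1 b2" "\<bar>q (clip x)\<bar> \<le> max b1 b2" for x
      using b1[of x] b2[of x] by simp_all
  qed (rule clip_uc[OF F_cont] clip_uc[OF q])+
  have "0 \<le> \<Gamma>" "\<bar>\<eta>\<bar> = 1" using \<open>\<Gamma> > 0\<close> \<eta> by auto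
  obtain v v' \<sigma> \<gamma> t0 where v: "weak_sol (\<lambda>x. F (clip x)) (\<lambda>x. q (clip x)) \<sigma> v v'"
    and \<gamma>: "\<gamma> = max 0 (min \<Gamma> (\<gamma> + \<sigma> - s))"
    and v_ge: "\<And>t. t \<in> {0..T} \<Longrightarrow> u t + \<eta> * \<gamma> \<le> v t" and t0: "t0 \<in> {0..T}" "v t0 = u t0 + \<eta> * \<gamma>"
    by (rule trunc.fixed_point[OF uc \<open>0 \<le> \<Gamma>\<close> \<open>\<bar>\<eta>\<bar> = 1\<close>, where s = s]) (blast intro: that)
  have qc: "continuous_on UNIV (\<lambda>x. q (clip x))" "continuous_on UNIV (\<lambda>x. F (clip x))"
    using trunc.q_cont trunc.F_cont .
  have u_id: "clip (u t) = u t" if "t \<in> {0..T}" for t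
    using U[OF that] \<open>U < M\<close> by (intro clip_id) simp
  have l': "lower_sol (\<lambda>x. F (clip x)) (\<lambda>x. q (clip x)) s' u u'"
  proof -
    have "integral {r..t} (rhs (\<lambda>x. q (clip x)) s' u) = integral {r..t} (rhs q s' u)"
      if "t \<in> {0..T}" "r \<in> {0..t}" for r t
      using that by (intro integral_cong) (simp add: rhs_def u_id)
    then show ?thesis
      using l unfolding lower_sol_def by (auto simp: u_id)
  qed
  have F_loc: "((\<lambda>x. F (clip x)) has_real_derivative f (u t)) (at (u t))" if "t \<in> {0..T}" for t
  proof (rule has_field_derivative_transform_within[OF F])
    show "0 < M - U" using \<open>U < M\<close> by simp
    fix x assume "dist x (u t) < M - U"
    then have "\<bar>x\<bar> \<le> M" using U[OF that] by (simp add: dist_real_def)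
    then show "F x = F (clip x)" by (simp add: clip_id)
  qed simp
  \<comment> \<open>The relation \<open>\<gamma>\<close> gives \<open>\<sigma> \<le> s\<close> at 0,
    \<open>\<sigma> \<ge> s\<close> for positive \<gamma>, and equality strictly between the
    ends.\<close>
  have "\<gamma> \<ge> 0" "\<gamma> \<le> \<Gamma>" using \<gamma> \<open>\<Gamma> > 0\<close> by linarith+
  have "\<gamma> \<noteq> 0"
  proof
    assume "\<gamma> = 0"
    then have "\<sigma> \<le> s" using \<gamma> \<open>\<Gamma> > 0\<close> by linarith
    moreover have "s' \<le> \<sigma>"
      using v_ge t0 \<open>\<gamma> = 0\<close> by (intro touching_lower_sol[OF v l' qc(1) _ t0(1) _ F_loc]) auto
    ultimately show False using \<open>s < s'\<close> by simp
  qed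
  then have "\<gamma> > 0" using \<open>\<gamma> \<ge> 0\<close> by simp
  \<comment> \<open>With \<gamma> positive the level is at least \<open>s\<close>, as the choice of
    \<open>R\<close> demands.\<close>
  have "s \<le> \<sigma>" using \<gamma> \<open>\<gamma> > 0\<close> \<open>\<gamma> \<le> \<Gamma>\<close> by linarith
  have osc: "\<bar>v t - v t0\<bar> \<le> R" if "t \<in> {0..T}" for t
    using Q \<open>s \<le> \<sigma>\<close> by (intro R[OF v qc(2,1) _ _ _ that t0(1)]) auto
  have \<eta>\<gamma>: "\<bar>\<eta> * \<gamma>\<bar> \<le> \<Gamma>" using \<eta> \<open>\<gamma> \<ge> 0\<close> \<open>\<gamma> \<le> \<Gamma>\<close> by auto
  have v_id: "clip (v t) = v t" if "t \<in> {0..T}" for t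
  proof (rule clip_id)
    show "\<bar>v t\<bar> \<le> M"
      using osc[OF that] t0(2) U[OF t0(1)] \<eta>\<gamma> unfolding M_def by linarith
  qed
  have "\<gamma> \<noteq> \<Gamma>"
  proof
    assume "\<gamma> = \<Gamma>"
    have qk: "q (v t) \<le> k" if "t \<in> {0..T}" for t
    proof (rule far)
      show "X \<le> \<eta> * v t"
        using osc[OF that] t0(2) U[OF t0(1)] \<open>\<gamma> = \<Gamma>\<close> \<eta> unfolding \<Gamma>_def
        by (auto simp: abs_le_iff)
    qed
    have "integral {0..T} (\<lambda>t. a t * q (clip (v t))) \<le> integral {0..T} (\<lambda>t. a t * k)"
    proof (rule integral_le)
      show "(\<lambda>t. a t * q (clip (v t))) integrable_on {0..T}"
        using rhs_integrable_continuous(1)[OF weak_solD(3)[OF v] qc(1)] by (simp add: absolutely_integrable_on_def)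
      show "(\<lambda>t. a t * k) integrable_on {0..T}"
        using integrable_a_mult[of "\<lambda>_. k" "\<bar>k\<bar>"] by (simp add: absolutely_integrable_on_def)
      fix t assume "t \<in> {0..T}"
      then show "a t * q (clip (v t)) \<le> a t * k"
        using a_bounds qk by (simp add: v_id mult_left_mono)
    qed
    then have "\<sigma> * T \<le> k * integral {0..T} a"
      using weak_sol_mean[OF v qc(1)] by (simp add: mult.commute)
    moreover have "s * T \<le> \<sigma> * T" using \<open>s \<le> \<sigma>\<close> T by simp
    ultimately show False using k by linarith
  qed
  then have "\<sigma> = s" using \<gamma> \<open>\<gamma> > 0\<close> \<open>\<gamma> \<le> \<Gamma>\<close> by linarith
  have "weak_sol F q s v v'"
  proof -
    have "integral {0..t} (rhs (\<lambda>x. q (clip x)) s v) = integral {0..t} (rhs q s v)" if "t \<in> {0..T}" for t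
      using that by (intro integral_cong) (simp add: rhs_def v_id)
    note int = this
    note v' = weak_solD[OF v[unfolded \<open>\<sigma> = s\<close>]]
    show ?thesis
      unfolding weak_sol_def
    proof (intro conjI ballI v')
      fix t assume t: "t \<in> {0..T}"
      show "\<phi> (v' t) + F (v t) = \<phi> (v' 0) + F (v 0) + integral {0..t} (rhs q s v)"
        using v'(6)[OF t] int[OF t] v_id[OF t] v_id[of 0] T by simp
    qed
  qed
  then show thesis using that \<open>\<gamma> > 0\<close> v_ge t0 by blast
qed

text \<open>Periodicity gives a zero of \<open>u'\<close>, where \<open>\<phi> (u') + F u\<close>
  reduces to \<open>F u\<close> and is bounded by \<open>B\<close>. The integral of the right-hand
  side, at most \<open>I\<close>, carries this bound to every point; one more passage and the
  removal of \<open>F u\<close> give \<open>c = 2 * (B + I)\<close> for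
  \<open>\<phi> (u')\<close>.\<close>

lemma weak_sol_slope_bound:
  assumes F: "continuous_on UNIV F" and q: "continuous_on UNIV q" and Q: "\<And>x. q x \<le> Q" "0 \<le> Q"
    and B: "\<And>x. \<bar>x\<bar> \<le> M \<Longrightarrow> \<bar>F x\<bar> \<le> B"
  shows "\<exists>K. \<forall>s u u'. weak_sol F q s u u' \<longrightarrow> S \<le> s \<longrightarrow> (\<forall>t\<in>{0..T}. \<bar>u t\<bar> \<le> M) \<longrightarrow>
      \<bar>\<phi> (u' 0) + F (u 0)\<bar> \<le> K \<and> (\<forall>t\<in>{0..T}. \<bar>u' t\<bar> \<le> K)"
proof -
  define I where "I = integral {0..T} (\<lambda>t. \<bar>e t\<bar>) + 2 * Q * integral {0..T} a + 2 * \<bar>S\<bar> * T"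
  define c where "c = 2 * (B + I)"
  define K where "K = max (B + I) (max (\<psi> c) (- \<psi> (- c)))"
  have main: "\<bar>\<phi> (u' 0) + F (u 0)\<bar> \<le> K \<and> (\<forall>t\<in>{0..T}. \<bar>u' t\<bar> \<le> K)"
    if w: "weak_sol F q s u u'" and "S \<le> s" and M: "\<And>t. t \<in> {0..T} \<Longrightarrow> \<bar>u t\<bar> \<le> M" for s u u'
  proof -
    note u = weak_solD[OF w]
    have rhs_int: "rhs q s u absolutely_integrable_on {0..T}"
      using rhs_integrable_continuous(2)[OF u(3) q] .
    have rhs_abs: "(\<lambda>t. \<bar>rhs q s u t\<bar>) integrable_on {0..T}"
      using absolutely_integrable_norm[OF rhs_int] by (simp add: o_def absolutely_integrable_on_def)
    have le: "\<bar>integral {0..t} (rhs q s u)\<bar> \<le> I" if t: "t \<in> {0..T}" for t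
    proof -
      have sub: "{0..t} \<subseteq> {0..T}" using t by auto
      have "norm (integral {0..t} (rhs q s u)) \<le> integral {0..t} (\<lambda>t. \<bar>rhs q s u t\<bar>)"
        using rhs_int rhs_abs sub
        by (intro integral_norm_bound_integral) (auto intro: integrable_on_subinterval simp: absolutely_integrable_on_def)
      also have "\<dots> \<le> integral {0..T} (\<lambda>t. \<bar>rhs q s u t\<bar>)"
        using rhs_abs sub by (intro integral_subset_le) (auto intro: integrable_on_subinterval)
      also have "\<dots> \<le> I"
        unfolding I_def by (rule rhs_L1_bound[OF w q Q \<open>S \<le> s\<close>])
      finally show ?thesis by simp
    qed
    obtain z where z: "z \<in> {0<..<T}" "u T - u 0 = u' z * (T - 0)"
      using mvt_simple[OF T, of u "\<lambda>x h. u' x * h"] u(1) by (auto simp: has_field_derivative_def)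
    then have "u' z = 0" using u(4) T by simp
    have zT: "z \<in> {0..T}" using z by simp
    have y0: "\<bar>\<phi> (u' 0) + F (u 0)\<bar> \<le> B + I"
      using u(6)[OF zT] le[OF zT] B[OF M[OF zT]] \<open>u' z = 0\<close> \<phi>0 by simp
    have "\<bar>u' t\<bar> \<le> max (\<psi> c) (- \<psi> (- c))" if t: "t \<in> {0..T}" for t
    proof -
      note bnds = u(6)[OF t] le[OF t] B[OF M[OF t]] y0
      have "\<phi> (u' t) \<le> c" "- c \<le> \<phi> (u' t)"
        using bnds unfolding c_def abs_le_iff by simp_all
      then have "\<psi> (\<phi> (u' t)) \<le> \<psi> c" "\<psi> (- c) \<le> \<psi> (\<phi> (u' t))"
        by (simp_all add: \<psi>_le_iff)
      then show ?thesis unfolding \<psi>\<phi> by linarith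
    qed
    then show ?thesis using y0 unfolding K_def by (simp add: le_max_iff_disj)
  qed
  show ?thesis
    by (rule exI[of _ K], intro allI impI main) auto
qed

text \<open>Uniform convergence is extracted only for the functions \<open>u n\<close>, and then
  convergence of the constants \<open>C n\<close> along a further subsequence. The derivatives
  follow, since the integrated equation expresses \<open>u' n\<close> through \<psi>,
  \<open>C n\<close> and \<open>u n\<close>; dominated convergence passes to the limit in the
  integrals.\<close>

lemma weak_sol_compactness:
  assumes F: "continuous_on UNIV F" and q: "continuous_on UNIV q" and Q: "\<And>x. q x \<le> Q" "0 \<le> Q"
    and w: "\<And>n. weak_sol F q (s n) (u n) (u' n)" and S: "\<And>n. S \<le> s n" and lim: "s \<longlonglongrightarrow> s0"
    and M: "\<And>n t. t \<in> {0..T} \<Longrightarrow> \<bar>u n t\<bar> \<le> M"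
  shows "\<exists>v v'. weak_sol F q s0 v v'"
proof -
  have "bounded (F ` {- M..M})"
    by (intro compact_imp_bounded compact_continuous_image continuous_on_subset[OF F]) auto
  then obtain B where "\<forall>y\<in>F ` {- M..M}. norm y \<le> B" unfolding bounded_iff by blast
  then have B: "\<bar>F x\<bar> \<le> B" if "\<bar>x\<bar> \<le> M" for x using that by (auto simp: abs_le_iff)
  obtain K where K': "\<forall>s u u'. weak_sol F q s u u' \<longrightarrow> S \<le> s \<longrightarrow> (\<forall>t\<in>{0..T}. \<bar>u t\<bar> \<le> M) \<longrightarrow>
      \<bar>\<phi> (u' 0) + F (u 0)\<bar> \<le> K \<and> (\<forall>t\<in>{0..T}. \<bar>u' t\<bar> \<le> K)"
    using weak_sol_slope_bound[OF F q Q B, where S = S] by blast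
  have K: "\<bar>\<phi> (u' n 0) + F (u n 0)\<bar> \<le> K" "\<And>t. t \<in> {0..T} \<Longrightarrow> \<bar>u' n t\<bar> \<le> K" for n
    using K'[rule_format, OF w S M] by blast+
  note u = weak_solD[OF w]
  have u'_le: "\<bar>u' n t\<bar> \<le> K" if "t \<in> {0..T}" for n t using K(2) that by blast
  have K0: "0 \<le> K" using u'_le[of 0] T by (auto intro: order_trans[OF abs_ge_zero])
  have lip: "\<bar>u n t - u n r\<bar> \<le> K * \<bar>t - r\<bar>" if "t \<in> {0..T}" "r \<in> {0..T}" for n t r
  proof -
    have "norm (u n t - u n r) \<le> K * norm (t - r)"
      using u'_le that by (intro field_differentiable_bound[of "{0..T}" "u n" "u' n"] u(1)) auto
    then show ?thesis by simp
  qed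
  obtain v k where v: "continuous_on {0..T} v" and k: "strict_mono (k::nat \<Rightarrow> nat)"
    and conv: "\<And>e. 0 < e \<Longrightarrow> \<exists>N. \<forall>n x. n \<ge> N \<and> x \<in> {0..T} \<longrightarrow> norm (u (k n) x - v x) < e"
  proof (rule Arzela_Ascoli[of "{0..T}" u M])
    fix x d :: real assume x: "x \<in> {0..T}" and "0 < d"
    show "\<exists>c>0. \<forall>n y. y \<in> {0..T} \<and> norm (x - y) < c \<longrightarrow> norm (u n x - u n y) < d"
    proof (intro exI[of _ "d / (K + 1)"] conjI allI impI; (elim conjE)?)
      fix n y assume y: "y \<in> {0..T}" "norm (x - y) < d / (K + 1)"
      then have "(K + 1) * \<bar>x - y\<bar> < d" using K0 by (simp add: field_simps)
      moreover have "K * \<bar>x - y\<bar> \<le> (K + 1) * \<bar>x - y\<bar>" by (intro mult_right_mono) auto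
      ultimately show "norm (u n x - u n y) < d" using lip[OF x y(1), of n] by simp
    qed (use K0 \<open>0 < d\<close> in auto)
  qed (use M in auto)
  define C where "C n = \<phi> (u' n 0) + F (u n 0)" for n
  have "bounded (range (C \<circ> k))"
    unfolding bounded_iff C_def using K(1) by (intro exI[of _ K]) auto
  then obtain c r where r: "strict_mono (r::nat \<Rightarrow> nat)" and c: "((C \<circ> k) \<circ> r) \<longlonglongrightarrow> c"
    using bounded_imp_convergent_subsequence by blast
  define j where "j = k \<circ> r"
  have j: "strict_mono j" unfolding j_def using k r by (rule strict_mono_o)
  have C_lim: "(\<lambda>n. C (j n)) \<longlonglongrightarrow> c" using c by (simp add: j_def o_def)
  have s_lim: "(\<lambda>n. s (j n)) \<longlonglongrightarrow> s0" using LIMSEQ_subseq_LIMSEQ[OF lim j] by (simp add: o_def)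
  have u_lim: "(\<lambda>n. u (j n) t) \<longlonglongrightarrow> v t" if "t \<in> {0..T}" for t
  proof -
    have "(\<lambda>n. u (k n) t) \<longlonglongrightarrow> v t"
      unfolding LIMSEQ_iff using conv that by blast
    from LIMSEQ_subseq_LIMSEQ[OF this r] show ?thesis by (simp add: j_def o_def)
  qed
  have "bounded (q ` {- M..M})"
    by (intro compact_imp_bounded compact_continuous_image continuous_on_subset[OF q]) auto
  then obtain b where "\<forall>y\<in>q ` {- M..M}. norm y \<le> b" unfolding bounded_iff by blast
  then have b: "\<bar>q x\<bar> \<le> b" if "\<bar>x\<bar> \<le> M" for x using that by (auto simp: abs_le_iff)
  have "Bseq s" using lim by (intro convergent_imp_Bseq) (auto simp: convergent_def)
  then obtain s1 where s1: "\<And>n. \<bar>s n\<bar> \<le> s1" unfolding Bseq_def by auto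
  have e': "(\<lambda>t. \<bar>e t\<bar>) integrable_on {0..T}"
    using absolutely_integrable_norm[OF e_int] by (simp add: o_def absolutely_integrable_on_def)
  have dom: "(\<lambda>t. s1 + A * b + \<bar>e t\<bar>) integrable_on {0..T}"
    by (intro integrable_add e' integrable_const_ivl)
  have isC: "isCont G x" if "continuous_on UNIV G" for G :: "real \<Rightarrow> real" and x
    using that by (simp add: continuous_on_eq_continuous_at)
  have I_lim: "(\<lambda>n. integral {0..t} (rhs q (s (j n)) (u (j n)))) \<longlonglongrightarrow> integral {0..t} (rhs q s0 v)" if t: "t \<in> {0..T}" for t
  proof (rule dominated_convergence)
    have sub: "{0..t} \<subseteq> {0..T}" using t by auto
    show "(\<lambda>t. s1 + A * b + \<bar>e t\<bar>) integrable_on {0..t}" by (rule integrable_on_subinterval[OF dom sub])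
    show "rhs q (s (j n)) (u (j n)) integrable_on {0..t}" for n
    proof (rule integrable_on_subinterval[OF _ sub])
      show "rhs q (s (j n)) (u (j n)) integrable_on {0..T}"
        using rhs_integrable_continuous(2)[OF u(3)[of "j n"] q, of "s (j n)"] by (simp add: absolutely_integrable_on_def)
    qed
    fix x assume "x \<in> {0..t}"
    then have x: "x \<in> {0..T}" using sub by blast
    show "norm (rhs q (s (j n)) (u (j n)) x) \<le> s1 + A * b + \<bar>e x\<bar>" for n
    proof -
      have "\<bar>a x * q (u (j n) x)\<bar> \<le> A * b"
        using a_bounds[OF x] b[OF M[OF x]] by (auto simp: abs_mult intro!: mult_mono)
      then show ?thesis using s1[of "j n"] unfolding rhs_def real_norm_def by linarith
    qed
    show "(\<lambda>n. rhs q (s (j n)) (u (j n)) x) \<longlonglongrightarrow> rhs q s0 v x"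
      unfolding rhs_def
      by (intro tendsto_intros s_lim isCont_tendsto_compose[OF isC[OF q]] u_lim x)
  qed
  define v' where "v' t = \<psi> (c + integral {0..t} (rhs q s0 v) - F (v t))" for t
  have u'_eq: "u' n t = \<psi> (C n + integral {0..t} (rhs q (s n) (u n)) - F (u n t))" if "t \<in> {0..T}" for n t
  proof -
    have "\<phi> (u' n t) = C n + integral {0..t} (rhs q (s n) (u n)) - F (u n t)"
      using u(6)[OF that, of n] by (simp add: C_def)
    then show ?thesis using \<psi>\<phi> by metis
  qed
  have u'_lim: "(\<lambda>n. u' (j n) t) \<longlonglongrightarrow> v' t" if t: "t \<in> {0..T}" for t
    unfolding u'_eq[OF t] v'_def
    by (intro isCont_tendsto_compose[OF isC[OF \<psi>_cont]] tendsto_intros C_lim I_lim t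
        isCont_tendsto_compose[OF isC[OF F]] u_lim)
  have v'_cont: "continuous_on {0..T} v'"
  proof -
    have "continuous_on {0..T} (\<lambda>t. integral {0..t} (rhs q s0 v))"
      using rhs_integrable_continuous(2)[OF v q, of s0]
      by (intro indefinite_integral_continuous_1) (simp add: absolutely_integrable_on_def)
    then show ?thesis
      unfolding v'_def[abs_def]
      by (intro continuous_on_compose2[OF \<psi>_cont] continuous_intros continuous_on_compose2[OF F v]) auto
  qed
  have v_eq: "v t = v 0 + integral {0..t} v'" if t: "t \<in> {0..T}" for t
  proof -
    have sub: "{0..t} \<subseteq> {0..T}" using t by auto
    have ftc: "(u' n has_integral u n t - u n 0) {0..t}" for n
    proof (rule fundamental_theorem_of_calculus)
      fix x assume "x \<in> {0..t}"
      then have "(u n has_real_derivative u' n x) (at x within {0..t})"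
        using DERIV_subset[OF u(1) sub] sub by blast
      then show "(u n has_vector_derivative u' n x) (at x within {0..t})"
        by (simp only: has_real_derivative_iff_has_vector_derivative)
    qed (use t in auto)
    have "(\<lambda>n. integral {0..t} (u' (j n))) \<longlonglongrightarrow> integral {0..t} v'"
    proof (rule dominated_convergence)
      show "(\<lambda>t. K) integrable_on {0..t}" by (rule integrable_const_ivl)
      show "u' (j n) integrable_on {0..t}" for n using ftc by blast
      fix x assume "x \<in> {0..t}"
      then have x: "x \<in> {0..T}" using sub by blast
      show "norm (u' (j n) x) \<le> K" for n using u'_le[OF x] by simp
      show "(\<lambda>n. u' (j n) x) \<longlonglongrightarrow> v' x" by (rule u'_lim[OF x])
    qed
    moreover have "(\<lambda>n. integral {0..t} (u' (j n))) \<longlonglongrightarrow> v t - v 0"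
      unfolding integral_unique[OF ftc] using T t by (intro tendsto_diff u_lim) auto
    ultimately have "v t - v 0 = integral {0..t} v'" by (rule LIMSEQ_unique[rotated])
    then show ?thesis by simp
  qed
  have eq0T: "x = y" if "f \<longlonglongrightarrow> x" "g \<longlonglongrightarrow> y" "\<And>n. f n = g n" for f g :: "nat \<Rightarrow> real" and x y
  proof -
    have "f = g" using that(3) by (rule ext)
    then show ?thesis using that(1,2) LIMSEQ_unique by blast
  qed
  have ends: "0 \<in> {0..T}" "T \<in> {0..T}" using T by auto
  have "weak_sol F q s0 v v'"
    unfolding weak_sol_def
  proof (intro conjI ballI v'_cont)
    show "v 0 = v T" by (rule eq0T[OF u_lim[OF ends(1)] u_lim[OF ends(2)]]) (rule u(4))
    show "v' 0 = v' T" by (rule eq0T[OF u'_lim[OF ends(1)] u'_lim[OF ends(2)]]) (rule u(5))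
    fix t assume t: "t \<in> {0..T}"
    have "((\<lambda>t. v 0 + integral {0..t} v') has_real_derivative 0 + v' t) (at t within {0..T})"
      by (intro DERIV_add DERIV_const integral_has_real_derivative[OF v'_cont t])
    then show "(v has_real_derivative v' t) (at t within {0..T})"
      unfolding add_0_left
      by (rule has_field_derivative_transform_within[OF _ zero_less_one t]) (rule v_eq[symmetric])
    show "\<phi> (v' t) + F (v t) = \<phi> (v' 0) + F (v 0) + integral {0..t} (rhs q s0 v)"
      unfolding v'_def \<phi>\<psi> by simp
  qed
  then show ?thesis by blast
qed

text \<open>Below the supremum \<open>s0\<close> of the solvable levels there is always a solvable
  level \<open>s' > s\<close>, and its solution is a lower solution that serves \<open>s\<close>.
  The constant \<open>u0\<close> makes the set of levels nonempty and places \<open>s0\<close> above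
  the critical means. The two solutions differ because one lies below the lower solution somewhere
  and the other above it everywhere.\<close>

lemma multiplicity:
  assumes F: "\<And>x. (F has_real_derivative f x) (at x)" and q: "continuous_on UNIV q"
    and a_pos: "integral {0..T} a > 0"
    and lim_p: "((\<lambda>u. ereal (q u)) \<longlongrightarrow> \<omega>p) at_top" and lim_m: "((\<lambda>u. ereal (q u)) \<longlongrightarrow> \<omega>m) at_bot"
    and u0: "max \<omega>p \<omega>m < ereal (q u0)"
    and abar: "abar = integral {0..T} a / T"
    and s1: "ereal abar * max \<omega>m \<omega>p < ereal s1"
    and low: "\<And>t. t \<in> {0..T} \<Longrightarrow> s1 + e t - a t * q u0 \<le> 0"
  shows "\<exists>s0. ereal abar * \<omega>m < ereal s0 \<and>
     (\<forall>s>s0. \<nexists>u u'. weak_sol F q s u u') \<and> (\<exists>u u'. weak_sol F q s0 u u') \<and>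
     (\<forall>s. ereal abar * \<omega>m < ereal s \<and> s < s0 \<longrightarrow> (\<exists>u u'. weak_sol F q s u u')) \<and>
     (\<forall>s. ereal abar * max \<omega>m \<omega>p < ereal s \<and> s < s0 \<longrightarrow>
        (\<exists>u u' w w'. weak_sol F q s u u' \<and> weak_sol F q s w w' \<and> (\<exists>t\<in>{0..T}. u t \<noteq> w t)))"
proof -
  have F_cont: "continuous_on UNIV F" by (rule DERIV_continuous_on[OF F])
  have abar_pos: "abar > 0" using a_pos T by (simp add: abar)
  \<comment> \<open>A real threshold \<open>k\<close> stands in for the limit \<omega>, which may be
    \<open>-\<infinity>\<close>.\<close>
  have level: "\<exists>k. \<omega> < ereal k \<and> k * integral {0..T} a < s * T" if "ereal abar * \<omega> < ereal s" for \<omega> s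
  proof -
    have "\<omega> < ereal (s / abar)"
      using that abar_pos by (cases \<omega>) (auto simp: field_simps)
    then obtain k where k: "\<omega> < ereal k" "ereal k < ereal (s / abar)" using ereal_dense2 by blast
    then have "k * abar < s" using abar_pos by (simp add: field_simps)
    then have "k * abar * T < s * T" using T by simp
    then show ?thesis using k T by (auto simp: abar)
  qed
  have far_p: "\<exists>X. \<forall>x\<ge>X. q x \<le> k" if "\<omega>p < ereal k" for k
    using order_tendstoD(2)[OF lim_p that] by (force simp: eventually_at_top_linorder)
  have far_m: "\<exists>X. \<forall>x. X \<le> - x \<longrightarrow> q x \<le> k" if km: "\<omega>m < ereal k" for k
  proof -
    obtain N where "\<And>x. x \<le> N \<Longrightarrow> ereal (q x) < ereal k"
      using order_tendstoD(2)[OF lim_m km] by (auto simp: eventually_at_bot_linorder)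
    then show ?thesis by (intro exI[of _ "- N"]) force
  qed
  obtain Q where Q: "\<And>x. q x \<le> Q" "0 \<le> Q"
  proof -
    obtain X where X: "\<forall>x\<ge>X. q x \<le> q u0" using far_p[of "q u0"] u0 by auto
    obtain Y where Y: "\<forall>x. Y \<le> - x \<longrightarrow> q x \<le> q u0" using far_m[of "q u0"] u0 by auto
    have "bounded (q ` {- Y..X})"
      by (intro compact_imp_bounded compact_continuous_image continuous_on_subset[OF q]) auto
    then obtain b where "\<forall>y\<in>q ` {- Y..X}. norm y \<le> b" unfolding bounded_iff by blast
    then have b: "q x \<le> b" if "- Y \<le> x" "x \<le> X" for x using that by (auto simp: abs_le_iff)
    show ?thesis
    proof (rule that[of "max 0 (max b (q u0))"])
      fix x
      consider "X \<le> x" | "Y \<le> - x" | "- Y \<le> x" "x \<le> X" by linarith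
      then show "q x \<le> max 0 (max b (q u0))"
        using X Y b by cases (auto simp: le_max_iff_disj)
    qed simp
  qed
  define S where "S = {s. \<exists>u u'. weak_sol F q s u u'}"
  have S_bound: "s \<le> Q * abar" if s: "s \<in> S" for s
  proof -
    obtain u u' where w: "weak_sol F q s u u'" using s by (auto simp: S_def)
    have "s * T = integral {0..T} (\<lambda>t. a t * q (u t))" using weak_sol_mean[OF w q] by simp
    also have "\<dots> \<le> integral {0..T} (\<lambda>t. a t * Q)"
    proof (rule integral_le)
      show "(\<lambda>t. a t * q (u t)) integrable_on {0..T}"
        using rhs_integrable_continuous(1)[OF weak_solD(3)[OF w] q] by (simp add: absolutely_integrable_on_def)
      show "(\<lambda>t. a t * Q) integrable_on {0..T}"
        using integrable_a_mult[of "\<lambda>_. Q" "\<bar>Q\<bar>"] by (simp add: absolutely_integrable_on_def)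
      show "a t * q (u t) \<le> a t * Q" if "t \<in> {0..T}" for t
        using a_bounds[OF that] Q(1)[of "u t"] by (intro mult_left_mono) auto
    qed
    also have "\<dots> = integral {0..T} a * Q" by simp
    finally show ?thesis using T by (simp add: abar field_simps)
  qed
  have bdd: "bdd_above S" by (rule bdd_aboveI[OF S_bound])
  have left: "\<exists>v v' t0. weak_sol F q s v v' \<and> t0 \<in> {0..T} \<and> v t0 < u t0"
    if l: "lower_sol F q s' u u'" "s < s'" "ereal abar * \<omega>m < ereal s" for s s' u u'
  proof -
    obtain k where k: "\<omega>m < ereal k" "k * integral {0..T} a < s * T" using level[OF l(3)] by blast
    obtain X where X: "\<forall>x. X \<le> - x \<longrightarrow> q x \<le> k" using far_m[OF k(1)] by blast
    show ?thesis
    proof (rule exists_sol_beside_lower_sol[OF F q Q l(1,2), of "- 1" X k])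
      fix v v' \<gamma> t0 assume "weak_sol F q s v v'" "\<gamma> > 0" "t0 \<in> {0..T}" "v t0 = u t0 + - 1 * \<gamma>"
      then show ?thesis by (intro exI[of _ v] exI[of _ v'] exI[of _ t0]) auto
    qed (use X k in auto)
  qed
  have right: "\<exists>v v'. weak_sol F q s v v' \<and> (\<forall>t\<in>{0..T}. u t < v t)"
    if l: "lower_sol F q s' u u'" "s < s'" "ereal abar * \<omega>p < ereal s" for s s' u u'
  proof -
    obtain k where k: "\<omega>p < ereal k" "k * integral {0..T} a < s * T" using level[OF l(3)] by blast
    obtain X where X: "\<forall>x\<ge>X. q x \<le> k" using far_p[OF k(1)] by blast
    show ?thesis
    proof (rule exists_sol_beside_lower_sol[OF F q Q l(1,2), of 1 X k])
      fix v v' \<gamma> t0 assume v: "weak_sol F q s v v'" "\<gamma> > 0" "\<And>t. t \<in> {0..T} \<Longrightarrow> u t + 1 * \<gamma> \<le> v t"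
      then have "u t < v t" if "t \<in> {0..T}" for t using v(3)[OF that] v(2) by simp
      then show ?thesis using v(1) by blast
    qed (use X k in auto)
  qed
  have ord: "ereal abar * \<omega>m \<le> ereal abar * max \<omega>m \<omega>p" "ereal abar * \<omega>p \<le> ereal abar * max \<omega>m \<omega>p"
    using abar_pos by (auto intro!: ereal_mult_left_mono)
  have l0: "lower_sol F q s1 (\<lambda>_. u0) (\<lambda>_. 0)"
    unfolding lower_sol_def
  proof (intro conjI ballI)
    fix t r assume t: "t \<in> {0..T}" "r \<in> {0..t}"
    have int: "rhs q s1 (\<lambda>_. u0) integrable_on {r..t}"
      using rhs_integrable_continuous(2)[OF continuous_on_const q, of s1 u0] t
      by (auto intro: integrable_on_subinterval simp: absolutely_integrable_on_def)
    have "integral {r..t} (rhs q s1 (\<lambda>_. u0)) \<le> integral {r..t} (\<lambda>_. 0)"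
      using low t by (intro integral_le int) (auto simp: rhs_def)
    then show "integral {r..t} (rhs q s1 (\<lambda>_. u0)) \<le> \<phi> 0 + F u0 - (\<phi> 0 + F u0)" by simp
  qed auto
  have below_s1: "s \<in> S" if "ereal abar * max \<omega>m \<omega>p < ereal s" "s < s1" for s
    using left[OF l0 that(2)] that(1) ord(1) unfolding S_def by (auto intro: order_le_less_trans)
  \<comment> \<open>A level below \<open>s1\<close> but above the critical mean. It shows that
    \<open>S\<close> is nonempty and serves as the uniform lower bound of the levels that approach
    \<open>s0\<close>.\<close>
  obtain s2 where s2: "ereal abar * max \<omega>m \<omega>p < ereal s2" "s2 < s1"
    using ereal_dense2[OF s1] by auto
  have S_ne: "S \<noteq> {}" using below_s1[OF s2] by blast
  define s0 where "s0 = Sup S"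
  have s1_le: "s1 \<le> s0"
  proof (rule dense_le_bounded[OF s2(2)])
    fix s assume "s2 < s" "s < s1"
    then have "s \<in> S" using s2(1) by (intro below_s1) (auto intro: less_trans)
    then show "s \<le> s0" unfolding s0_def by (intro cSup_upper bdd)
  qed
  have at_s0: "\<exists>u u'. weak_sol F q s0 u u'"
  proof -
    have "\<exists>s\<in>S. max s2 (s0 - 1 / Suc n) < s" for n
    proof -
      have "max s2 (s0 - 1 / Suc n) < Sup S" using s2(2) s1_le by (simp add: s0_def)
      then show ?thesis using less_cSup_iff[OF S_ne bdd] by blast
    qed
    then obtain \<sigma> where \<sigma>: "\<And>n. \<sigma> n \<in> S" "\<And>n. max s2 (s0 - 1 / Suc n) < \<sigma> n" by metis
    then obtain u u' where w: "\<And>n. weak_sol F q (\<sigma> n) (u n) (u' n)"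
      unfolding S_def by simp metis
    have \<sigma>_le: "\<sigma> n \<le> s0" for n unfolding s0_def by (intro cSup_upper bdd \<sigma>)
    have \<sigma>_ge: "s2 \<le> \<sigma> n" for n using \<sigma>(2)[of n] by simp
    have \<sigma>_lim: "\<sigma> \<longlonglongrightarrow> s0"
    proof (rule tendsto_sandwich)
      show "\<forall>\<^sub>F n in sequentially. s0 - 1 / Suc n \<le> \<sigma> n"
        using \<sigma>(2) by (auto intro!: always_eventually less_imp_le)
      have "(\<lambda>n. s0 - 1 / Suc n) \<longlonglongrightarrow> s0 - 0"
        by (intro tendsto_diff tendsto_const LIMSEQ_Suc[OF lim_1_over_n])
      then show "(\<lambda>n. s0 - 1 / Suc n) \<longlonglongrightarrow> s0" by simp
    qed (use \<sigma>_le in auto)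
    obtain k where k: "max \<omega>m \<omega>p < ereal k" "k * integral {0..T} a < s2 * T" using level[OF s2(1)] by blast
    obtain X where X: "\<forall>x\<ge>X. q x \<le> k" using far_p[of k] k(1) by auto
    obtain Y where Y: "\<forall>x. Y \<le> - x \<longrightarrow> q x \<le> k" using far_m[of k] k(1) by auto
    obtain R where "R \<ge> 0" and R: "\<And>F q s u u' t t'. weak_sol F q s u u' \<Longrightarrow> continuous_on UNIV F \<Longrightarrow> continuous_on UNIV q \<Longrightarrow>
       (\<And>x. q x \<le> Q) \<Longrightarrow> 0 \<le> Q \<Longrightarrow> s2 \<le> s \<Longrightarrow> t \<in> {0..T} \<Longrightarrow> t' \<in> {0..T} \<Longrightarrow> \<bar>u t - u t'\<bar> \<le> R"
      using oscillation_bound[of Q s2] by blast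
    have bound: "\<bar>u n t\<bar> \<le> \<bar>X\<bar> + \<bar>Y\<bar> + R" if t: "t \<in> {0..T}" for n t
    proof -
      \<comment> \<open>Otherwise the mean value of \<open>a q(u n)\<close> would force a level
        below \<open>s2\<close>. At such an \<open>r\<close> the value of \<open>u n\<close> is
        confined between \<open>- Y\<close> and \<open>X\<close>, and the oscillation bound extends
        this to the whole period.\<close>
      have "\<exists>r\<in>{0..T}. k < q (u n r)"
      proof (rule ccontr)
        assume no: "\<not> (\<exists>r\<in>{0..T}. k < q (u n r))"
        have "integral {0..T} (\<lambda>t. a t * q (u n t)) \<le> integral {0..T} (\<lambda>t. a t * k)"
        proof (rule integral_le)
          show "(\<lambda>t. a t * q (u n t)) integrable_on {0..T}"
            using rhs_integrable_continuous(1)[OF weak_solD(3)[OF w] q] by (simp add: absolutely_integrable_on_def)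
          show "(\<lambda>t. a t * k) integrable_on {0..T}"
            using integrable_a_mult[of "\<lambda>_. k" "\<bar>k\<bar>"] by (simp add: absolutely_integrable_on_def)
          show "a t * q (u n t) \<le> a t * k" if "t \<in> {0..T}" for t
            using a_bounds[OF that] no that by (intro mult_left_mono) (auto simp: not_less)
        qed
        then have "\<sigma> n * T \<le> k * integral {0..T} a"
          using weak_sol_mean[OF w q, of n] by (simp add: mult.commute)
        moreover have "s2 * T \<le> \<sigma> n * T" using \<sigma>_ge T by simp
        ultimately show False using k(2) by linarith
      qed
      then obtain r where r: "r \<in> {0..T}" "k < q (u n r)" by blast
      have "u n r < X" "- u n r < Y" using X Y r(2) by (meson not_less)+
      moreover have "\<bar>u n t - u n r\<bar> \<le> R" using Q by (intro R[OF w F_cont q _ _ \<sigma>_ge t r(1)])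
      ultimately show ?thesis by linarith
    qed
    show ?thesis by (rule weak_sol_compactness[OF F_cont q Q w \<sigma>_ge \<sigma>_lim bound])
  qed
  have below: "\<exists>s' u u'. s < s' \<and> lower_sol F q s' u u'" if s: "s < s0" for s
  proof -
    obtain s' where "s' \<in> S" "s < s'" using s less_cSup_iff[OF S_ne bdd] unfolding s0_def by blast
    then show ?thesis unfolding S_def using weak_sol_imp_lower_sol[OF _ q] by blast
  qed
  show ?thesis
  proof (intro exI[of _ s0] conjI allI impI at_s0; (elim conjE)?)
    show "ereal abar * \<omega>m < ereal s0"
      using ord(1) s1 s1_le by (meson ereal_less_eq(3) order_le_less_trans order_less_le_trans)
    show "\<nexists>u u'. weak_sol F q s u u'" if "s0 < s" for s
      using that cSup_upper[OF _ bdd, of s] unfolding s0_def S_def by fastforce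
    show "\<exists>u u'. weak_sol F q s u u'" if "ereal abar * \<omega>m < ereal s" "s < s0" for s
      using below[OF that(2)] left that(1) by blast
    fix s assume s: "ereal abar * max \<omega>m \<omega>p < ereal s" "s < s0"
    obtain s' u u' where u: "s < s'" "lower_sol F q s' u u'" using below[OF s(2)] by blast
    obtain v v' t0 where v: "weak_sol F q s v v'" "t0 \<in> {0..T}" "v t0 < u t0"
      using left[OF u(2,1)] s(1) ord(1) by (meson order_le_less_trans)
    obtain w w' where w: "weak_sol F q s w w'" "\<forall>t\<in>{0..T}. u t < w t"
      using right[OF u(2,1)] s(1) ord(2) by (meson order_le_less_trans)
    have "v t0 \<noteq> w t0" using v(2,3) w(2) by force
    then show "\<exists>u u' w w'. weak_sol F q s u u' \<and> weak_sol F q s w w' \<and> (\<exists>t\<in>{0..T}. u t \<noteq> w t)"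
      using v w by blast
  qed
qed

end

section \<open>From hypotheses almost everywhere to pointwise ones\<close>

lemma periodic_solution_cong_AE:
  assumes "AE t in lebesgue. t \<in> {0..T} \<longrightarrow> a t = a' t" "AE t in lebesgue. t \<in> {0..T} \<longrightarrow> e t = e' t"
    and "periodic_solution T phi f a q e s u"
  shows "periodic_solution T phi f a' q e' s u"
proof -
  obtain u' where u: "\<forall>t\<in>{0..T}. (u has_real_derivative u' t) (at t within {0..T})" "continuous_on {0..T} u'"
      "u 0 = u T" "u' 0 = u' T" "abs_cont_on 0 T (\<lambda>t. phi (u' t))"
    and ae: "AE t in lebesgue. t \<in> {0..T} \<longrightarrow> ((\<lambda>r. phi (u' r)) has_real_derivative
                 (s + e t - f (u t) * u' t - a t * q (u t))) (at t within {0..T})"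
    using assms(3) unfolding periodic_solution_def by blast
  have "AE t in lebesgue. t \<in> {0..T} \<longrightarrow> ((\<lambda>r. phi (u' r)) has_real_derivative
                 (s + e' t - f (u t) * u' t - a' t * q (u t))) (at t within {0..T})"
    using ae assms(1,2) by eventually_elim auto
  then show ?thesis unfolding periodic_solution_def using u by blast
qed

text \<open>Over a null set the essential supremum of zero would be \<open>-\<infinity>\<close>, so
  the positive length of the interval is essential.\<close>

lemma Linf_norm_nonneg:
  assumes "T > 0" shows "0 \<le> Linf_norm T g"
proof -
  have "emeasure (lebesgue_on {0..T}) (space (lebesgue_on {0..T})) \<noteq> 0"
    using assms by (simp add: emeasure_restrict_space)
  then have "0 = esssup (lebesgue_on {0..T}) (\<lambda>_. 0 :: ereal)"
    by (rule esssup_const[symmetric])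
  also have "\<dots> \<le> Linf_norm T g"
    unfolding Linf_norm_def by (rule esssup_mono) auto
  finally show ?thesis .
qed

lemma AE_abs_le_Linf_norm:
  "AE t in lebesgue. t \<in> {0..T} \<longrightarrow> ereal \<bar>g t\<bar> \<le> Linf_norm T g"
  using esssup_AE[where M = "lebesgue_on {0..T}" and f = "\<lambda>t. ereal \<bar>g t\<bar>"]
  unfolding Linf_norm_def by (subst (asm) AE_restrict_space_iff) auto

theorem theorem4p3:
  fixes T :: real and phi f q a e :: "real \<Rightarrow> real"
    and \<omega>p \<omega>m :: ereal and u0 :: real
  assumes T: "T > 0"
    and phi_mono: "strict_mono phi" and phi_homeo: "\<exists>g. homeomorphism UNIV UNIV phi g"
    and phi0: "phi 0 = 0"
    and f_cont: "continuous_on UNIV f" and q_cont: "continuous_on UNIV q"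
    and a_meas: "set_borel_measurable lebesgue {0..T} a"
    and a_Linf: "Linf_norm T a < \<infinity>"
    and a_nonneg: "AE t in lebesgue. t \<in> {0..T} \<longrightarrow> a t \<ge> 0"
    and a_mean: "(1 / T) * (LINT t:{0..T}|lebesgue. a t) > 0"
    and e_L1: "set_integrable lebesgue {0..T} e"
    and e_mean: "(1 / T) * (LINT t:{0..T}|lebesgue. e t) = 0"
    and lim_p: "((\<lambda>u. ereal (q u)) \<longlongrightarrow> \<omega>p) at_top"
    and lim_m: "((\<lambda>u. ereal (q u)) \<longlongrightarrow> \<omega>m) at_bot"
    and u0_le: "q u0 \<le> 0"
    and u0_gt: "ereal (q u0) > max \<omega>p \<omega>m"
    and cond: "ereal ((1 / T) * (LINT t:{0..T}|lebesgue. a t)) * max \<omega>m \<omega>p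
                 < Linf_norm T a * ereal (q u0) - Linf_norm T (\<lambda>t. max (e t) 0)"
  shows "\<exists>s0::real.
     ereal ((1 / T) * (LINT t:{0..T}|lebesgue. a t)) * \<omega>m < ereal s0 \<and>
     (\<forall>s. s > s0 \<longrightarrow> \<not> (\<exists>u. periodic_solution T phi f a q e s u)) \<and>
     (\<exists>u. periodic_solution T phi f a q e s0 u) \<and>
     (\<forall>s. ereal ((1 / T) * (LINT t:{0..T}|lebesgue. a t)) * \<omega>m < ereal s \<and> s < s0
          \<longrightarrow> (\<exists>u. periodic_solution T phi f a q e s u)) \<and>
     (\<forall>s. ereal ((1 / T) * (LINT t:{0..T}|lebesgue. a t)) * max \<omega>m \<omega>p < ereal s \<and> s < s0
          \<longrightarrow> (\<exists>u1 u2. periodic_solution T phi f a q e s u1 \<and>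
                       periodic_solution T phi f a q e s u2 \<and>
                       (\<exists>t\<in>{0..T}. u1 t \<noteq> u2 t)))"
proof -
  obtain psi where psi: "homeomorphism UNIV UNIV phi psi" using phi_homeo by blast
  obtain A where A: "Linf_norm T a = ereal A"
    using a_Linf Linf_norm_nonneg[OF T, of a] by (cases "Linf_norm T a") auto
  \<comment> \<open>With an infinite norm the right-hand side of \<open>cond\<close> would be
    \<open>-\<infinity>\<close>; thus \<open>cond\<close> itself provides an upper bound for
    \<open>e\<close>.\<close>
  obtain E where E: "Linf_norm T (\<lambda>t. max (e t) 0) = ereal E"
  proof (cases "Linf_norm T (\<lambda>t. max (e t) 0)")
    case PInf
    then show thesis using cond by (simp add: A)
  qed (use Linf_norm_nonneg[OF T, of "\<lambda>t. max (e t) 0"] in auto)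
  have A0: "0 \<le> A" using Linf_norm_nonneg[OF T, of a] by (simp add: A)
  \<comment> \<open>Changing the coefficients on null sets makes \<open>0 \<le> a' t \<le> A\<close>
    and \<open>e' t \<le> E\<close> hold everywhere, with the same periodic solutions.\<close>
  define a' where "a' t = max 0 (min (a t) A)" for t
  define e' where "e' t = min (e t) E" for t
  have ae_a: "AE t in lebesgue. t \<in> {0..T} \<longrightarrow> a t = a' t"
    using AE_abs_le_Linf_norm[of T a] a_nonneg
    by eventually_elim (auto simp: A a'_def)
  have ae_e: "AE t in lebesgue. t \<in> {0..T} \<longrightarrow> e t = e' t"
    using AE_abs_le_Linf_norm[of T "\<lambda>t. max (e t) 0"]
    by eventually_elim (auto simp: E e'_def)
  obtain Na where Na: "negligible Na" "\<And>t. t \<in> {0..T} - Na \<Longrightarrow> a t = a' t"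
    using ae_a unfolding eventually_ae_filter_negligible by blast
  obtain Ne where Ne: "negligible Ne" "\<And>t. t \<in> {0..T} - Ne \<Longrightarrow> e t = e' t"
    using ae_e unfolding eventually_ae_filter_negligible by blast
  have a'_meas: "a' \<in> borel_measurable (lebesgue_on {0..T})"
  proof -
    have "a \<in> borel_measurable (lebesgue_on {0..T})"
      using a_meas by (simp add: set_borel_measurable_def borel_measurable_restrict_space_iff)
    then show ?thesis unfolding a'_def[abs_def]
      by (intro borel_measurable_max borel_measurable_min borel_measurable_const)
  qed
  have e'_int: "e' absolutely_integrable_on {0..T}"
    by (rule absolutely_integrable_spike[OF e_L1 Ne(1)]) (simp add: Ne(2))
  have e'_mean: "integral {0..T} e' = 0"
  proof -
    have "integral {0..T} e' = integral {0..T} e"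
      by (rule integral_spike[OF Ne(1)]) (simp add: Ne(2))
    also have "\<dots> = 0"
      using e_mean T set_lebesgue_integral_eq_integral(2)[OF e_L1] by simp
    finally show ?thesis .
  qed
  interpret periodic_phi_laplacian T phi psi a' e' A
  proof
    show "phi (psi y) = y" for y using psi by (simp add: homeomorphism_def)
    show "continuous_on UNIV phi" "continuous_on UNIV psi" using psi by (auto simp: homeomorphism_def)
  qed (use T phi_mono phi0 a'_meas A0 e'_int e'_mean in \<open>auto simp: a'_def\<close>)
  have a'_int: "a' absolutely_integrable_on {0..T}"
    using integrable_a_mult[of "\<lambda>_. 1" 1] by simp
  have a_int: "a absolutely_integrable_on {0..T}"
    by (rule absolutely_integrable_spike[OF a'_int Na(1)]) (simp add: Na(2))
  define abar where "abar = (1 / T) * (LINT t:{0..T}|lebesgue. a t)"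
  have abar: "abar = integral {0..T} a' / T"
  proof -
    have "integral {0..T} a = integral {0..T} a'"
      by (rule integral_spike[OF Na(1)]) (simp add: Na(2))
    then show ?thesis
      using set_lebesgue_integral_eq_integral(2)[OF a_int] by (simp add: abar_def)
  qed
  have a'_pos: "integral {0..T} a' > 0"
    using a_mean T unfolding abar_def[symmetric] abar by (simp add: zero_less_divide_iff)
  obtain F where F: "\<And>x. (F has_real_derivative f x) (at x)"
    using continuous_imp_antiderivative[OF f_cont] by blast
  \<comment> \<open>The right-hand side of \<open>cond\<close>. Since \<open>q u0 \<le> 0\<close>,
    replacing \<open>a' t\<close> by its bound \<open>A\<close> decreases
    \<open>a' t * q u0\<close>; together with \<open>e' t \<le> E\<close> this makes the constant
    \<open>u0\<close> a lower solution at level \<open>s1\<close>.\<close>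
  define s1 where "s1 = A * q u0 - E"
  have s1: "ereal abar * max \<omega>m \<omega>p < ereal s1"
    using cond by (simp add: A E s1_def abar_def)
  have low: "s1 + e' t - a' t * q u0 \<le> 0" if "t \<in> {0..T}" for t
  proof -
    have "A * q u0 \<le> a' t * q u0"
      using u0_le A0 by (intro mult_right_mono_neg) (auto simp: a'_def)
    then show ?thesis by (simp add: s1_def e'_def)
  qed
  have ae_sym: "AE t in lebesgue. t \<in> {0..T} \<longrightarrow> a' t = a t" "AE t in lebesgue. t \<in> {0..T} \<longrightarrow> e' t = e t"
    using ae_a ae_e by (auto elim: eventually_mono)
  have sol: "periodic_solution T phi f a q e s u \<longleftrightarrow> (\<exists>u'. weak_sol F q s u u')" for s u
    using periodic_solution_cong_AE[OF ae_a ae_e] periodic_solution_cong_AE[OF ae_sym]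
      periodic_solution_iff_weak_sol[OF F f_cont q_cont] by blast
  from multiplicity[OF F q_cont a'_pos lim_p lim_m u0_gt abar s1 low]
  show ?thesis
    unfolding sol abar_def[symmetric] by blast
qed

end
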